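(* Let $\mathcal{H}$ and $\mathcal{G}_i$, $i=1,\ldots,m$, be real Hilbert spaces, $f\in\Gamma(\mathcal{H})$, and $h:\mathcal{H}\to\mathbb{R}$ convex and differentiable with $\mu$-Lipschitzian gradient for some $\mu>0$. Let $z\in\mathcal{H}$ and, for every $i\in\{1,\ldots,m\}$, let $r_i\in\mathcal{G}_i$, let $g_i,l_i\in\Gamma(\mathcal{G}_i)$ with $l_i$ being $\nu_i^{-1}$-strongly convex for some $\nu_i>0$, and let $L_i:\mathcal{H}\to\mathcal{G}_i$ be a nonzero linear continuous operator. Consider $$(P)\quad \inf_{x\in\mathcal{H}}\Big\{f(x)+\sum_{i=1}^m (g_i\,\square\, l_i)(L_ix-r_i)+h(x)-\langle x,z\rangle\Big\}$$ and $$(D)\quad \sup_{(v_1,\ldots,v_m)\in\mathcal{G}_1\times\cdots\times\mathcal{G}_m}\Big\{-(f^*\,\square\, h^* )\Big(z-\sum_{i=1}^m L_i^*v_i\Big)-\sum_{i=1}^m\big(g_i^*(v_i)+l_i^*(v_i)+\langle v_i,r_i\rangle\big)\Big\}.$$ Suppose that $$z\in\operatorname{ran}\Big(\partial f+\sum_{i=1}^m L_i^*(\partial g_i\,\square\,\partial l_i)(L_i\cdot-r_i)+\nabla h\Big).$$ Let $x_0\in\mathcal{H}$, $(v_{1,0},\ldots,v_{m,0})\in\mathcal{G}_1\times\cdots\times\mathcal{G}_m$, $\beta=\max\{\mu,\nu_1,\ldots,\nu_m\}+\sqrt{\sum_{i=1}^m\|L_i\|^2}$, $\varepsilon\in\big(0,\frac{1}{\beta+1}\big)$,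 let $(\gamma_n)_{n\ge0}$ be a nondecreasing sequence in $\big[\varepsilon,\frac{1-\varepsilon}{\beta}\big]$, and define for all $n\ge0$ (and all $i=1,\ldots,m$) $$\begin{aligned} p_{1,n}&=\operatorname{Prox}_{\gamma_n f}\Big(x_n-\gamma_n\Big(\nabla h(x_n)+\sum_{i=1}^mL_i^*v_{i,n}-z\Big)\Big),\\ p_{2,i,n}&=\operatorname{Prox}_{\gamma_n g_i^*}\big(v_{i,n}+\gamma_n(L_ix_n-\nabla l_i^*(v_{i,n})-r_i)\big),\\ v_{i,n+1}&=\gamma_nL_i(p_{1,n}-x_n)+\gamma_n\big(\nabla l_i^*(v_{i,n})-\nabla l_i^*(p_{2,i,n})\big)+p_{2,i,n},\\ x_{n+1}&=\gamma_n\sum_{i=1}^mL_i^*(v_{i,n}-p_{2,i,n})+\gamma_n\big(\nabla h(x_n)-\nabla h(p_{1,n})\big)+p_{1,n}. \end{aligned}$$ Then there exist an optimal solution $\overline{x}\in\mathcal{H}$ to $(P)$ and an optimal solution $(\overline{v}_1,\ldots,\overline{v}_m)\in\mathcal{G}_1\times\cdots\times\mathcal{G}_m$ to $(D)$ such that: (a) $z-\sum_{i=1}^mL_i^*\overline{v}_i\in\partial f(\overline{x})+\nabla h(\overline{x})$ and $L_i\overline{x}-r_i\in\partial g_i^*(\overline{v}_i)+\nabla l_i^*(\overline{v}_i)$ for all $i\in\{1,\ldots,m\}$. (b) $x_n\rightharpoonup\overline{x}$, $p_{1,n}\rightharpoonup\overline{x}$, and $v_{i,n}\rightharpoonup\overline{v}_i$,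 $p_{2,i,n}\rightharpoonup\overline{v}_i$ for all $i\in\{1,\ldots,m\}$. (c) For every $n\ge0$, $$\frac{\|x_n-\overline{x}\|^2}{2\gamma_n}+\sum_{i=1}^m\frac{\|v_{i,n}-\overline{v}_i\|^2}{2\gamma_n}\le\frac{\|x_0-\overline{x}\|^2}{2\gamma_0}+\sum_{i=1}^m\frac{\|v_{i,0}-\overline{v}_i\|^2}{2\gamma_0}.$$ (d) If $B_1\subseteq\mathcal{H}$ and $B_2\subseteq\mathcal{G}_1\times\cdots\times\mathcal{G}_m$ are bounded, then for $x^N:=\frac1N\sum_{n=0}^{N-1}p_{1,n}$ and $v_i^N:=\frac1N\sum_{n=0}^{N-1}p_{2,i,n}$, $i=1,\ldots,m$, $N\ge1$, the primal-dual gap satisfies $$\mathcal{G}_{B_1\times B_2}(x^N,v_1^N,\ldots,v_m^N)\le\frac{C(B_1,B_2)}{N},$$ where $$C(B_1,B_2)=\sup_{(x,v_1,\ldots,v_m)\in B_1\times B_2}\Big\{\frac{\|x_0-x\|^2}{2\gamma_0}+\sum_{i=1}^m\frac{\|v_{i,0}-v_i\|^2}{2\gamma_0}\Big\}.$$ (e) The sequence $(x^N,v_1^N,\ldots,v_m^N)_{N\ge1}$ converges weakly to $(\overline{x},\overline{v}_1,\ldots,\overline{v}_m)$.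
   Context: $\Gamma(\mathcal{H})$ is the set of proper, convex, lower semicontinuous functions $\mathcal{H}\to\overline{\mathbb{R}}=\mathbb{R}\cup\{\pm\infty\}$. $f^*(p)=\sup_x\{\langle p,x\rangle-f(x)\}$ is the conjugate; $\partial f$ the convex subdifferential; $L_i^*$ the adjoint of $L_i$. For functions, $(f\,\square\,g)(x)=\inf_y\{f(y)+g(x-y)\}$ is the infimal convolution; for set-valued operators, $M_1\,\square\,M_2=(M_1^{-1}+M_2^{-1})^{-1}$ is the parallel sum, where $M^{-1}(u)=\{x: u\in Mx\}$. $\operatorname{ran}M=\{u:\exists x,\ u\in Mx\}$. $\operatorname{Prox}_{\gamma f}(x)$ is the unique minimizer of $y\mapsto f(y)+\frac{1}{2\gamma}\|y-x\|^2$. Since $l_i$ is $\nu_i^{-1}$-strongly convex, $l_i^*$ is everywhere differentiable with $\nu_i$-Lipschitzian gradient. $\rightharpoonup$ denotes weak convergence. The product $\mathcal{G}_1\times\cdots\times\mathcal{G}_m$ carries the inner product $\langle \boldsymbol{p},\boldsymbol{q}\rangle=\sum_i\langle p_i,q_i\rangle$. Write $\boldsymbol{L}x=(L_1x,\ldots,L_mx)$, $\boldsymbol{r}=(r_1,\ldots,r_m)$, $F(x)=f(x)+h(x)-\langle x,z\rangle$, $G(\boldsymbol{y})=\sum_{i=1}^m(g_i\,\square\,l_i)(y_i)$, so that $G^*(\boldsymbol{v})=\sum_{i=1}^m(g_i^*+l_i^* )(v_i)$. For $B_1\subseteq\mathcal{H}$ and $B_2\subseteq\mathcal{G}_1\times\cdots\times\mathcal{G}_m$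 the primal-dual gap function is $$\mathcal{G}_{B_1\times B_2}(x,\boldsymbol{v})=\sup_{\tilde{\boldsymbol{v}}\in B_2}\{\langle\boldsymbol{L}x-\boldsymbol{r},\tilde{\boldsymbol{v}}\rangle+F(x)-G^*(\tilde{\boldsymbol{v}})\}-\inf_{\tilde{x}\in B_1}\{\langle\boldsymbol{L}\tilde{x}-\boldsymbol{r},\boldsymbol{v}\rangle+F(\tilde{x})-G^*(\boldsymbol{v})\}.$$ *)

theory Defs
  imports "HOL-Analysis.Analysis" "HOL-Library.Set_Algebras"
begin

text \<open>
  A real Hilbert space is either a type of sort \<open>{real_inner, complete_space}\<close> or a closed linear
  subspace \<open>V\<close> of such a type. The second form renders a family \<open>(G i)\<close> of possibly different
  Hilbert spaces: every finite family of Hilbert spaces sits, up to isometry, as closed subspaces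
  inside one Hilbert space (their direct sum). The convex-analytic notions below therefore take the
  underlying space \<open>V\<close> as a parameter (\<open>UNIV\<close> for a whole type), and never look at the values of a
  function outside \<open>V\<close>.
\<close>

section \<open>Convex analysis on a Hilbert space\<close>

definition proper_on :: "'a set \<Rightarrow> ('a \<Rightarrow> ereal) \<Rightarrow> bool" where
  "proper_on V f \<longleftrightarrow> (\<forall>x\<in>V. f x \<noteq> -\<infinity>) \<and> (\<exists>x\<in>V. f x \<noteq> \<infinity>)"

definition econvex_on :: "'a::real_vector set \<Rightarrow> ('a \<Rightarrow> ereal) \<Rightarrow> bool" where
  "econvex_on V f \<longleftrightarrow> (\<forall>x\<in>V. \<forall>y\<in>V. \<forall>t\<in>{0<..<1}.
     f (t *\<^sub>R x + (1 - t) *\<^sub>R y) \<le> ereal t * f x + ereal (1 - t) * f y)"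

definition lsc_on :: "'a::topological_space set \<Rightarrow> ('a \<Rightarrow> ereal) \<Rightarrow> bool" where
  "lsc_on V f \<longleftrightarrow> (\<forall>x\<in>V. f x \<le> Liminf (at x within V) f)"

definition Gamma_on :: "'a::real_inner set \<Rightarrow> ('a \<Rightarrow> ereal) set" where
  "Gamma_on V = {f. proper_on V f \<and> econvex_on V f \<and> lsc_on V f}"

definition strongly_convex_on :: "real \<Rightarrow> 'a::real_inner set \<Rightarrow> ('a \<Rightarrow> ereal) \<Rightarrow> bool" where
  "strongly_convex_on \<rho> V f \<longleftrightarrow> (\<forall>x\<in>V. \<forall>y\<in>V. \<forall>t\<in>{0<..<1}.
     f (t *\<^sub>R x + (1 - t) *\<^sub>R y) + ereal (\<rho> / 2 * t * (1 - t) * (norm (x - y))\<^sup>2)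
       \<le> ereal t * f x + ereal (1 - t) * f y)"

definition conjugate_on :: "'a::real_inner set \<Rightarrow> ('a \<Rightarrow> ereal) \<Rightarrow> 'a \<Rightarrow> ereal" where
  "conjugate_on V f p = (SUP x\<in>V. ereal (p \<bullet> x) - f x)"

definition infconv_on :: "'a::real_inner set \<Rightarrow> ('a \<Rightarrow> ereal) \<Rightarrow> ('a \<Rightarrow> ereal) \<Rightarrow> 'a \<Rightarrow> ereal" where
  "infconv_on V f g x = (INF y\<in>V. f y + g (x - y))"

text \<open>As usual, the subdifferential is empty at points where the function is not finite.\<close>

definition subdiff_on :: "'a::real_inner set \<Rightarrow> ('a \<Rightarrow> ereal) \<Rightarrow> 'a \<Rightarrow> 'a set" where
  "subdiff_on V f x =
     {u\<in>V. x \<in> V \<and> \<bar>f x\<bar> \<noteq> \<infinity> \<and> (\<forall>y\<in>V. f x + ereal (u \<bullet> (y - x)) \<le> f y)}"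

definition prox_on :: "'a::real_inner set \<Rightarrow> real \<Rightarrow> ('a \<Rightarrow> ereal) \<Rightarrow> 'a \<Rightarrow> 'a" where
  "prox_on V \<gamma> f x =
     (THE p. is_arg_min (\<lambda>y. f y + ereal (1 / (2 * \<gamma>) * (norm (y - x))\<^sup>2)) (\<lambda>y. y \<in> V) p)"

text \<open>
  The gradient of a real-valued function on the Hilbert space \<open>V\<close>, i.e. the vector of \<open>V\<close>
  representing the Frechet derivative relative to \<open>V\<close>; it is meaningful only where that derivative
  exists.
\<close>

definition gradient_on :: "'a::real_inner set \<Rightarrow> ('a \<Rightarrow> real) \<Rightarrow> 'a \<Rightarrow> 'a" where
  "gradient_on V f x = (THE D. D \<in> V \<and> (f has_derivative (\<lambda>d. D \<bullet> d)) (at x within V))"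

text \<open>
  For strongly convex \<open>l\<close> the conjugate is finite everywhere on \<open>V\<close>, so \<open>real_of_ereal\<close> loses nothing.
\<close>

definition grad_conj_on :: "'a::real_inner set \<Rightarrow> ('a \<Rightarrow> ereal) \<Rightarrow> 'a \<Rightarrow> 'a" where
  "grad_conj_on V l = gradient_on V (\<lambda>v. real_of_ereal (conjugate_on V l v))"

definition weakly_tendsto :: "(nat \<Rightarrow> 'a::real_inner) \<Rightarrow> 'a \<Rightarrow> bool" where
  "weakly_tendsto X x \<longleftrightarrow> (\<forall>u. (\<lambda>n. X n \<bullet> u) \<longlonglongrightarrow> x \<bullet> u)"

section \<open>Set-valued operators\<close>

text \<open>Sums of operators are pointwise Minkowski sums, as provided by \<open>HOL-Library.Set_Algebras\<close>.\<close>

definition op_inverse :: "('a \<Rightarrow> 'b set) \<Rightarrow> 'b \<Rightarrow> 'a set" where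
  "op_inverse M u = {x. u \<in> M x}"

definition op_ran :: "('a \<Rightarrow> 'b set) \<Rightarrow> 'b set" where
  "op_ran M = {u. \<exists>x. u \<in> M x}"

definition parallel_sum :: "('a::plus \<Rightarrow> 'b set) \<Rightarrow> ('a \<Rightarrow> 'b set) \<Rightarrow> 'a \<Rightarrow> 'b set" where
  "parallel_sum M1 M2 = op_inverse (\<lambda>u. op_inverse M1 u + op_inverse M2 u)"

section \<open>The primal-dual pair and its gap function\<close>

text \<open>
  The index set \<open>{1,\<dots>,m}\<close> is a finite type \<open>'m\<close>, so that \<open>m = CARD('m) \<ge> 1\<close>, and the product of the
  spaces \<open>G i\<close> is a closed subspace of \<open>'g ^ 'm\<close>, whose inner product is the sum of the
  componentwise inner products. For \<open>L i\<close> mapping into \<open>G i\<close>, the library's \<open>adjoint (L i)\<close>,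
  restricted to \<open>G i\<close>, is the adjoint of \<open>L i\<close> regarded as an operator into \<open>G i\<close>.
\<close>

definition prod_space :: "('m::finite \<Rightarrow> 'g set) \<Rightarrow> ('g ^ 'm) set" where
  "prod_space G = {v. \<forall>i. v $ i \<in> G i}"

definition stack_op :: "('m::finite \<Rightarrow> 'h \<Rightarrow> 'g) \<Rightarrow> 'h \<Rightarrow> 'g ^ 'm" where
  "stack_op L x = (\<chi> i. L i x)"

definition primal_F :: "('h::real_inner \<Rightarrow> ereal) \<Rightarrow> ('h \<Rightarrow> real) \<Rightarrow> 'h \<Rightarrow> 'h \<Rightarrow> ereal" where
  "primal_F f h z x = f x + ereal (h x) - ereal (x \<bullet> z)"

definition primal_G :: "('m::finite \<Rightarrow> 'g::real_inner set) \<Rightarrow> ('m \<Rightarrow> 'g \<Rightarrow> ereal) \<Rightarrow>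
    ('m \<Rightarrow> 'g \<Rightarrow> ereal) \<Rightarrow> 'g ^ 'm \<Rightarrow> ereal" where
  "primal_G G g l y = (\<Sum>i\<in>UNIV. infconv_on (G i) (g i) (l i) (y $ i))"

definition primal_obj :: "('m::finite \<Rightarrow> 'g::real_inner set) \<Rightarrow> ('h::real_inner \<Rightarrow> ereal) \<Rightarrow>
    ('h \<Rightarrow> real) \<Rightarrow> 'h \<Rightarrow> ('m \<Rightarrow> 'g \<Rightarrow> ereal) \<Rightarrow> ('m \<Rightarrow> 'g \<Rightarrow> ereal) \<Rightarrow> ('m \<Rightarrow> 'h \<Rightarrow> 'g) \<Rightarrow>
    'g ^ 'm \<Rightarrow> 'h \<Rightarrow> ereal" where
  "primal_obj G f h z g l L r x =
     f x + (\<Sum>i\<in>UNIV. infconv_on (G i) (g i) (l i) (L i x - r $ i)) + ereal (h x) - ereal (x \<bullet> z)"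

definition dual_obj :: "('m::finite \<Rightarrow> 'g::real_inner set) \<Rightarrow> ('h::real_inner \<Rightarrow> ereal) \<Rightarrow>
    ('h \<Rightarrow> real) \<Rightarrow> 'h \<Rightarrow> ('m \<Rightarrow> 'g \<Rightarrow> ereal) \<Rightarrow> ('m \<Rightarrow> 'g \<Rightarrow> ereal) \<Rightarrow> ('m \<Rightarrow> 'h \<Rightarrow> 'g) \<Rightarrow>
    'g ^ 'm \<Rightarrow> 'g ^ 'm \<Rightarrow> ereal" where
  "dual_obj G f h z g l L r v =
     - infconv_on UNIV (conjugate_on UNIV f) (conjugate_on UNIV (\<lambda>x. ereal (h x)))
         (z - (\<Sum>i\<in>UNIV. adjoint (L i) (v $ i)))
     - (\<Sum>i\<in>UNIV. conjugate_on (G i) (g i) (v $ i) + conjugate_on (G i) (l i) (v $ i)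
                   + ereal (v $ i \<bullet> r $ i))"

definition pd_gap :: "('m::finite \<Rightarrow> 'g::real_inner set) \<Rightarrow> ('h::real_inner \<Rightarrow> ereal) \<Rightarrow>
    ('h \<Rightarrow> real) \<Rightarrow> 'h \<Rightarrow> ('m \<Rightarrow> 'g \<Rightarrow> ereal) \<Rightarrow> ('m \<Rightarrow> 'g \<Rightarrow> ereal) \<Rightarrow> ('m \<Rightarrow> 'h \<Rightarrow> 'g) \<Rightarrow>
    'g ^ 'm \<Rightarrow> 'h set \<Rightarrow> ('g ^ 'm) set \<Rightarrow> 'h \<Rightarrow> 'g ^ 'm \<Rightarrow> ereal" where
  "pd_gap G f h z g l L r B1 B2 x v =
     (SUP v'\<in>B2. ereal ((stack_op L x - r) \<bullet> v') + primal_F f h z x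
                  - conjugate_on (prod_space G) (primal_G G g l) v')
   - (INF x'\<in>B1. ereal ((stack_op L x' - r) \<bullet> v) + primal_F f h z x'
                  - conjugate_on (prod_space G) (primal_G G g l) v)"

definition gap_const :: "real \<Rightarrow> 'h::real_inner \<Rightarrow> ('g::real_inner) ^ 'm::finite \<Rightarrow> 'h set \<Rightarrow>
    ('g ^ 'm) set \<Rightarrow> ereal" where
  "gap_const \<gamma>0 x0 v0 B1 B2 =
     (SUP (x, v)\<in>B1 \<times> B2. ereal ((norm (x0 - x))\<^sup>2 / (2 * \<gamma>0)
        + (\<Sum>i\<in>UNIV. (norm (v0 $ i - v $ i))\<^sup>2 / (2 * \<gamma>0))))"

definition ergodic :: "(nat \<Rightarrow> 'a::real_vector) \<Rightarrow> nat \<Rightarrow> 'a" where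
  "ergodic p N = (1 / real N) *\<^sub>R (\<Sum>n<N. p n)"

end

theory Submission
  imports Defs
begin

text \<open>
  On the product Hilbert space \<open>H \<times> (G\<^sub>1 \<times> \<dots> \<times> G\<^sub>m)\<close> put \<open>w = (x, v)\<close> and
  \<^item> \<open>A (x, v) = (\<partial>f x - z) \<times> (\<partial>g\<^sub>i* v\<^sub>i + r\<^sub>i)\<^sub>i\<close>,
  \<^item> \<open>B (x, v) = (\<nabla>h x + L*v, (\<nabla>l\<^sub>i* v\<^sub>i - L\<^sub>i x)\<^sub>i)\<close>.

  The optimality system (a) says exactly that \<open>0 \<in> A w + B w\<close>. The operator \<open>A\<close> is monotone with
  everywhere defined resolvents, which are built from the two proximity operators. The operator \<open>B\<close> is
  monotone, being a gradient plus a skew operator, and Lipschitz: the gradient contributes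
  \<open>max {\<mu>, \<nu>\<^sub>1, \<dots>, \<nu>\<^sub>m}\<close>, the skew part \<open>sqrt (\<Sum> \<parallel>L\<^sub>i\<parallel>\<^sup>2)\<close>, and the sum is \<open>\<beta>\<close>. The iteration is Tseng's
  forward-backward-forward method for \<open>A + B\<close>: with \<open>p = (p\<^sub>1, p\<^sub>2)\<close>,
  \<open>p\<^sub>n = (Id + \<gamma>\<^sub>n A)\<^sup>-\<^sup>1 (w\<^sub>n - \<gamma>\<^sub>n B w\<^sub>n)\<close> and \<open>w\<^sub>n\<^sub>+\<^sub>1 = p\<^sub>n + \<gamma>\<^sub>n (B w\<^sub>n - B p\<^sub>n)\<close>.

  Everything rests on two observations: \<open>(w\<^sub>n - w\<^sub>n\<^sub>+\<^sub>1) / \<gamma>\<^sub>n\<close> lies in \<open>A p\<^sub>n + B p\<^sub>n\<close>, and, because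
  \<open>\<gamma>\<^sub>n \<beta> \<le> 1 - \<epsilon>\<close>, for every point \<open>s\<close> (\<open>step_estimate\<close>)

    \<open>2 \<langle>w\<^sub>n - w\<^sub>n\<^sub>+\<^sub>1, p\<^sub>n - s\<rangle> \<le> \<parallel>w\<^sub>n - s\<parallel>\<^sup>2 - \<parallel>w\<^sub>n\<^sub>+\<^sub>1 - s\<parallel>\<^sup>2 - \<epsilon> \<parallel>w\<^sub>n - p\<^sub>n\<parallel>\<^sup>2\<close>.

  If \<open>s\<close> is a zero of \<open>A + B\<close>, monotonicity makes the left-hand side nonnegative. So the distances to \<open>s\<close>
  decrease, which with \<open>\<gamma>\<^sub>0 \<le> \<gamma>\<^sub>n\<close> is (c), and \<open>w\<^sub>n - p\<^sub>n \<rightarrow> 0\<close>. Weak cluster points are zeros because the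
  graph of \<open>A + B\<close> is weakly-strongly closed (\<open>demiclosed_sum\<close>), and Opial's argument (\<open>opial\<close>) yields
  weak convergence of the whole sequence, that is (b); the means converge to the same limit, which is (e).

  If \<open>s = (x', v')\<close> is arbitrary, convexity of \<open>f\<close>, \<open>h\<close>, \<open>g\<^sub>i*\<close> and \<open>l\<^sub>i*\<close> bounds the gap integrand at
  \<open>p\<^sub>n\<close> by the left-hand side divided by \<open>2 \<gamma>\<^sub>n\<close>, since the bilinear coupling terms come precisely from
  the skew part of \<open>B\<close> (\<open>saddle_estimate\<close>). As \<open>1 / \<gamma>\<^sub>n\<close> is nonincreasing, summation over \<open>n < N\<close>
  telescopes to at most \<open>\<parallel>w\<^sub>0 - s\<parallel>\<^sup>2 / (2 \<gamma>\<^sub>0)\<close>, and Jensen's inequality for the means gives (d). With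
  residual \<open>0\<close> the same estimate is the saddle point property, from which optimality for the primal and
  for the dual problem follows.

  The Hilbert space facts below have a common source: a proper lower semicontinuous strongly
  convex function attains its minimum (\<open>strongly_convex_attains_min\<close>), because minimizing sequences are
  Cauchy. This provides the proximity points, Riesz representation (hence adjoints and gradients),
  the inversion \<open>u \<in> \<partial>f x \<longleftrightarrow> x \<in> \<partial>f* u\<close>, and the differentiability of \<open>l\<^sub>i*\<close>.
\<close>

section \<open>Minimizing strongly convex functions\<close>

lemma lsc_on_ballE:
  fixes f :: "'a::metric_space \<Rightarrow> ereal"
  assumes "lsc_on V f" "x \<in> V" "c < f x"
  obtains \<delta> where "\<delta> > 0" "\<And>y. y \<in> V \<Longrightarrow> dist y x < \<delta> \<Longrightarrow> c < f y"
proof -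
  have "f x \<le> Liminf (at x within V) f"
    using assms by (auto simp: lsc_on_def)
  then have "eventually (\<lambda>y. c < f y) (at x within V)"
    using assms(3) by (simp add: le_Liminf_iff)
  then obtain \<delta> where "\<delta> > 0" "\<And>y. y \<in> V \<Longrightarrow> y \<noteq> x \<Longrightarrow> dist y x < \<delta> \<Longrightarrow> c < f y"
    by (auto simp: eventually_at)
  then show ?thesis
    using that[of \<delta>] assms(3) by metis
qed

lemma lsc_on_ballI:
  fixes f :: "'a::metric_space \<Rightarrow> ereal"
  assumes "\<And>x c. x \<in> V \<Longrightarrow> c < f x \<Longrightarrow> \<exists>\<delta>>0. \<forall>y\<in>V. dist y x < \<delta> \<longrightarrow> c < f y"
  shows "lsc_on V f"
  unfolding lsc_on_def le_Liminf_iff eventually_at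
  using assms by blast

lemma norm_convex_combination_sq:
  fixes a b :: "'a::real_inner"
  shows "(norm (t *\<^sub>R a + (1 - t) *\<^sub>R b))\<^sup>2
    = t * (norm a)\<^sup>2 + (1 - t) * (norm b)\<^sup>2 - t * (1 - t) * (norm (a - b))\<^sup>2"
  unfolding power2_norm_eq_inner
  by (simp add: inner_add_left inner_add_right inner_diff_left inner_diff_right inner_commute)
     (simp add: algebra_simps)

text \<open>
  Lower semicontinuity bounds \<open>\<phi>\<close> below on a small ball around a point \<open>x0\<close> of its domain. Along the
  segment from \<open>x0\<close> to a distant \<open>y\<close>, convexity carries this bound to \<open>y\<close> at the price of a term linear in
  the distance \<open>d\<close>, and the quadratic term of strong convexity outweighs it. No supporting
  hyperplane is used, so the lemma can serve to produce subgradients.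
\<close>

lemma strongly_convex_bounded_below:
  fixes \<phi> :: "'a::real_inner \<Rightarrow> ereal"
  assumes V: "subspace V" and \<phi>: "proper_on V \<phi>" "lsc_on V \<phi>"
    and \<rho>: "\<rho> > 0" "strongly_convex_on \<rho> V \<phi>"
  obtains c :: real where "\<And>y. y \<in> V \<Longrightarrow> ereal c \<le> \<phi> y"
proof -
  obtain x0 where x0: "x0 \<in> V" "\<phi> x0 \<noteq> \<infinity>" "\<phi> x0 \<noteq> -\<infinity>"
    using \<phi>(1) by (auto simp: proper_on_def)
  then obtain a where a: "\<phi> x0 = ereal a" by (cases "\<phi> x0") auto
  have "ereal (a - 1) < \<phi> x0" by (simp add: a)
  from lsc_on_ballE[OF \<phi>(2) x0(1) this] obtain \<delta>
    where \<delta>: "\<delta> > 0" "\<And>y. y \<in> V \<Longrightarrow> dist y x0 < \<delta> \<Longrightarrow> ereal (a - 1) < \<phi> y" by blast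
  define e where "e = \<delta> / 2"
  define c where "c = a - 1 - 1 / (\<rho> * e\<^sup>2)"
  have e: "e > 0" using \<delta> by (simp add: e_def)
  have "ereal c \<le> \<phi> y" if y: "y \<in> V" for y
  proof (cases "dist y x0 < \<delta>")
    case True
    have "ereal c \<le> ereal (a - 1)" using \<rho> e by (simp add: c_def)
    then show ?thesis using \<delta>(2)[OF y True] by order
  next
    case False
    define d where "d = norm (y - x0)"
    \<comment> \<open>The point at parameter \<open>t\<close> of the segment has distance \<open>e < \<delta>\<close> from \<open>x0\<close>, hence lies in the ball.\<close>
    define t where "t = e / d"
    have d: "d \<ge> 2 * e" "d > 0" using False \<delta> by (auto simp: d_def e_def dist_norm)
    have t: "0 < t" "t \<le> 1/2" "t * d = e" using d e by (auto simp: t_def divide_simps)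
    show ?thesis
    proof (cases "\<phi> y")
      case (real b)
      let ?w = "t *\<^sub>R y + (1 - t) *\<^sub>R x0"
      have w: "?w \<in> V" using V y x0 by (auto intro: subspace_add subspace_scale)
      have "?w - x0 = t *\<^sub>R (y - x0)" by (simp add: algebra_simps)
      then have "dist ?w x0 = e" using t by (simp add: dist_norm d_def)
      then have "ereal (a - 1) < \<phi> ?w" using \<delta>(2)[OF w] e by (simp add: e_def)
      then have "ereal (a - 1) + ereal (\<rho> / 2 * t * (1 - t) * d\<^sup>2)
          \<le> \<phi> ?w + ereal (\<rho> / 2 * t * (1 - t) * d\<^sup>2)"
        by (intro add_mono) auto
      also have "\<dots> \<le> ereal t * \<phi> y + ereal (1 - t) * \<phi> x0"
        using \<rho>(2) y x0 t unfolding strongly_convex_on_def d_def by auto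
      finally have "a - 1 + \<rho> / 2 * t * (1 - t) * d\<^sup>2 \<le> t * b + (1 - t) * a"
        by (simp add: real a)
      moreover have "\<rho> / 2 * t * (1 - t) * d\<^sup>2 \<ge> \<rho> / 4 * t * d\<^sup>2"
      proof -
        have "\<rho> / 4 * t * d\<^sup>2 = \<rho> / 2 * t * (1/2) * d\<^sup>2" by simp
        also have "\<dots> \<le> \<rho> / 2 * t * (1 - t) * d\<^sup>2"
          using t \<rho> by (intro mult_right_mono mult_left_mono) auto
        finally show ?thesis .
      qed
      ultimately have "a - 1 + \<rho> / 4 * t * d\<^sup>2 \<le> t * b + (1 - t) * a" by linarith
      then have "t * (a + \<rho> / 4 * d\<^sup>2 - b) \<le> 1" by (simp add: algebra_simps)
      also have "1 = t * (d / e)" using t e by simp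
      finally have 1: "a + \<rho> / 4 * d\<^sup>2 - b \<le> d / e"
        using t(1) by (simp only: mult_le_cancel_left_pos)
      \<comment> \<open>Completing the square: \<open>\<rho> d\<^sup>2 / 4 - d / e \<ge> - 1 / (\<rho> e\<^sup>2)\<close>.\<close>
      have "0 \<le> \<rho> * (d / 2 - 1 / (\<rho> * e))\<^sup>2" using \<rho> by simp
      also have "\<dots> = \<rho> / 4 * d\<^sup>2 - d / e + 1 / (\<rho> * e\<^sup>2)"
        using \<rho> e by (simp add: power2_eq_square field_simps)
      finally show ?thesis using 1 by (simp add: real c_def)
    qed (use \<phi>(1) y in \<open>auto simp: proper_on_def\<close>)
  qed
  then show ?thesis using that by blast
qed

text \<open>
  Strong convexity at the midpoint of two almost minimal points bounds their distance, so a
  minimizing sequence is Cauchy; its limit is a minimizer by lower semicontinuity. Completeness replaces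
  weak compactness here.
\<close>

lemma strongly_convex_attains_min:
  fixes \<phi> :: "'a::{real_inner, complete_space} \<Rightarrow> ereal"
  assumes V: "subspace V" "closed V" and \<phi>: "proper_on V \<phi>" "lsc_on V \<phi>"
    and \<rho>: "\<rho> > 0" "strongly_convex_on \<rho> V \<phi>"
  obtains p where "p \<in> V" "\<And>y. y \<in> V \<Longrightarrow> \<phi> p \<le> \<phi> y"
proof -
  obtain c :: real where c: "\<And>y. y \<in> V \<Longrightarrow> ereal c \<le> \<phi> y"
    using strongly_convex_bounded_below[OF V(1) \<phi> \<rho>] by blast
  obtain x0 where x0: "x0 \<in> V" "\<phi> x0 \<noteq> \<infinity>" "\<phi> x0 \<noteq> -\<infinity>"
    using \<phi>(1) by (auto simp: proper_on_def)
  then obtain a where a: "\<phi> x0 = ereal a" by (cases "\<phi> x0") auto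
  define M where "M = (INF y\<in>V. \<phi> y)"
  have M: "ereal c \<le> M" "M \<le> ereal a"
    unfolding M_def using c x0 a by (auto intro: INF_greatest INF_lower2)
  then obtain m where m: "M = ereal m" by (cases M) auto
  have lb: "ereal m \<le> \<phi> y" if "y \<in> V" for y
    using that unfolding m[symmetric] M_def by (rule INF_lower)
  have "\<exists>y b. y \<in> V \<and> \<phi> y = ereal b \<and> b < m + 1 / real (Suc n)" for n
  proof -
    have "M < ereal (m + 1 / real (Suc n))" by (simp add: m)
    then obtain y where y: "y \<in> V" "\<phi> y < ereal (m + 1 / real (Suc n))"
      unfolding M_def INF_less_iff by blast
    then show ?thesis using lb[OF y(1)] by (cases "\<phi> y") auto
  qed
  then obtain y b where y: "\<And>n::nat. y n \<in> V" "\<And>n. \<phi> (y n) = ereal (b n)"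
      "\<And>n. b n < m + 1 / real (Suc n)" by metis
  have near: "\<rho> / 4 * (norm (y i - y j))\<^sup>2 \<le> 1 / real (Suc i) + 1 / real (Suc j)" for i j
  proof -
    let ?w = "(1/2) *\<^sub>R y i + (1 - 1/2) *\<^sub>R y j"
    have "?w \<in> V" using V y by (intro subspace_add subspace_scale) auto
    then have "ereal m + ereal (\<rho> / 2 * (1/2) * (1 - 1/2) * (norm (y i - y j))\<^sup>2)
        \<le> \<phi> ?w + ereal (\<rho> / 2 * (1/2) * (1 - 1/2) * (norm (y i - y j))\<^sup>2)"
      by (intro add_mono lb) auto
    also have "\<dots> \<le> ereal (1/2) * \<phi> (y i) + ereal (1 - 1/2) * \<phi> (y j)"
      using \<rho>(2)[unfolded strongly_convex_on_def, rule_format, OF y(1)[of i] y(1)[of j], of "1/2"]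
      by simp
    finally have "m + \<rho> * (norm (y i - y j))\<^sup>2 / 8 \<le> b i / 2 + b j / 2" by (simp add: y(2))
    then show ?thesis using y(3)[of i] y(3)[of j] by linarith
  qed
  have "Cauchy y"
  proof (rule metric_CauchyI)
    fix e :: real assume e: "e > 0"
    have "\<rho> * e\<^sup>2 / 8 > 0" using e \<rho> by simp
    then obtain N where N: "1 / real (Suc N) < \<rho> * e\<^sup>2 / 8"
      using reals_Archimedean[of "\<rho> * e\<^sup>2 / 8"] by (auto simp: inverse_eq_divide)
    have "dist (y i) (y j) < e" if "i \<ge> N" "j \<ge> N" for i j
    proof -
      have "1 / real (Suc i) \<le> 1 / real (Suc N)" "1 / real (Suc j) \<le> 1 / real (Suc N)"
        using that by (auto intro!: divide_left_mono)
      then have "\<rho> / 4 * (norm (y i - y j))\<^sup>2 < \<rho> / 4 * e\<^sup>2"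
        using near[of i j] N by simp
      then have "(norm (y i - y j))\<^sup>2 < e\<^sup>2" using \<rho> by simp
      then show ?thesis using e by (simp add: dist_norm power_less_imp_less_base)
    qed
    then show "\<exists>N. \<forall>i\<ge>N. \<forall>j\<ge>N. dist (y i) (y j) < e" by blast
  qed
  then obtain p where p: "y \<longlonglongrightarrow> p" by (auto simp: Cauchy_convergent_iff convergent_def)
  have pV: "p \<in> V" using closed_sequentially[OF V(2)] y(1) p by blast
  have "\<phi> p \<le> ereal m"
  proof (rule ccontr)
    assume "\<not> \<phi> p \<le> ereal m"
    then have "ereal m < \<phi> p" by simp
    from ereal_dense2[OF this] obtain k where k: "m < k" "ereal k < \<phi> p" by auto
    from lsc_on_ballE[OF \<phi>(2) pV k(2)] obtain \<delta>
      where \<delta>: "\<delta> > 0" "\<And>y. y \<in> V \<Longrightarrow> dist y p < \<delta> \<Longrightarrow> ereal k < \<phi> y" by blast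
    have "eventually (\<lambda>n. dist (y n) p < \<delta>) sequentially"
      using p \<delta>(1) by (rule tendstoD)
    moreover have "eventually (\<lambda>n. 1 / real (Suc n) < k - m) sequentially"
      using LIMSEQ_inverse_real_of_nat k(1)
      by (auto simp: inverse_eq_divide dest!: order_tendstoD(2)[of _ 0 _ "k - m"])
    ultimately have "eventually (\<lambda>n. False) sequentially"
    proof eventually_elim
      case (elim n)
      show ?case using \<delta>(2)[OF y(1) elim(1)] y(2)[of n] y(3)[of n] elim(2) by simp
    qed
    then show False by simp
  qed
  then have "\<phi> p \<le> \<phi> w" if "w \<in> V" for w using lb[OF that] by order
  then show ?thesis using that pV by blast
qed

text \<open>
  Convexity is the case \<open>\<rho> = 0\<close> of strong convexity, so that one set of lemmas covers both.
\<close>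

lemma econvex_on_iff: "econvex_on V f \<longleftrightarrow> strongly_convex_on 0 V f"
  by (simp add: econvex_on_def strongly_convex_on_def zero_ereal_def[symmetric])

lemma Gamma_onD:
  assumes "f \<in> Gamma_on V"
  shows "proper_on V f" "strongly_convex_on 0 V f" "lsc_on V f"
  using assms by (auto simp: Gamma_on_def econvex_on_iff)

lemma subdiff_onD:
  assumes "u \<in> subdiff_on V f x"
  shows "u \<in> V" "x \<in> V" "\<bar>f x\<bar> \<noteq> \<infinity>" "\<And>y. y \<in> V \<Longrightarrow> f x + ereal (u \<bullet> (y - x)) \<le> f y"
  using assms by (auto simp: subdiff_on_def)

lemma subdiff_on_realE:
  assumes "u \<in> subdiff_on V f x"
  obtains a where "f x = ereal a"
  using subdiff_onD(3)[OF assms] by (cases "f x") auto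

text \<open>
  The subgradient inequality at \<open>x + t (y - x)\<close>, combined with strong convexity on the segment,
  gives the claim with \<open>(1 - t) \<rho>\<close> in place of \<open>\<rho>\<close> after division by \<open>t\<close>; then \<open>t \<rightarrow> 0\<close>.
\<close>

lemma strongly_convex_subdiff_growth:
  fixes f :: "'a::real_inner \<Rightarrow> ereal"
  assumes V: "subspace V" and u: "u \<in> subdiff_on V f x"
    and f: "strongly_convex_on \<rho> V f" and y: "y \<in> V"
  shows "f x + ereal (u \<bullet> (y - x) + \<rho> / 2 * (norm (y - x))\<^sup>2) \<le> f y"
proof -
  obtain a where a: "f x = ereal a" using u by (rule subdiff_on_realE)
  have x: "x \<in> V" using u by (rule subdiff_onD)
  show ?thesis
  proof (cases "f y")
    case (real b)
    define s where "s = u \<bullet> (y - x)"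
    define q where "q = \<rho> / 2 * (norm (y - x))\<^sup>2"
    have *: "a + s + q * (1 - t) \<le> b" if t: "0 < t" "t < 1" for t
    proof -
      let ?w = "t *\<^sub>R y + (1 - t) *\<^sub>R x"
      have w: "?w \<in> V" using V y x by (auto intro: subspace_add subspace_scale)
      have "?w - x = t *\<^sub>R (y - x)" by (simp add: algebra_simps)
      then have "ereal (a + t * s) \<le> f ?w"
        using subdiff_onD(4)[OF u w] by (simp add: a s_def)
      then have "ereal (a + t * s) + ereal (\<rho> / 2 * t * (1 - t) * (norm (y - x))\<^sup>2)
          \<le> f ?w + ereal (\<rho> / 2 * t * (1 - t) * (norm (y - x))\<^sup>2)"
        by (intro add_mono) auto
      also have "\<dots> \<le> ereal t * f y + ereal (1 - t) * f x"
        using f y x t unfolding strongly_convex_on_def by auto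
      finally have "t * (a + s + q * (1 - t)) \<le> t * b"
        by (simp add: a real q_def algebra_simps)
      then show ?thesis using t by simp
    qed
    have "((\<lambda>t. a + s + q * (1 - t)) \<longlongrightarrow> a + s + q * (1 - 0)) (at_right 0)"
      by (intro tendsto_intros)
    moreover have "eventually (\<lambda>t. a + s + q * (1 - t) \<le> b) (at_right 0)"
      using eventually_at_right_less[of 0]
        eventually_at_right_real[of 0 1] * by (auto elim!: eventually_mono)
    ultimately have "a + s + q \<le> b"
      using tendsto_upperbound by fastforce
    then show ?thesis by (simp add: a real s_def q_def)
  next
    case MInf
    have "f x + ereal (u \<bullet> (y - x)) \<le> f y" using subdiff_onD(4)[OF u y] .
    then show ?thesis by (simp add: a MInf)
  qed simp
qed

lemma zero_subdiffI:
  assumes "subspace V" "p \<in> V" "proper_on V \<phi>" "\<And>y. y \<in> V \<Longrightarrow> \<phi> p \<le> \<phi> y"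
  shows "0 \<in> subdiff_on V \<phi> p"
proof -
  obtain x0 where "x0 \<in> V" "\<phi> x0 \<noteq> \<infinity>" using assms(3) by (auto simp: proper_on_def)
  then have "\<phi> p \<noteq> \<infinity>" using assms(4)[of x0] by auto
  moreover have "\<phi> p \<noteq> -\<infinity>" using assms by (auto simp: proper_on_def)
  ultimately show ?thesis
    using assms by (auto simp: subdiff_on_def subspace_0 zero_ereal_def[symmetric])
qed

lemma subdiff_monotone:
  assumes "u \<in> subdiff_on V f x" "w \<in> subdiff_on V f y"
  shows "(u - w) \<bullet> (x - y) \<ge> 0"
proof -
  obtain a b where "f x = ereal a" "f y = ereal b"
    using assms by (auto elim!: subdiff_on_realE)
  then have "a + u \<bullet> (y - x) \<le> b" "b + w \<bullet> (x - y) \<le> a"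
    using subdiff_onD(4)[OF assms(1), of y] subdiff_onD(4)[OF assms(2), of x]
      subdiff_onD(2)[OF assms(1)] subdiff_onD(2)[OF assms(2)] by auto
  then show ?thesis by (simp add: inner_diff_left inner_diff_right)
qed

text \<open>
  The moduli add up. This is applied with \<open>q\<close> the quadratic term of a proximity problem, and with \<open>q\<close> linear
  (where \<open>\<rho>2 = 0\<close>) to maximize \<open>\<langle>w, y\<rangle> - l y\<close>.
\<close>

lemma perturb_strongly_convex:
  fixes f :: "'a::real_inner \<Rightarrow> ereal" and q :: "'a \<Rightarrow> real"
  assumes f: "f \<in> Gamma_on V" "strongly_convex_on \<rho>1 V f"
    and q: "continuous_on UNIV q"
      "\<And>x y t. t \<in> {0<..<1} \<Longrightarrow> q (t *\<^sub>R x + (1 - t) *\<^sub>R y) + \<rho>2 / 2 * t * (1 - t) * (norm (x - y))\<^sup>2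
          \<le> t * q x + (1 - t) * q y"
  shows "proper_on V (\<lambda>y. f y + ereal (q y))" "lsc_on V (\<lambda>y. f y + ereal (q y))"
    "strongly_convex_on (\<rho>1 + \<rho>2) V (\<lambda>y. f y + ereal (q y))"
proof -
  show "proper_on V (\<lambda>y. f y + ereal (q y))"
    using Gamma_onD(1)[OF f(1)] by (auto simp: proper_on_def)
  show "lsc_on V (\<lambda>y. f y + ereal (q y))"
  proof (rule lsc_on_ballI)
    fix x c assume x: "x \<in> V" "c < f x + ereal (q x)"
    from ereal_dense2[OF x(2)] obtain c' where c': "c < ereal c'" "ereal c' < f x + ereal (q x)"
      by auto
    have "ereal (c' - q x) < f x" using c'(2) by (cases "f x") auto
    from ereal_dense2[OF this] obtain k where k: "c' - q x < k" "ereal k < f x" by auto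
    from lsc_on_ballE[OF Gamma_onD(3)[OF f(1)] x(1) k(2)] obtain d1 where
      d1: "d1 > 0" "\<And>y. y \<in> V \<Longrightarrow> dist y x < d1 \<Longrightarrow> ereal k < f y" by blast
    have "isCont q x" using q(1) by (simp add: continuous_on_eq_continuous_at)
    then obtain d2 where d2: "d2 > 0" "\<And>y. dist y x < d2 \<Longrightarrow> dist (q y) (q x) < k - (c' - q x)"
      using k(1) unfolding continuous_at_eps_delta by (metis diff_gt_0_iff_gt)
    have "c < f y + ereal (q y)" if "y \<in> V" "dist y x < min d1 d2" for y
    proof -
      have "q y > c' - k" using d2(2)[of y] that by (auto simp: dist_real_def)
      moreover have "ereal k < f y" using d1(2) that by auto
      ultimately have "ereal c' < f y + ereal (q y)" by (cases "f y") auto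
      then show ?thesis using c'(1) by order
    qed
    then show "\<exists>\<delta>>0. \<forall>y\<in>V. dist y x < \<delta> \<longrightarrow> c < f y + ereal (q y)"
      using d1(1) d2(1) by (intro exI[of _ "min d1 d2"]) auto
  qed
  show "strongly_convex_on (\<rho>1 + \<rho>2) V (\<lambda>y. f y + ereal (q y))"
    unfolding strongly_convex_on_def
  proof (intro ballI)
    fix x y t :: _ assume x: "x \<in> V" and y: "y \<in> V" and t: "t \<in> {0<..<1::real}"
    let ?w = "t *\<^sub>R x + (1 - t) *\<^sub>R y" and ?n = "(norm (x - y))\<^sup>2"
    have 1: "f ?w + ereal (\<rho>1 / 2 * t * (1 - t) * ?n) \<le> ereal t * f x + ereal (1 - t) * f y"
      using f(2) x y t unfolding strongly_convex_on_def by blast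
    have 2: "ereal (q ?w + \<rho>2 / 2 * t * (1 - t) * ?n) \<le> ereal (t * q x + (1 - t) * q y)"
      using q(2)[OF t] by simp
    have "f ?w + ereal (q ?w) + ereal ((\<rho>1 + \<rho>2) / 2 * t * (1 - t) * ?n)
      = (f ?w + ereal (\<rho>1 / 2 * t * (1 - t) * ?n)) + ereal (q ?w + \<rho>2 / 2 * t * (1 - t) * ?n)"
      by (cases "f ?w") (auto simp: algebra_simps add_divide_distrib)
    also have "\<dots> \<le> (ereal t * f x + ereal (1 - t) * f y) + ereal (t * q x + (1 - t) * q y)"
      using 1 2 by (rule add_mono)
    also have "\<dots> = ereal t * (f x + ereal (q x)) + ereal (1 - t) * (f y + ereal (q y))"
      using t Gamma_onD(1)[OF f(1)] x y
      by (cases "f x"; cases "f y") (auto simp: proper_on_def algebra_simps)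
    finally show "f ?w + ereal (q ?w) + ereal ((\<rho>1 + \<rho>2) / 2 * t * (1 - t) * ?n)
      \<le> ereal t * (f x + ereal (q x)) + ereal (1 - t) * (f y + ereal (q y))" .
  qed
qed

lemma half_square_strongly_convex:
  fixes x y w :: "'a::real_inner"
  assumes "\<gamma> > 0" "t \<in> {0<..<1}"
  shows "1 / (2 * \<gamma>) * (norm (t *\<^sub>R x + (1 - t) *\<^sub>R y - w))\<^sup>2
      + (1 / \<gamma>) / 2 * t * (1 - t) * (norm (x - y))\<^sup>2
    \<le> t * (1 / (2 * \<gamma>) * (norm (x - w))\<^sup>2) + (1 - t) * (1 / (2 * \<gamma>) * (norm (y - w))\<^sup>2)"
proof -
  have "t *\<^sub>R x + (1 - t) *\<^sub>R y - w = t *\<^sub>R (x - w) + (1 - t) *\<^sub>R (y - w)"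
    by (simp add: algebra_simps)
  then have "(norm (t *\<^sub>R x + (1 - t) *\<^sub>R y - w))\<^sup>2
      = t * (norm (x - w))\<^sup>2 + (1 - t) * (norm (y - w))\<^sup>2 - t * (1 - t) * (norm (x - y))\<^sup>2"
    using norm_convex_combination_sq[of t "x - w" "y - w"] by simp
  then show ?thesis
    using assms(1) by (simp only:) (simp add: field_simps)
qed

text \<open>
  The minimizer \<open>p\<close> of \<open>f + \<parallel>\<cdot> - x\<parallel>\<^sup>2 / (2 \<gamma>)\<close>. The quadratic growth of this strongly convex sum around \<open>p\<close>
  cancels the quadratic terms exactly, which leaves the subgradient inequality for \<open>f\<close> alone.
\<close>

lemma prox_subdiff_exists:
  fixes f :: "'a::{real_inner, complete_space} \<Rightarrow> ereal"
  assumes V: "subspace V" "closed V" and f: "f \<in> Gamma_on V" and \<gamma>: "\<gamma> > 0" and x: "x \<in> V"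
  obtains p where "(1 / \<gamma>) *\<^sub>R (x - p) \<in> subdiff_on V f p"
proof -
  define q where "q = (\<lambda>y. 1 / (2 * \<gamma>) * (norm (y - x))\<^sup>2)"
  have q: "continuous_on UNIV q" unfolding q_def by (intro continuous_intros)
  have "q (t *\<^sub>R a + (1 - t) *\<^sub>R b) + (1 / \<gamma>) / 2 * t * (1 - t) * (norm (a - b))\<^sup>2
      \<le> t * q a + (1 - t) * q b" if "t \<in> {0<..<1}" for a b t
    using half_square_strongly_convex[OF \<gamma> that] by (simp add: q_def)
  note pert = perturb_strongly_convex[OF f Gamma_onD(2)[OF f] q this]
  have "0 + 1 / \<gamma> > 0" using \<gamma> by simp
  from strongly_convex_attains_min[OF V pert(1,2) this pert(3)]
  obtain p where p: "p \<in> V" "\<And>y. y \<in> V \<Longrightarrow> f p + ereal (q p) \<le> f y + ereal (q y)"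
    by blast
  have z: "0 \<in> subdiff_on V (\<lambda>y. f y + ereal (q y)) p"
    using zero_subdiffI[OF V(1) p(1) pert(1)] p(2) by blast
  have "\<bar>f p\<bar> \<noteq> \<infinity>" using subdiff_onD(3)[OF z] by (cases "f p") auto
  then obtain a where a: "f p = ereal a" by (cases "f p") auto
  have "f p + ereal ((1 / \<gamma>) *\<^sub>R (x - p) \<bullet> (y - p)) \<le> f y" if y: "y \<in> V" for y
  proof -
    have "f p + ereal (q p) + ereal (0 \<bullet> (y - p) + (0 + 1 / \<gamma>) / 2 * (norm (y - p))\<^sup>2)
        \<le> f y + ereal (q y)"
      using strongly_convex_subdiff_growth[OF V(1) z pert(3) y] .
    then have 1: "ereal (a + q p + 1 / \<gamma> / 2 * (norm (y - p))\<^sup>2) \<le> f y + ereal (q y)"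
      by (simp only: a) simp
    have "(norm (y - x))\<^sup>2 = (norm (y - p))\<^sup>2 + (norm (p - x))\<^sup>2 - 2 * ((x - p) \<bullet> (y - p))"
      unfolding power2_norm_eq_inner
      by (simp add: inner_diff_left inner_diff_right inner_commute)
    then have "q y = 1 / \<gamma> / 2 * ((norm (y - p))\<^sup>2 + (norm (p - x))\<^sup>2 - 2 * ((x - p) \<bullet> (y - p)))"
      by (simp add: q_def)
    also have "\<dots> = q p + 1 / \<gamma> / 2 * (norm (y - p))\<^sup>2 - (1 / \<gamma>) *\<^sub>R (x - p) \<bullet> (y - p)"
      unfolding q_def inner_scaleR_left by (simp add: algebra_simps diff_divide_distrib add_divide_distrib)
    finally show ?thesis using 1 by (cases "f y") (simp_all add: a)
  qed
  moreover have "(1 / \<gamma>) *\<^sub>R (x - p) \<in> V"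
    using V x p by (auto intro: subspace_scale subspace_diff)
  ultimately show ?thesis using that p(1) a unfolding subdiff_on_def by fastforce
qed

section \<open>Conjugates, proximity operators and gradients\<close>

text \<open>
  The proximity point \<open>p\<close> of the linear function \<open>-\<phi>\<close> at \<open>0\<close> satisfies \<open>-p \<in> \<partial>(-\<phi>) p\<close>, that is
  \<open>\<phi> y \<le> \<langle>p, y\<rangle>\<close> for all \<open>y\<close>; replacing \<open>y\<close> by \<open>-y\<close> gives equality.
\<close>

lemma riesz_representation_on:
  fixes \<phi> :: "'a::{real_inner, complete_space} \<Rightarrow> real"
  assumes V: "subspace V" "closed V" and \<phi>: "bounded_linear \<phi>"
  obtains p where "p \<in> V" "\<And>y. y \<in> V \<Longrightarrow> \<phi> y = p \<bullet> y"
proof -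
  interpret bounded_linear \<phi> by fact
  let ?f = "\<lambda>x. ereal (- \<phi> x)"
  have "proper_on V ?f" using subspace_0[OF V(1)] by (auto simp: proper_on_def)
  moreover have "econvex_on V ?f" by (auto simp: econvex_on_def add scaleR)
  moreover have "lsc_on V ?f"
  proof (rule lsc_on_ballI)
    fix x c assume c: "c < ereal (- \<phi> x)"
    have "((\<lambda>y. ereal (- \<phi> y)) \<longlongrightarrow> ereal (- \<phi> x)) (nhds x)"
      by (intro tendsto_intros tendsto) (auto simp: filterlim_ident)
    then have "eventually (\<lambda>y. c < ereal (- \<phi> y)) (nhds x)"
      using c by (rule order_tendstoD)
    then show "\<exists>\<delta>>0. \<forall>y\<in>V. dist y x < \<delta> \<longrightarrow> c < ereal (- \<phi> y)"
      by (auto simp: eventually_nhds_metric)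
  qed
  ultimately have "?f \<in> Gamma_on V" by (simp add: Gamma_on_def)
  from prox_subdiff_exists[OF V this zero_less_one subspace_0[OF V(1)]]
  obtain p where p: "- p \<in> subdiff_on V ?f p" by (auto simp: scaleR_minus1_left)
  have pV: "p \<in> V" using p by (rule subdiff_onD)
  have le: "\<phi> y \<le> p \<bullet> y" if "y \<in> V" for y
    using subdiff_onD(4)[OF p subspace_add[OF V(1) pV that]] by (simp add: add)
  have "\<phi> y = p \<bullet> y" if "y \<in> V" for y
    using le[OF that] le[OF subspace_neg[OF V(1) that]] by (simp add: linear_neg[OF bounded_linear.linear[OF \<phi>]])
  with pV show ?thesis using that by blast
qed

text \<open>
  The adjoint is a Hilbert choice whose existence follows from Riesz representation of
  \<open>x \<mapsto> \<langle>T x, y\<rangle>\<close>.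
\<close>

lemma adjoint_bounded_linear:
  fixes T :: "'a::{real_inner, complete_space} \<Rightarrow> 'b::real_inner"
  assumes "bounded_linear T"
  shows "x \<bullet> adjoint T y = T x \<bullet> y"
proof -
  have "\<exists>w. \<forall>x. T x \<bullet> y = x \<bullet> w" for y
  proof -
    have "bounded_linear (\<lambda>x. T x \<bullet> y)"
      using bounded_linear_compose[OF bounded_linear_inner_left assms] .
    from riesz_representation_on[OF subspace_UNIV closed_UNIV this]
    show ?thesis by (metis UNIV_I inner_commute)
  qed
  then obtain a where "\<And>x y. T x \<bullet> y = x \<bullet> a y" by metis
  then show ?thesis
    unfolding adjoint_def
    by (intro someI2_ex[where Q="\<lambda>f'. x \<bullet> f' y = T x \<bullet> y"]) auto
qed

text \<open>
  Derivatives within a subspace \<open>V\<close> are determined along lines in \<open>V\<close>, so two representing vectors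
  in \<open>V\<close> agree.
\<close>

lemma gradient_on_eqI:
  fixes f :: "'a::real_inner \<Rightarrow> real"
  assumes V: "subspace V" and x: "x \<in> V" and D: "D \<in> V"
    and der: "(f has_derivative (\<lambda>d. D \<bullet> d)) (at x within V)"
  shows "gradient_on V f x = D"
  unfolding gradient_on_def
proof (rule the_equality)
  show "D \<in> V \<and> (f has_derivative (\<lambda>d. D \<bullet> d)) (at x within V)" using D der by simp
next
  fix D' assume D': "D' \<in> V \<and> (f has_derivative (\<lambda>d. D' \<bullet> d)) (at x within V)"
  define e where "e = D' - D"
  have eV: "e \<in> V" using V D D' by (auto simp: e_def intro: subspace_diff)
  have along: "((\<lambda>t. f (x + t *\<^sub>R e)) has_derivative (\<lambda>t. E \<bullet> (t *\<^sub>R e))) (at 0)"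
    if "(f has_derivative (\<lambda>d. E \<bullet> d)) (at x within V)" for E
  proof -
    have 1: "((\<lambda>t. x + t *\<^sub>R e) has_derivative (\<lambda>t. t *\<^sub>R e)) (at 0)"
      by (auto intro!: derivative_eq_intros)
    have "(f has_derivative (\<lambda>d. E \<bullet> d)) (at (x + 0 *\<^sub>R e) within range (\<lambda>t. x + t *\<^sub>R e))"
      using that V x eV
      by (auto intro!: has_derivative_subset[OF that] subspace_add subspace_scale)
    from diff_chain_within[OF 1 this] show ?thesis by (simp add: o_def)
  qed
  have "(\<lambda>t. D \<bullet> (t *\<^sub>R e)) = (\<lambda>t. D' \<bullet> (t *\<^sub>R e))"
    using along[OF der] along D' by (blast intro: has_derivative_unique)
  from fun_cong[OF this, of 1] have "e \<bullet> e = 0"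
    by (simp add: e_def inner_diff_left)
  then show "D' = D" by (simp add: e_def)
qed

lemma fenchel_young: "x \<in> V \<Longrightarrow> ereal (p \<bullet> x) - f x \<le> conjugate_on V f p"
  unfolding conjugate_on_def by (rule SUP_upper)

lemma conjugate_neq_MInf:
  assumes "proper_on V f"
  shows "conjugate_on V f p \<noteq> -\<infinity>"
proof -
  obtain x where x: "x \<in> V" "f x \<noteq> \<infinity>" using assms by (auto simp: proper_on_def)
  show ?thesis using fenchel_young[OF x(1), of p f] x(2) by (cases "f x") auto
qed

lemma conjugate_at_subgradient:
  assumes "u \<in> subdiff_on V f x" "f x = ereal a"
  shows "conjugate_on V f u = ereal (u \<bullet> x - a)"
proof (rule antisym)
  show "conjugate_on V f u \<le> ereal (u \<bullet> x - a)"
    unfolding conjugate_on_def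
  proof (rule SUP_least)
    fix y assume "y \<in> V"
    from subdiff_onD(4)[OF assms(1) this]
    show "ereal (u \<bullet> y) - f y \<le> ereal (u \<bullet> x - a)"
      by (cases "f y") (auto simp: assms(2) inner_diff_right)
  qed
  show "ereal (u \<bullet> x - a) \<le> conjugate_on V f u"
    using fenchel_young[OF subdiff_onD(2)[OF assms(1)], of u f] by (simp add: assms(2))
qed

lemma subdiff_conjugateI:
  assumes u: "u \<in> subdiff_on V f x"
  shows "x \<in> subdiff_on V (conjugate_on V f) u"
proof -
  obtain a where a: "f x = ereal a" using u by (rule subdiff_on_realE)
  note D = subdiff_onD[OF u] and c = conjugate_at_subgradient[OF u a]
  have "ereal (u \<bullet> x - a) + ereal (x \<bullet> (w - u)) \<le> conjugate_on V f w" for w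
    using fenchel_young[OF D(2), of w f] by (simp add: a inner_diff_right inner_commute)
  then show ?thesis using D by (simp add: subdiff_on_def c)
qed

lemma conjugate_Gamma:
  fixes f :: "'a::{real_inner, complete_space} \<Rightarrow> ereal"
  assumes V: "subspace V" "closed V" and f: "f \<in> Gamma_on V"
  shows "conjugate_on V f \<in> Gamma_on V"
proof -
  note f' = Gamma_onD[OF f]
  note nM = conjugate_neq_MInf[OF f'(1)]
  obtain p where "(1 / 1) *\<^sub>R (0 - p) \<in> subdiff_on V f p"
    using prox_subdiff_exists[OF V f zero_less_one subspace_0[OF V(1)]] by blast
  then obtain u where u: "u \<in> subdiff_on V f p" by blast
  have "conjugate_on V f u \<noteq> \<infinity>"
    using subdiff_onD(3)[OF subdiff_conjugateI[OF u]] by (cases "conjugate_on V f u") auto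
  then have "proper_on V (conjugate_on V f)"
    using nM subdiff_onD(1)[OF u] unfolding proper_on_def by blast
  moreover have "econvex_on V (conjugate_on V f)"
    unfolding econvex_on_def
  proof (intro ballI)
    fix p q and t :: real assume t: "t \<in> {0<..<1}"
    show "conjugate_on V f (t *\<^sub>R p + (1 - t) *\<^sub>R q)
        \<le> ereal t * conjugate_on V f p + ereal (1 - t) * conjugate_on V f q"
    proof (subst (1) conjugate_on_def, rule SUP_least)
      fix x assume x: "x \<in> V"
      show "ereal ((t *\<^sub>R p + (1 - t) *\<^sub>R q) \<bullet> x) - f x
          \<le> ereal t * conjugate_on V f p + ereal (1 - t) * conjugate_on V f q"
      proof (cases "f x")
        case (real a)
        have "ereal t * ereal (p \<bullet> x - a) \<le> ereal t * conjugate_on V f p"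
          using t fenchel_young[OF x, of p f] by (intro ereal_mult_left_mono) (auto simp: real)
        moreover have "ereal (1 - t) * ereal (q \<bullet> x - a) \<le> ereal (1 - t) * conjugate_on V f q"
          using t fenchel_young[OF x, of q f] by (intro ereal_mult_left_mono) (auto simp: real)
        ultimately have "ereal t * ereal (p \<bullet> x - a) + ereal (1 - t) * ereal (q \<bullet> x - a)
            \<le> ereal t * conjugate_on V f p + ereal (1 - t) * conjugate_on V f q"
          by (rule add_mono)
        moreover have "ereal ((t *\<^sub>R p + (1 - t) *\<^sub>R q) \<bullet> x) - f x
            = ereal t * ereal (p \<bullet> x - a) + ereal (1 - t) * ereal (q \<bullet> x - a)"
          by (simp add: real inner_add_left algebra_simps)
        ultimately show ?thesis by simp
      qed (use f'(1) x in \<open>auto simp: proper_on_def\<close>)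
    qed
  qed
  moreover have "lsc_on V (conjugate_on V f)"
  proof (rule lsc_on_ballI)
    fix p c assume "c < conjugate_on V f p"
    then obtain x where x: "x \<in> V" "c < ereal (p \<bullet> x) - f x"
      unfolding conjugate_on_def less_SUP_iff by blast
    have "((\<lambda>w. ereal (w \<bullet> x) - f x) \<longlongrightarrow> ereal (p \<bullet> x) - f x) (nhds p)"
    proof (cases "f x")
      case (real a)
      show ?thesis unfolding real ereal_minus(1)
        by (intro tendsto_intros) (auto simp: filterlim_ident)
    qed simp_all
    then have "eventually (\<lambda>w. c < ereal (w \<bullet> x) - f x) (nhds p)"
      using x(2) by (rule order_tendstoD)
    then obtain d where "d > 0" "\<And>w. dist w p < d \<Longrightarrow> c < ereal (w \<bullet> x) - f x"
      by (auto simp: eventually_nhds_metric)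
    then show "\<exists>\<delta>>0. \<forall>w\<in>V. dist w p < \<delta> \<longrightarrow> c < conjugate_on V f w"
      using fenchel_young[OF x(1), of _ f] by (meson order_less_le_trans)
  qed
  ultimately show ?thesis by (simp add: Gamma_on_def)
qed

text \<open>
  Minty's argument, in place of the biconjugate theorem: if \<open>p\<close> is the proximity point of \<open>x + u\<close>, then
  \<open>x + u - p \<in> \<partial>f p\<close>, so \<open>p \<in> \<partial>f* (x + u - p)\<close>; monotonicity of \<open>\<partial>f*\<close> applied to this and
  \<open>x \<in> \<partial>f* u\<close> gives \<open>- \<parallel>x - p\<parallel>\<^sup>2 \<ge> 0\<close>.
\<close>

lemma subdiff_conjugateD:
  fixes f :: "'a::{real_inner, complete_space} \<Rightarrow> ereal"
  assumes V: "subspace V" "closed V" and f: "f \<in> Gamma_on V"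
    and x: "x \<in> subdiff_on V (conjugate_on V f) u"
  shows "u \<in> subdiff_on V f x"
proof -
  have "x + u \<in> V" using subdiff_onD(1,2)[OF x] V by (auto intro: subspace_add)
  from prox_subdiff_exists[OF V f zero_less_one this]
  obtain p where p: "x + u - p \<in> subdiff_on V f p" by auto
  have "(x - p) \<bullet> (u - (x + u - p)) \<ge> 0"
    using subdiff_monotone[OF x subdiff_conjugateI[OF p]] .
  moreover have "u - (x + u - p) = - (x - p)" by simp
  ultimately have "(x - p) \<bullet> (x - p) \<le> 0" by (simp only: inner_minus_right)
  then have "x = p" using inner_ge_zero[of "x - p"] inner_eq_zero_iff[of "x - p"] by simp
  then show ?thesis using p by simp
qed

text \<open>
  A point \<open>p\<close> with this subgradient is a strict minimizer of the proximity problem, so the definite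
  description in \<open>prox_on\<close> denotes it.
\<close>

lemma prox_on_subdiff:
  fixes f :: "'a::{real_inner, complete_space} \<Rightarrow> ereal"
  assumes V: "subspace V" "closed V" and f: "f \<in> Gamma_on V" and \<gamma>: "\<gamma> > 0" and x: "x \<in> V"
  shows "(1 / \<gamma>) *\<^sub>R (x - prox_on V \<gamma> f x) \<in> subdiff_on V f (prox_on V \<gamma> f x)"
proof -
  obtain p where p: "(1 / \<gamma>) *\<^sub>R (x - p) \<in> subdiff_on V f p"
    using prox_subdiff_exists[OF V f \<gamma> x] .
  define q where "q = (\<lambda>y. 1 / (2 * \<gamma>) * (norm (y - x))\<^sup>2)"
  obtain a where a: "f p = ereal a" using p by (rule subdiff_on_realE)
  have growth: "ereal (a + q p + 1 / (2 * \<gamma>) * (norm (y - p))\<^sup>2) \<le> f y + ereal (q y)"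
    if y: "y \<in> V" for y
  proof -
    have "ereal (a + (1 / \<gamma>) *\<^sub>R (x - p) \<bullet> (y - p)) \<le> f y"
      using subdiff_onD(4)[OF p y] by (simp add: a)
    then have "ereal (a + (1 / \<gamma>) *\<^sub>R (x - p) \<bullet> (y - p)) + ereal (q y) \<le> f y + ereal (q y)"
      by (rule add_right_mono)
    moreover have "(1 / \<gamma>) *\<^sub>R (x - p) \<bullet> (y - p) + q y = q p + 1 / (2 * \<gamma>) * (norm (y - p))\<^sup>2"
    proof -
      have "2 * ((x - p) \<bullet> (y - p)) + (norm (y - x))\<^sup>2 = (norm (p - x))\<^sup>2 + (norm (y - p))\<^sup>2"
        unfolding power2_norm_eq_inner
        by (simp add: inner_diff_left inner_diff_right inner_commute)
      then have "1 / (2 * \<gamma>) * (2 * ((x - p) \<bullet> (y - p)) + (norm (y - x))\<^sup>2)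
          = 1 / (2 * \<gamma>) * ((norm (p - x))\<^sup>2 + (norm (y - p))\<^sup>2)" by simp
      then show ?thesis unfolding q_def inner_scaleR_left by (simp add: distrib_left)
    qed
    ultimately show ?thesis by (simp add: algebra_simps)
  qed
  have "prox_on V \<gamma> f x = p"
    unfolding prox_on_def
  proof (rule the_equality)
    show "is_arg_min (\<lambda>y. f y + ereal (1 / (2 * \<gamma>) * (norm (y - x))\<^sup>2)) (\<lambda>y. y \<in> V) p"
      unfolding is_arg_min_def
    proof (intro conjI notI)
      show "p \<in> V" using p by (rule subdiff_onD)
      assume "\<exists>y. y \<in> V \<and> f y + ereal (1 / (2 * \<gamma>) * (norm (y - x))\<^sup>2)
          < f p + ereal (1 / (2 * \<gamma>) * (norm (p - x))\<^sup>2)"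
      then obtain y where y: "y \<in> V" "f y + ereal (q y) < f p + ereal (q p)" by (auto simp: q_def)
      have "ereal (a + q p) \<le> ereal (a + q p + 1 / (2 * \<gamma>) * (norm (y - p))\<^sup>2)" using \<gamma> by simp
      also have "\<dots> \<le> f y + ereal (q y)" using growth[OF y(1)] .
      finally show False using y(2) by (simp add: a)
    qed
  next
    fix p' assume "is_arg_min (\<lambda>y. f y + ereal (1 / (2 * \<gamma>) * (norm (y - x))\<^sup>2)) (\<lambda>y. y \<in> V) p'"
    then have p': "p' \<in> V" "\<not> f p + ereal (q p) < f p' + ereal (q p')"
      using subdiff_onD(2)[OF p] by (auto simp: is_arg_min_def q_def)
    have "ereal (a + q p + 1 / (2 * \<gamma>) * (norm (p' - p))\<^sup>2) \<le> f p' + ereal (q p')"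
      using growth[OF p'(1)] .
    also have "\<dots> \<le> ereal (a + q p)" using p'(2) by (simp add: a)
    finally have "1 / (2 * \<gamma>) * (norm (p' - p))\<^sup>2 \<le> 0" by simp
    then have "(norm (p' - p))\<^sup>2 \<le> 0" using \<gamma> by (simp add: divide_le_0_iff)
    then show "p' = p" by simp
  qed
  then show ?thesis using p by simp
qed

lemma strongly_convex_subdiff_strongly_monotone:
  assumes V: "subspace V" and f: "strongly_convex_on \<rho> V f"
    and u: "u \<in> subdiff_on V f x" and w: "w \<in> subdiff_on V f y"
  shows "\<rho> * (norm (x - y))\<^sup>2 \<le> (u - w) \<bullet> (x - y)"
proof -
  obtain a b where "f x = ereal a" "f y = ereal b"
    using u w by (auto elim!: subdiff_on_realE)
  then have "a + (u \<bullet> (y - x) + \<rho> / 2 * (norm (y - x))\<^sup>2) \<le> b"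
      "b + (w \<bullet> (x - y) + \<rho> / 2 * (norm (x - y))\<^sup>2) \<le> a"
    using strongly_convex_subdiff_growth[OF V u f subdiff_onD(2)[OF w]]
      strongly_convex_subdiff_growth[OF V w f subdiff_onD(2)[OF u]] by auto
  then show ?thesis
    by (simp add: inner_diff_left inner_diff_right norm_minus_commute)
qed

lemma strongly_convex_subdiff_inverse_lipschitz:
  assumes V: "subspace V" and \<nu>: "\<nu> > 0" and f: "strongly_convex_on (inverse \<nu>) V f"
    and u: "u \<in> subdiff_on V f x" and w: "w \<in> subdiff_on V f y"
  shows "norm (x - y) \<le> \<nu> * norm (u - w)"
proof (cases "x = y")
  case False
  have "inverse \<nu> * (norm (x - y))\<^sup>2 \<le> (u - w) \<bullet> (x - y)"
    using strongly_convex_subdiff_strongly_monotone[OF V f u w] .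
  also have "\<dots> \<le> norm (u - w) * norm (x - y)" by (rule norm_cauchy_schwarz)
  finally have "norm (x - y) * norm (x - y) \<le> (\<nu> * norm (u - w)) * norm (x - y)"
    using \<nu> by (simp add: power2_eq_square field_simps)
  then show ?thesis using False by simp
qed (use \<nu> in simp)

text \<open>
  The maximizer \<open>q v\<close> of \<open>\<langle>v, \<cdot>\<rangle> - l\<close> is a subgradient of \<open>l*\<close> at \<open>v\<close>, and it is Lipschitz in \<open>v\<close>. The
  subgradient inequalities at \<open>v\<close> and at \<open>w\<close> squeeze the remainder \<open>l* w - l* v - \<langle>q v, w - v\<rangle>\<close> between \<open>0\<close> and
  \<open>\<nu> \<parallel>w - v\<parallel>\<^sup>2\<close>, so \<open>q v\<close> is the gradient.
\<close>

lemma grad_conj_subdiff: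
  fixes l :: "'a::{real_inner, complete_space} \<Rightarrow> ereal"
  assumes V: "subspace V" "closed V" and l: "l \<in> Gamma_on V"
    and \<nu>: "\<nu> > 0" "strongly_convex_on (inverse \<nu>) V l" and v: "v \<in> V"
  shows "v \<in> subdiff_on V l (grad_conj_on V l v)"
proof -
  have ex: "\<exists>q. w \<in> subdiff_on V l q" if w: "w \<in> V" for w
  proof -
    have c: "continuous_on UNIV (\<lambda>y. - (w \<bullet> y))" by (intro continuous_intros)
    have lin: "- (w \<bullet> (t *\<^sub>R x + (1 - t) *\<^sub>R y)) + 0 / 2 * t * (1 - t) * (norm (x - y))\<^sup>2
        \<le> t * - (w \<bullet> x) + (1 - t) * - (w \<bullet> y)" for x y t
      by (simp add: inner_add_right algebra_simps)
    note pert = perturb_strongly_convex[OF l \<nu>(2) c lin]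
    have "inverse \<nu> + 0 > 0" using \<nu> by simp
    from strongly_convex_attains_min[OF V pert(1,2) this pert(3)]
    obtain q where q: "q \<in> V" "\<And>y. y \<in> V \<Longrightarrow> l q + ereal (- (w \<bullet> q)) \<le> l y + ereal (- (w \<bullet> y))"
      by blast
    have "0 \<in> subdiff_on V (\<lambda>y. l y + ereal (- (w \<bullet> y))) q"
      using zero_subdiffI[OF V(1) q(1) pert(1)] q(2) by blast
    from subdiff_onD(3)[OF this] obtain a where a: "l q = ereal a" by (cases "l q") auto
    have "l q + ereal (w \<bullet> (y - q)) \<le> l y" if "y \<in> V" for y
      using q(2)[OF that] by (cases "l y") (auto simp: a inner_diff_right)
    then show ?thesis using q(1) w by (intro exI[of _ q]) (auto simp: subdiff_on_def a)
  qed
  then obtain q where q: "\<And>w. w \<in> V \<Longrightarrow> w \<in> subdiff_on V l (q w)" by metis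
  define c where "c w = real_of_ereal (conjugate_on V l w)" for w
  have c: "conjugate_on V l w = ereal (c w)" if "w \<in> V" for w
    using subdiff_onD(3)[OF subdiff_conjugateI[OF q[OF that]]]
    by (auto simp: c_def ereal_real)
  have sub: "c w + q w \<bullet> (w' - w) \<le> c w'" if "w \<in> V" "w' \<in> V" for w w'
    using subdiff_onD(4)[OF subdiff_conjugateI[OF q[OF that(1)]] that(2)] that by (simp add: c)
  have qV: "q v \<in> V" using subdiff_onD(2)[OF q[OF v]] .
  have bound: "norm (c w - c v - q v \<bullet> (w - v)) \<le> \<nu> * (norm (w - v))\<^sup>2" if w: "w \<in> V" for w
  proof -
    have "c w - c v - q v \<bullet> (w - v) \<le> (q w - q v) \<bullet> (w - v)"
      using sub[OF w v] by (simp add: inner_diff_left inner_diff_right)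
    also have "\<dots> \<le> norm (q w - q v) * norm (w - v)" by (rule norm_cauchy_schwarz)
    also have "\<dots> \<le> (\<nu> * norm (w - v)) * norm (w - v)"
      using strongly_convex_subdiff_inverse_lipschitz[OF V(1) \<nu> q[OF w] q[OF v]]
      by (rule mult_right_mono) simp
    finally show ?thesis using sub[OF v w] by (simp add: power2_eq_square algebra_simps)
  qed
  have "(c has_derivative (\<lambda>d. q v \<bullet> d)) (at v within V)"
    unfolding has_derivative_within
  proof (intro conjI bounded_linear_inner_right)
    have "((\<lambda>w. \<nu> * norm (w - v)) \<longlongrightarrow> \<nu> * norm (v - v)) (at v within V)"
      by (intro tendsto_intros)
    then show "((\<lambda>w. (1 / norm (w - v)) *\<^sub>R (c w - (c v + q v \<bullet> (w - v)))) \<longlongrightarrow> 0) (at v within V)"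
    proof (rule Lim_null_comparison[rotated, OF tendsto_eq_rhs])
      show "\<forall>\<^sub>F w in at v within V. norm ((1 / norm (w - v)) *\<^sub>R (c w - (c v + q v \<bullet> (w - v)))) \<le> \<nu> * norm (w - v)"
        unfolding eventually_at_topological
      proof (intro exI[of _ UNIV] conjI ballI impI)
        fix w assume w: "w \<noteq> v" "w \<in> V"
        have "norm ((1 / norm (w - v)) *\<^sub>R (c w - (c v + q v \<bullet> (w - v))))
            = norm (c w - c v - q v \<bullet> (w - v)) / norm (w - v)"
          by (simp add: diff_diff_eq)
        also have "\<dots> \<le> \<nu> * (norm (w - v))\<^sup>2 / norm (w - v)"
          using bound[OF w(2)] by (rule divide_right_mono) simp
        finally show "norm ((1 / norm (w - v)) *\<^sub>R (c w - (c v + q v \<bullet> (w - v)))) \<le> \<nu> * norm (w - v)"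
          using w by (simp add: power2_eq_square)
      qed auto
    qed simp
  qed
  then have "gradient_on V c v = q v"
    by (rule gradient_on_eqI[OF V(1) v qV])
  then have "grad_conj_on V l v = q v" unfolding grad_conj_on_def c_def .
  then show ?thesis using q[OF v] by simp
qed

lemma convex_gradient_subdiff:
  fixes h :: "'a::{real_inner, complete_space} \<Rightarrow> real"
  assumes h: "convex_on UNIV h" "h differentiable (at x)"
  shows "gradient_on UNIV h x \<in> subdiff_on UNIV (\<lambda>x. ereal (h x)) x"
proof -
  obtain h' where h': "(h has_derivative h') (at x)" using h(2) by (auto simp: differentiable_def)
  from riesz_representation_on[OF subspace_UNIV closed_UNIV has_derivative_bounded_linear[OF this]]
  obtain D where D: "h' = (\<lambda>d. D \<bullet> d)" by (metis UNIV_I ext)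
  have grad: "gradient_on UNIV h x = D"
    using gradient_on_eqI[of UNIV x D h] h' by (simp add: D)
  have "h x + D \<bullet> (y - x) \<le> h y" for y
  proof -
    define k where "k = (\<lambda>t::real. h (x + t *\<^sub>R (y - x)))"
    have "((\<lambda>t. x + t *\<^sub>R (y - x)) has_derivative (\<lambda>t. t *\<^sub>R (y - x))) (at 0)"
      by (auto intro!: derivative_eq_intros)
    from diff_chain_at[OF this, of h h'] h' have "(k has_derivative (\<lambda>t. D \<bullet> (t *\<^sub>R (y - x)))) (at 0)"
      by (simp add: o_def k_def D)
    then have k': "(k has_field_derivative D \<bullet> (y - x)) (at 0)"
      by (rule has_derivative_imp_has_field_derivative) simp
    have "convex_on UNIV k"
    proof (rule convex_onI)
      fix t a b :: real assume t: "0 < t" "t < 1"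
      have "x + ((1 - t) *\<^sub>R a + t *\<^sub>R b) *\<^sub>R (y - x)
          = (1 - t) *\<^sub>R (x + a *\<^sub>R (y - x)) + t *\<^sub>R (x + b *\<^sub>R (y - x))"
        by (simp add: algebra_simps)
      then show "k ((1 - t) *\<^sub>R a + t *\<^sub>R b) \<le> (1 - t) * k a + t * k b"
        using convex_onD[OF h(1), of t] t by (simp add: k_def)
    qed simp
    from convex_on_imp_above_tangent[OF this _ _ _ k', of 1]
    show ?thesis by (simp add: k_def)
  qed
  then show ?thesis by (simp add: grad subdiff_on_def)
qed

section \<open>Weak convergence\<close>

text \<open>
  Weak compactness of balls, for an arbitrary Hilbert space and in terms of filters, so that no
  subsequences have to be extracted. A vector \<open>X n\<close> is identified with the functional \<open>u \<mapsto> \<langle>X n, u\<rangle>\<close>; by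
  Tychonoff's theorem these functionals have a pointwise cluster point. It is again bounded and linear, hence
  represented by a vector.
\<close>

lemma weak_cluster_filter:
  fixes X :: "'i \<Rightarrow> 'a::{real_inner, complete_space}"
  assumes F: "F \<noteq> bot" and bdd: "eventually (\<lambda>n. norm (X n) \<le> M) F"
  obtains x F' where "F' \<noteq> bot" "F' \<le> F" "\<And>u. ((\<lambda>n. X n \<bullet> u) \<longlongrightarrow> x \<bullet> u) F'"
proof -
  define \<Phi> where "\<Phi> n = (\<lambda>u. X n \<bullet> u)" for n
  define K where "K = PiE UNIV (\<lambda>u::'a. {- (M * norm u)..M * norm u})"
  \<comment> \<open>The functionals take their value at \<open>u\<close> in the compact interval of radius \<open>M \<parallel>u\<parallel>\<close>.\<close>
  have "compactin (product_topology (\<lambda>u. euclidean) UNIV) K"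
    unfolding K_def compactin_PiE by simp
  then have "compact K" by (simp add: euclidean_product_topology)
  moreover have "eventually (\<lambda>\<phi>. \<phi> \<in> K) (filtermap \<Phi> F)"
    unfolding eventually_filtermap using bdd
  proof eventually_elim
    case (elim n)
    have "\<bar>X n \<bullet> u\<bar> \<le> M * norm u" for u
      using Cauchy_Schwarz_ineq2[of "X n" u] elim by (meson mult_right_mono norm_ge_zero order_trans)
    then show ?case by (auto simp: K_def \<Phi>_def abs_le_iff minus_le_iff)
  qed
  moreover have "filtermap \<Phi> F \<noteq> bot" using F by (simp add: filtermap_bot_iff)
  ultimately obtain \<phi> where \<phi>: "\<phi> \<in> K" "inf (nhds \<phi>) (filtermap \<Phi> F) \<noteq> bot"
    unfolding compact_filter by blast
  define F' where "F' = inf F (filtercomap \<Phi> (nhds \<phi>))"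
  have "F' \<noteq> bot"
  proof
    assume "F' = bot"
    then have "eventually (\<lambda>_. False) F'" by simp
    then obtain P Q where PQ: "eventually P F" "eventually Q (nhds \<phi>)"
        "\<And>n. P n \<Longrightarrow> Q (\<Phi> n) \<Longrightarrow> False"
      unfolding F'_def eventually_inf eventually_filtercomap by blast
    have "eventually (\<lambda>\<psi>. \<not> Q \<psi>) (filtermap \<Phi> F)"
      unfolding eventually_filtermap using PQ(1) by (rule eventually_mono) (use PQ(3) in blast)
    with PQ(2) have "eventually (\<lambda>_. False) (inf (nhds \<phi>) (filtermap \<Phi> F))"
      unfolding eventually_inf by blast
    with \<phi>(2) show False by (simp add: trivial_limit_def)
  qed
  have lim: "((\<lambda>n. X n \<bullet> u) \<longlongrightarrow> \<phi> u) F'" for u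
  proof -
    have "filterlim \<Phi> (nhds \<phi>) F'"
      unfolding F'_def by (intro filterlim_mono[OF filterlim_filtercomap order_refl] inf_le2)
    then have "((\<lambda>n. \<Phi> n u) \<longlongrightarrow> \<phi> u) F'"
      using open_vimage[OF _ continuous_on_product_coordinates[of u]]
      by (intro topological_tendstoI) (force dest: topological_tendstoD)
    then show ?thesis by (simp add: \<Phi>_def)
  qed
  have "bounded_linear \<phi>"
  proof (rule bounded_linear_intro)
    show "\<phi> (u + w) = \<phi> u + \<phi> w" for u w
      using tendsto_unique[OF \<open>F' \<noteq> bot\<close> lim[of "u + w"]] tendsto_add[OF lim[of u] lim[of w]]
      by (simp add: inner_add_right)
    show "\<phi> (c *\<^sub>R u) = c *\<^sub>R \<phi> u" for c u
      using tendsto_unique[OF \<open>F' \<noteq> bot\<close> lim[of "c *\<^sub>R u"]] tendsto_mult_left[OF lim[of u], of c]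
      by simp
    show "norm (\<phi> u) \<le> norm u * M" for u
      using \<phi>(1) by (auto simp: K_def PiE_iff abs_le_iff minus_le_iff mult.commute)
  qed
  from riesz_representation_on[OF subspace_UNIV closed_UNIV this]
  obtain x where "\<And>u. \<phi> u = x \<bullet> u" by (metis UNIV_I)
  then show ?thesis
    using that[of F' x] \<open>F' \<noteq> bot\<close> lim by (auto simp: F'_def)
qed

text \<open>
  A weak limit of points of \<open>V\<close> equals its orthogonal projection \<open>q\<close>, obtained here from Riesz
  representation on \<open>V\<close>.
\<close>

lemma weak_limit_in_closed_subspace:
  fixes X :: "'i \<Rightarrow> 'a::{real_inner, complete_space}"
  assumes V: "subspace V" "closed V" and F: "F \<noteq> bot" and X: "\<And>n. X n \<in> V"
    and lim: "\<And>u. ((\<lambda>n. X n \<bullet> u) \<longlongrightarrow> x \<bullet> u) F"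
  shows "x \<in> V"
proof -
  from riesz_representation_on[OF V bounded_linear_inner_right[of x]]
  obtain q where q: "q \<in> V" "\<And>y. y \<in> V \<Longrightarrow> x \<bullet> y = q \<bullet> y" by blast
  have orth: "y \<bullet> (x - q) = 0" if "y \<in> V" for y
    using q(2)[OF that] by (simp add: inner_diff_right inner_commute)
  have "((\<lambda>n. X n \<bullet> (x - q)) \<longlongrightarrow> 0) F" using X orth by simp
  with lim[of "x - q"] F have "x \<bullet> (x - q) = 0" using tendsto_unique by blast
  then have "(x - q) \<bullet> (x - q) = 0" using orth[OF q(1)] by (simp add: inner_diff_left)
  then show ?thesis using q(1) by simp
qed

text \<open>
  If \<open>x\<close> and \<open>y\<close> are two weak cluster points in \<open>S\<close>, then \<open>\<langle>X n, x - y\<rangle>\<close> converges, since by polarization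
  it is a combination of \<open>\<parallel>X n - x\<parallel>\<^sup>2\<close> and \<open>\<parallel>X n - y\<parallel>\<^sup>2\<close>. Its limit is both \<open>\<langle>x, x - y\<rangle>\<close> and \<open>\<langle>y, x - y\<rangle>\<close>, so \<open>x = y\<close>.
\<close>

lemma opial:
  fixes X :: "nat \<Rightarrow> 'a::{real_inner, complete_space}"
  assumes S: "S \<noteq> {}" and conv: "\<And>s. s \<in> S \<Longrightarrow> convergent (\<lambda>n. norm (X n - s))"
    and cluster: "\<And>F x. F \<noteq> bot \<Longrightarrow> F \<le> sequentially \<Longrightarrow> (\<And>u. ((\<lambda>n. X n \<bullet> u) \<longlongrightarrow> x \<bullet> u) F) \<Longrightarrow> x \<in> S"
  obtains x where "x \<in> S" "weakly_tendsto X x"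
proof -
  obtain s where s: "s \<in> S" using S by blast
  have "Bseq (\<lambda>n. norm (X n - s))" using conv[OF s] by (rule convergent_imp_Bseq)
  then obtain K where K: "\<And>n. norm (X n - s) \<le> K" by (auto simp: Bseq_def)
  have bdd: "norm (X n) \<le> K + norm s" for n
    using norm_triangle_ineq[of "X n - s" s] K[of n] by simp
  obtain x F1 where F1: "F1 \<noteq> bot" "F1 \<le> sequentially" "\<And>u. ((\<lambda>n. X n \<bullet> u) \<longlongrightarrow> x \<bullet> u) F1"
    using weak_cluster_filter[OF sequentially_bot always_eventually] bdd by metis
  have x: "x \<in> S" using cluster[OF F1] .
  have "(\<lambda>n. X n \<bullet> u) \<longlonglongrightarrow> x \<bullet> u" for u
  proof (rule ccontr)
    assume "\<not> (\<lambda>n. X n \<bullet> u) \<longlonglongrightarrow> x \<bullet> u"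
    then obtain e where e: "e > 0" "\<not> eventually (\<lambda>n. dist (X n \<bullet> u) (x \<bullet> u) < e) sequentially"
      by (auto simp: tendsto_iff)
    \<comment> \<open>Restricting to the indices that stay away from the limit produces a second cluster point \<open>y\<close>.\<close>
    define F0 where "F0 = inf sequentially (principal {n. \<not> dist (X n \<bullet> u) (x \<bullet> u) < e})"
    have "F0 \<noteq> bot"
      using e(2) unfolding F0_def trivial_limit_def eventually_inf_principal by simp
    from weak_cluster_filter[OF this always_eventually] bdd
    obtain y F2 where F2: "F2 \<noteq> bot" "F2 \<le> F0" "\<And>u. ((\<lambda>n. X n \<bullet> u) \<longlongrightarrow> y \<bullet> u) F2" by metis
    have F2': "F2 \<le> sequentially" using F2(2) by (simp add: F0_def)
    have y: "y \<in> S" using cluster[OF F2(1) F2' F2(3)] .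
    obtain a b where ab: "(\<lambda>n. norm (X n - x)) \<longlonglongrightarrow> a" "(\<lambda>n. norm (X n - y)) \<longlonglongrightarrow> b"
      using conv[OF x] conv[OF y] by (auto simp: convergent_def)
    have eq: "X n \<bullet> (x - y) = ((norm (X n - y))\<^sup>2 - (norm (X n - x))\<^sup>2 + (norm x)\<^sup>2 - (norm y)\<^sup>2) / 2" for n
      unfolding power2_norm_eq_inner by (simp add: inner_diff_left inner_diff_right inner_commute)
    define c where "c = (b\<^sup>2 - a\<^sup>2 + (norm x)\<^sup>2 - (norm y)\<^sup>2) / 2"
    have "(\<lambda>n. X n \<bullet> (x - y)) \<longlonglongrightarrow> c"
      unfolding eq c_def by (intro tendsto_intros ab) simp
    then have "((\<lambda>n. X n \<bullet> (x - y)) \<longlongrightarrow> c) F1" "((\<lambda>n. X n \<bullet> (x - y)) \<longlongrightarrow> c) F2"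
      using F1(2) F2' by (auto intro: tendsto_mono)
    then have "x \<bullet> (x - y) = c" "y \<bullet> (x - y) = c"
      using F1 F2 tendsto_unique by metis+
    then have "(x - y) \<bullet> (x - y) = 0" by (simp add: inner_diff_left)
    then have "x = y" by simp
    then have "eventually (\<lambda>n. dist (X n \<bullet> u) (x \<bullet> u) < e) F2"
      using F2(3)[of u] e(1) by (auto dest: tendstoD)
    moreover have "eventually (\<lambda>n. \<not> dist (X n \<bullet> u) (x \<bullet> u) < e) F2"
      by (rule filter_leD[OF F2(2)]) (simp add: F0_def eventually_inf_principal)
    ultimately have "eventually (\<lambda>n. False) F2" by eventually_elim simp
    then show False using F2(1) by (simp add: trivial_limit_def)
  qed
  then show ?thesis using that x by (auto simp: weakly_tendsto_def)
qed

section \<open>The forward-backward-forward method\<close>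

locale forward_backward_forward =
  fixes W :: "'a::{real_inner, complete_space} set" and A :: "'a \<Rightarrow> 'a set" and B :: "'a \<Rightarrow> 'a"
    and \<beta> \<epsilon> :: real and \<gamma> :: "nat \<Rightarrow> real" and w p :: "nat \<Rightarrow> 'a"
  assumes W: "subspace W" "closed W"
    and A_dom: "\<And>x u. u \<in> A x \<Longrightarrow> x \<in> W"
    and A_mono: "\<And>x y u v. u \<in> A x \<Longrightarrow> v \<in> A y \<Longrightarrow> (u - v) \<bullet> (x - y) \<ge> 0"
    and A_resolvent: "\<And>c x. c > 0 \<Longrightarrow> x \<in> W \<Longrightarrow> \<exists>y. (1 / c) *\<^sub>R (x - y) \<in> A y"
    and B_W: "\<And>x. x \<in> W \<Longrightarrow> B x \<in> W"
    and B_mono: "\<And>x y. x \<in> W \<Longrightarrow> y \<in> W \<Longrightarrow> (B x - B y) \<bullet> (x - y) \<ge> 0"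
    and B_lipschitz: "\<And>x y. x \<in> W \<Longrightarrow> y \<in> W \<Longrightarrow> norm (B x - B y) \<le> \<beta> * norm (x - y)"
    and \<beta>: "\<beta> > 0" and \<epsilon>: "0 < \<epsilon>" "\<epsilon> < 1"
    and \<gamma>: "\<And>n. \<epsilon> \<le> \<gamma> n" "\<And>n. \<gamma> n * \<beta> \<le> 1 - \<epsilon>"
    and w0: "w 0 \<in> W"
    and p: "\<And>n. w n \<in> W \<Longrightarrow> (1 / \<gamma> n) *\<^sub>R (w n - \<gamma> n *\<^sub>R B (w n) - p n) \<in> A (p n)"
    and w_Suc: "\<And>n. w (Suc n) = p n + \<gamma> n *\<^sub>R (B (w n) - B (p n))"
begin

text \<open>
  Maximality of \<open>A + B\<close> in the form needed. For small \<open>c\<close> the map \<open>a \<mapsto> (Id + c A)\<^sup>-\<^sup>1 (x - c B a)\<close> is a contraction; its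
  fixed point \<open>a\<close> satisfies \<open>(x - a) / c \<in> A a + B a\<close>. Testing monotonicity of \<open>A + B\<close> against this point and
  passing to the limit gives \<open>- \<parallel>x - a\<parallel>\<^sup>2 / c \<ge> 0\<close>, so \<open>x = a\<close> is a zero.
\<close>

lemma demiclosed_sum:
  assumes F: "F \<noteq> bot" and yu: "\<And>n. u n - B (y n) \<in> A (y n)" and bdd: "\<And>n. norm (y n) \<le> K"
    and weak: "\<And>a. ((\<lambda>n. y n \<bullet> a) \<longlongrightarrow> x \<bullet> a) F" and u: "(u \<longlongrightarrow> 0) F"
  shows "- B x \<in> A x"
proof -
  have yW: "y n \<in> W" for n using A_dom[OF yu] .
  have xW: "x \<in> W" using weak_limit_in_closed_subspace[OF W F yW weak] .
  \<comment> \<open>This choice of \<open>c\<close> makes the contraction constant \<open>c \<beta> = 1/2\<close>.\<close>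
  define c where "c = 1 / (2 * \<beta>)"
  have c: "c > 0" "c * \<beta> = 1/2" using \<beta> by (auto simp: c_def)
  obtain J where J: "\<And>a. a \<in> W \<Longrightarrow> (1 / c) *\<^sub>R (a - J a) \<in> A (J a)"
    using A_resolvent[OF c(1)] by metis
  have J_nonexp: "norm (J a - J b) \<le> norm (a - b)" if "a \<in> W" "b \<in> W" for a b
  proof -
    have "((1 / c) *\<^sub>R (a - J a) - (1 / c) *\<^sub>R (b - J b)) \<bullet> (J a - J b) \<ge> 0"
      using A_mono J that by blast
    moreover have "(1 / c) *\<^sub>R (a - J a) - (1 / c) *\<^sub>R (b - J b) = (1 / c) *\<^sub>R ((a - b) - (J a - J b))"
      by (simp add: algebra_simps)
    ultimately have "(1 / c) * (((a - b) - (J a - J b)) \<bullet> (J a - J b)) \<ge> 0"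
      by (simp only: inner_scaleR_left)
    then have "(J a - J b) \<bullet> (J a - J b) \<le> (a - b) \<bullet> (J a - J b)"
      using c(1) by (simp add: zero_le_divide_iff inner_diff_left)
    also have "\<dots> \<le> norm (a - b) * norm (J a - J b)" by (rule norm_cauchy_schwarz)
    finally have "norm (J a - J b) * norm (J a - J b) \<le> norm (a - b) * norm (J a - J b)"
      by (simp add: power2_norm_eq_inner[symmetric] power2_eq_square)
    then show ?thesis by (cases "J a = J b") auto
  qed
  have stepW: "x - c *\<^sub>R B a \<in> W" if "a \<in> W" for a
    using W xW B_W[OF that] by (auto intro: subspace_diff subspace_scale)
  have "\<exists>!a. a \<in> W \<and> J (x - c *\<^sub>R B a) = a"
  proof (rule Banach_fix[where c="1/2"])
    show "complete W" using W(2) by (simp add: complete_eq_closed)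
    show "W \<noteq> {}" using xW by blast
    show "(\<lambda>a. J (x - c *\<^sub>R B a)) ` W \<subseteq> W" using A_dom[OF J[OF stepW]] by blast
    fix a b assume ab: "a \<in> W" "b \<in> W"
    have "norm (J (x - c *\<^sub>R B a) - J (x - c *\<^sub>R B b)) \<le> norm (c *\<^sub>R (B b - B a))"
      using J_nonexp[OF stepW[OF ab(1)] stepW[OF ab(2)]] by (simp add: scaleR_diff_right)
    also have "\<dots> = c * norm (B a - B b)" using c by (simp add: norm_minus_commute)
    also have "\<dots> \<le> c * (\<beta> * norm (a - b))"
      using B_lipschitz[OF ab] c by (intro mult_left_mono) auto
    finally show "dist (J (x - c *\<^sub>R B a)) (J (x - c *\<^sub>R B b)) \<le> 1/2 * dist a b"
      using c(2) by (simp add: dist_norm mult.assoc[symmetric])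
  qed auto
  then obtain a where a: "a \<in> W" "J (x - c *\<^sub>R B a) = a" by blast
  have aA: "(1 / c) *\<^sub>R (x - a) - B a \<in> A a"
    using J[OF stepW[OF a(1)]] c(1) by (simp add: a(2) algebra_simps)
  have ge: "u n \<bullet> (y n - a) - (1 / c) * (y n \<bullet> (x - a) - a \<bullet> (x - a)) \<ge> 0" for n
  proof -
    have "(u n - B (y n) - ((1 / c) *\<^sub>R (x - a) - B a)) \<bullet> (y n - a) \<ge> 0"
      using A_mono[OF yu aA] .
    then show ?thesis using B_mono[OF yW a(1), of n]
      by (simp add: inner_diff_left inner_diff_right inner_commute algebra_simps)
  qed
  have "((\<lambda>n. u n \<bullet> (y n - a)) \<longlongrightarrow> 0) F"
  proof (rule Lim_null_comparison)
    show "((\<lambda>n. norm (u n) * (K + norm a)) \<longlongrightarrow> 0) F"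
      using tendsto_mult_left_zero[OF tendsto_norm_zero[OF u]] .
    have "norm (u n \<bullet> (y n - a)) \<le> norm (u n) * (K + norm a)" for n
    proof -
      have "norm (u n \<bullet> (y n - a)) \<le> norm (u n) * norm (y n - a)"
        by (simp add: Cauchy_Schwarz_ineq2)
      also have "\<dots> \<le> norm (u n) * (K + norm a)"
        using norm_triangle_ineq4[of "y n" a] bdd[of n] by (intro mult_left_mono) auto
      finally show ?thesis .
    qed
    then show "\<forall>\<^sub>F n in F. norm (u n \<bullet> (y n - a)) \<le> norm (u n) * (K + norm a)" by simp
  qed
  then have "((\<lambda>n. u n \<bullet> (y n - a) - (1 / c) * (y n \<bullet> (x - a) - a \<bullet> (x - a)))
      \<longlongrightarrow> 0 - (1 / c) * (x \<bullet> (x - a) - a \<bullet> (x - a))) F"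
    by (intro tendsto_intros weak)
  then have "0 - (1 / c) * (x \<bullet> (x - a) - a \<bullet> (x - a)) \<ge> 0"
    using ge by (intro tendsto_lowerbound[OF _ _ F]) auto
  then have "(x - a) \<bullet> (x - a) \<le> 0" using c(1) by (simp add: inner_diff_left divide_le_0_iff)
  then have "x = a" using inner_ge_zero[of "x - a"] inner_eq_zero_iff[of "x - a"] by simp
  then show ?thesis using aA by simp
qed

lemma \<gamma>_pos: "\<gamma> n > 0"
  using \<epsilon>(1) \<gamma>(1)[of n] by linarith

lemma w_W: "w n \<in> W"
proof (induction n)
  case (Suc n)
  then show ?case
    unfolding w_Suc using W A_dom[OF p[OF Suc]] B_W by (auto intro!: subspace_add subspace_scale subspace_diff)
qed (rule w0)

lemma p_W: "p n \<in> W" using A_dom[OF p[OF w_W]] .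

text \<open>
  The second forward step is made for this: it replaces \<open>B w\<^sub>n\<close> by \<open>B p\<^sub>n\<close> in the inclusion that defines \<open>p\<^sub>n\<close>.
\<close>

lemma residual: "(1 / \<gamma> n) *\<^sub>R (w n - w (Suc n)) - B (p n) \<in> A (p n)"
proof -
  have "(1 / \<gamma> n) *\<^sub>R (w n - w (Suc n)) - B (p n)
      = (1 / \<gamma> n) *\<^sub>R (w n - \<gamma> n *\<^sub>R B (w n) - p n)"
    unfolding w_Suc using \<gamma>_pos[of n] by (simp add: algebra_simps)
  then show ?thesis using p[OF w_W] by simp
qed

text \<open>
  The polarization identity with the extra term \<open>\<parallel>w\<^sub>n\<^sub>+\<^sub>1 - p\<^sub>n\<parallel>\<^sup>2 = \<gamma>\<^sub>n\<^sup>2 \<parallel>B w\<^sub>n - B p\<^sub>n\<parallel>\<^sup>2\<close>, which the step size bound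
  keeps below \<open>(1 - \<epsilon>) \<parallel>w\<^sub>n - p\<^sub>n\<parallel>\<^sup>2\<close>. The point \<open>s\<close> is arbitrary: zeros of \<open>A + B\<close> are used for
  convergence, points of \<open>B1 \<times> B2\<close> for the gap.
\<close>

lemma step_estimate:
  "2 * ((w n - w (Suc n)) \<bullet> (p n - s))
    \<le> (norm (w n - s))\<^sup>2 - (norm (w (Suc n) - s))\<^sup>2 - \<epsilon> * (norm (w n - p n))\<^sup>2"
proof -
  have "norm (w (Suc n) - p n) = \<gamma> n * norm (B (w n) - B (p n))"
    using \<gamma>_pos[of n] by (simp add: w_Suc)
  also have "\<dots> \<le> \<gamma> n * (\<beta> * norm (w n - p n))"
    using \<gamma>_pos[of n] B_lipschitz[OF w_W p_W] by (intro mult_left_mono) auto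
  also have "\<dots> \<le> (1 - \<epsilon>) * norm (w n - p n)"
    using mult_right_mono[OF \<gamma>(2)[of n] norm_ge_zero[of "w n - p n"]] by (simp add: mult.assoc)
  finally have "(norm (w (Suc n) - p n))\<^sup>2 \<le> ((1 - \<epsilon>) * norm (w n - p n))\<^sup>2"
    by (intro power_mono) auto
  also have "\<dots> \<le> (1 - \<epsilon>) * (norm (w n - p n))\<^sup>2"
    unfolding power_mult_distrib using \<epsilon> by (intro mult_right_mono) (auto simp: power2_eq_square mult_left_le)
  finally have "(norm (w (Suc n) - p n))\<^sup>2 \<le> (1 - \<epsilon>) * (norm (w n - p n))\<^sup>2" .
  moreover have "2 * ((w n - w (Suc n)) \<bullet> (p n - s))
      = (norm (w n - s))\<^sup>2 - (norm (w (Suc n) - s))\<^sup>2 - (norm (w n - p n))\<^sup>2 + (norm (w (Suc n) - p n))\<^sup>2"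
    unfolding power2_norm_eq_inner by (simp add: inner_diff_left inner_diff_right inner_commute)
  ultimately show ?thesis by (simp add: algebra_simps)
qed

lemma fejer_step:
  assumes s: "- B s \<in> A s"
  shows "(norm (w (Suc n) - s))\<^sup>2 + \<epsilon> * (norm (w n - p n))\<^sup>2 \<le> (norm (w n - s))\<^sup>2"
proof -
  have "((1 / \<gamma> n) *\<^sub>R (w n - w (Suc n)) - B (p n) - - B s) \<bullet> (p n - s) \<ge> 0"
    using A_mono[OF residual s] .
  then have "((1 / \<gamma> n) *\<^sub>R (w n - w (Suc n))) \<bullet> (p n - s) \<ge> 0"
    using B_mono[OF p_W A_dom[OF s], of n] by (simp add: inner_diff_left inner_add_left)
  then have "(w n - w (Suc n)) \<bullet> (p n - s) \<ge> 0"
    using \<gamma>_pos[of n] by (simp add: zero_le_divide_iff)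
  then show ?thesis using step_estimate[of n s] by linarith
qed

lemma fejer:
  assumes s: "- B s \<in> A s"
  shows "decseq (\<lambda>n. norm (w n - s))"
proof (rule decseq_SucI)
  fix n
  have "\<epsilon> * (norm (w n - p n))\<^sup>2 \<ge> 0" using \<epsilon> by simp
  with fejer_step[OF s, of n] have "(norm (w (Suc n) - s))\<^sup>2 \<le> (norm (w n - s))\<^sup>2" by linarith
  then show "norm (w (Suc n) - s) \<le> norm (w n - s)" by (simp add: power_mono_iff)
qed

lemma forward_backward_gap_null:
  assumes s: "- B s \<in> A s"
  shows "(\<lambda>n. w n - p n) \<longlonglongrightarrow> 0"
proof -
  have "convergent (\<lambda>n. norm (w n - s))"
    by (rule decseq_convergent[OF fejer[OF s], of 0]) (auto simp: convergent_def)
  then obtain a where a: "(\<lambda>n. norm (w n - s)) \<longlonglongrightarrow> a" by (auto simp: convergent_def)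
  then have "(\<lambda>n. ((norm (w n - s))\<^sup>2 - (norm (w (Suc n) - s))\<^sup>2) / \<epsilon>) \<longlonglongrightarrow> (a\<^sup>2 - a\<^sup>2) / \<epsilon>"
    by (intro tendsto_intros LIMSEQ_Suc[of "\<lambda>n. norm (w n - s)"]) (use \<epsilon> in auto)
  then have "(\<lambda>n. (norm (w n - p n))\<^sup>2) \<longlonglongrightarrow> 0"
    by (rule Lim_null_comparison[rotated, OF tendsto_eq_rhs])
       (use fejer_step[OF s] \<epsilon> in \<open>auto intro!: always_eventually simp: field_simps\<close>)
  then show ?thesis by (simp add: tendsto_norm_zero_iff)
qed

lemma weak_convergence:
  assumes s: "- B s \<in> A s"
  obtains wb where "- B wb \<in> A wb" "weakly_tendsto w wb" "weakly_tendsto p wb"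
proof -
  have conv: "convergent (\<lambda>n. norm (w n - s))" if "- B s \<in> A s" for s
    by (rule decseq_convergent[OF fejer[OF that], of 0]) (auto simp: convergent_def)
  note null = forward_backward_gap_null[OF s]
  have shift: "((\<lambda>n. p n \<bullet> a) \<longlongrightarrow> x \<bullet> a) F"
    if "((\<lambda>n. w n \<bullet> a) \<longlongrightarrow> x \<bullet> a) F" "F \<le> sequentially" for x a F
  proof -
    have "((\<lambda>n. w n - p n) \<longlongrightarrow> 0) F" using null that(2) by (rule tendsto_mono[rotated])
    then have "((\<lambda>n. w n \<bullet> a - (w n - p n) \<bullet> a) \<longlongrightarrow> x \<bullet> a - 0 \<bullet> a) F"
      by (intro tendsto_diff[OF that(1)] tendsto_inner tendsto_const)
    then show ?thesis by (simp add: inner_diff_left)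
  qed
  have "Bseq (\<lambda>n. w n - p n)" using null by (intro convergent_imp_Bseq convergentI)
  then obtain K where K: "\<And>n. norm (w n - p n) \<le> K" by (auto simp: Bseq_def)
  have bdd: "norm (p n) \<le> K + (norm (w 0 - s) + norm s)" for n
    using norm_triangle_ineq[of "w n - s" s] norm_triangle_ineq4[of "w n" "w n - p n"] K[of n]
      decseqD[OF fejer[OF s], of 0 n] by simp
  have res: "(\<lambda>n. (1 / \<gamma> n) *\<^sub>R (w n - w (Suc n))) \<longlonglongrightarrow> 0"
  proof (rule Lim_null_comparison)
    show "(\<lambda>n. (1 / \<epsilon> + \<beta>) * norm (w n - p n)) \<longlonglongrightarrow> 0"
      using tendsto_mult_right_zero[OF tendsto_norm_zero[OF null]] .
    have "norm ((1 / \<gamma> n) *\<^sub>R (w n - w (Suc n))) \<le> (1 / \<epsilon> + \<beta>) * norm (w n - p n)" for n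
    proof -
      have "(1 / \<gamma> n) *\<^sub>R (w n - w (Suc n)) = (1 / \<gamma> n) *\<^sub>R (w n - p n) - (B (w n) - B (p n))"
        unfolding w_Suc using \<gamma>_pos[of n] by (simp add: algebra_simps)
      then have "norm ((1 / \<gamma> n) *\<^sub>R (w n - w (Suc n)))
          \<le> norm ((1 / \<gamma> n) *\<^sub>R (w n - p n)) + norm (B (w n) - B (p n))"
        by (metis norm_triangle_ineq4)
      also have "\<dots> \<le> (1 / \<epsilon>) * norm (w n - p n) + \<beta> * norm (w n - p n)"
      proof (rule add_mono)
        have "1 / \<gamma> n \<le> 1 / \<epsilon>" using \<gamma>(1)[of n] \<epsilon>(1) by (intro divide_left_mono) auto
        then show "norm ((1 / \<gamma> n) *\<^sub>R (w n - p n)) \<le> (1 / \<epsilon>) * norm (w n - p n)"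
          using \<gamma>_pos[of n] mult_right_mono[of "1 / \<gamma> n" "1 / \<epsilon>" "norm (w n - p n)"] by simp
      qed (rule B_lipschitz[OF w_W p_W])
      finally show ?thesis by (simp add: distrib_right)
    qed
    then show "\<forall>\<^sub>F n in sequentially. norm ((1 / \<gamma> n) *\<^sub>R (w n - w (Suc n))) \<le> (1 / \<epsilon> + \<beta>) * norm (w n - p n)"
      by simp
  qed
  obtain wb where wb: "wb \<in> {s. - B s \<in> A s}" "weakly_tendsto w wb"
  proof (rule opial[of "{s. - B s \<in> A s}" w])
    show "{s. - B s \<in> A s} \<noteq> {}" using s by blast
    show "convergent (\<lambda>n. norm (w n - s))" if "s \<in> {s. - B s \<in> A s}" for s
      using conv that by simp
    fix F x assume F: "F \<noteq> bot" "F \<le> sequentially" and lim: "\<And>u. ((\<lambda>n. w n \<bullet> u) \<longlongrightarrow> x \<bullet> u) F"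
    show "x \<in> {s. - B s \<in> A s}"
      using demiclosed_sum[OF F(1) residual bdd shift[OF lim F(2)] tendsto_mono[OF F(2) res]] by simp
  qed
  then have "weakly_tendsto p wb" using shift by (auto simp: weakly_tendsto_def)
  then show ?thesis using that wb by simp
qed

end

section \<open>The primal-dual problem as a monotone inclusion\<close>

lemma norm_vec_sq: "(norm (v :: 'g::real_inner ^ 'm::finite))\<^sup>2 = (\<Sum>i\<in>UNIV. (norm (v $ i))\<^sup>2)"
  by (simp add: norm_vec_def L2_set_def sum_nonneg)

lemma norm_Pair_sq: "(norm (a, b))\<^sup>2 = (norm a)\<^sup>2 + (norm b)\<^sup>2"
  by (simp add: norm_Pair)

lemma subspace_prod_space:
  fixes G :: "'m::finite \<Rightarrow> 'g::real_vector set"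
  assumes "\<And>i. subspace (G i)"
  shows "subspace (prod_space G)"
  using assms by (simp add: subspace_def prod_space_def)

lemma closed_prod_space:
  fixes G :: "'m::finite \<Rightarrow> 'g::topological_space set"
  assumes "\<And>i. closed (G i)"
  shows "closed (prod_space G)"
proof -
  have "prod_space G = (\<Inter>i. (\<lambda>v. v $ i) -` G i)" by (auto simp: prod_space_def)
  then show ?thesis
    using assms by (auto intro!: closed_INT closed_vimage continuous_intros)
qed

locale composite_problem =
  fixes f :: "'h::{real_inner, complete_space} \<Rightarrow> ereal"
    and h :: "'h \<Rightarrow> real" and z :: 'h
    and G :: "'m::finite \<Rightarrow> 'g::{real_inner, complete_space} set"
    and g l :: "'m \<Rightarrow> 'g \<Rightarrow> ereal"
    and L :: "'m \<Rightarrow> 'h \<Rightarrow> 'g"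
    and r :: "'g ^ 'm"
    and \<mu> :: real and \<nu> :: "'m \<Rightarrow> real"
  assumes G: "\<And>i. subspace (G i)" "\<And>i. closed (G i)"
    and f: "f \<in> Gamma_on UNIV"
    and h_convex: "convex_on UNIV h"
    and h_diff: "\<And>y. h differentiable (at y)"
    and h_lipschitz: "\<mu> > 0" "lipschitz_on \<mu> UNIV (gradient_on UNIV h)"
    and r: "r \<in> prod_space G"
    and g: "\<And>i. g i \<in> Gamma_on (G i)"
    and l: "\<And>i. l i \<in> Gamma_on (G i)"
    and l_strong: "\<And>i. \<nu> i > 0" "\<And>i. strongly_convex_on (inverse (\<nu> i)) (G i) (l i)"
    and L: "\<And>i. bounded_linear (L i)" "\<And>i y. L i y \<in> G i"
begin

abbreviation "gh \<equiv> gradient_on UNIV h"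
abbreviation "gl i \<equiv> grad_conj_on (G i) (l i)"
abbreviation "gs i \<equiv> conjugate_on (G i) (g i)"
abbreviation "ls i \<equiv> conjugate_on (G i) (l i)"
abbreviation "Ladj v \<equiv> (\<Sum>i\<in>UNIV. adjoint (L i) (v $ i))"

lemma r_G: "r $ i \<in> G i" using r by (simp add: prod_space_def)

lemma gs: "gs i \<in> Gamma_on (G i)" using conjugate_Gamma[OF G g] .

lemma gl: "v \<in> G i \<Longrightarrow> v \<in> subdiff_on (G i) (l i) (gl i v)"
  using grad_conj_subdiff[OF G l l_strong] .

lemma gl_G: "v \<in> G i \<Longrightarrow> gl i v \<in> G i" using subdiff_onD(2)[OF gl] .

lemma gl_ls: "v \<in> G i \<Longrightarrow> gl i v \<in> subdiff_on (G i) (ls i) v"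
  using subdiff_conjugateI[OF gl] .

lemma gh: "gh x \<in> subdiff_on UNIV (\<lambda>x. ereal (h x)) x"
  using convex_gradient_subdiff[OF h_convex h_diff] .

lemma Ladj_inner: "x \<bullet> Ladj v = stack_op L x \<bullet> v"
  by (simp add: inner_sum_right adjoint_bounded_linear[OF L(1)] inner_vec_def stack_op_def)

lemma stack_op_diff: "stack_op L (x - y) = stack_op L x - stack_op L y"
  by (simp add: stack_op_def vec_eq_iff bounded_linear.linear[OF L(1)] linear_diff)

text \<open>
  Linearity of the adjoints is read off from the inner products that determine them.
\<close>

lemma Ladj_diff: "Ladj (v - w) = Ladj v - Ladj w"
proof -
  have "\<forall>x. x \<bullet> Ladj (v - w) = x \<bullet> (Ladj v - Ladj w)"
    unfolding inner_diff_right Ladj_inner by (rule allI, rule refl)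
  then show ?thesis by (rule iffD1[OF vector_eq_ldot])
qed

definition "L_norm = sqrt (\<Sum>i\<in>UNIV. (onorm (L i))\<^sup>2)"

lemma norm_stack_op: "norm (stack_op L x) \<le> L_norm * norm x"
proof (rule power2_le_imp_le)
  have "(norm (stack_op L x))\<^sup>2 = (\<Sum>i\<in>UNIV. (norm (L i x))\<^sup>2)"
    by (simp add: norm_vec_sq stack_op_def)
  also have "\<dots> \<le> (\<Sum>i\<in>UNIV. (onorm (L i) * norm x)\<^sup>2)"
    by (intro sum_mono power_mono onorm[OF L(1)] norm_ge_zero)
  also have "\<dots> = (L_norm * norm x)\<^sup>2"
    by (simp add: L_norm_def power_mult_distrib sum_nonneg sum_distrib_right)
  finally show "(norm (stack_op L x))\<^sup>2 \<le> (L_norm * norm x)\<^sup>2" .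
qed (simp add: L_norm_def sum_nonneg)

lemma norm_Ladj: "norm (Ladj v) \<le> L_norm * norm v"
proof (cases "Ladj v = 0")
  case True
  then show ?thesis by (simp add: L_norm_def sum_nonneg)
next
  case False
  have "norm (Ladj v) * norm (Ladj v) = stack_op L (Ladj v) \<bullet> v"
    unfolding Ladj_inner[symmetric] by (simp add: power2_norm_eq_inner[symmetric] power2_eq_square)
  also have "\<dots> \<le> norm (stack_op L (Ladj v)) * norm v" by (rule norm_cauchy_schwarz)
  also have "\<dots> \<le> (L_norm * norm (Ladj v)) * norm v"
    by (intro mult_right_mono norm_stack_op) simp
  finally have "norm (Ladj v) * norm (Ladj v) \<le> (L_norm * norm v) * norm (Ladj v)"
    by (simp add: mult_ac)
  then show ?thesis using False by simp
qed

definition "W = (UNIV :: 'h set) \<times> prod_space G"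

text \<open>
  The zeros of \<open>A + B\<close> are the solutions of the optimality system of the primal-dual pair; \<open>A\<close> collects the
  terms that the algorithm treats by proximity operators, \<open>B\<close> those that it evaluates directly.
\<close>

definition A :: "'h \<times> ('g ^ 'm) \<Rightarrow> ('h \<times> ('g ^ 'm)) set" where
  "A w = {(a, b). a + z \<in> subdiff_on UNIV f (fst w)
      \<and> (\<forall>i. b $ i - r $ i \<in> subdiff_on (G i) (gs i) (snd w $ i))}"

definition B :: "'h \<times> ('g ^ 'm) \<Rightarrow> 'h \<times> ('g ^ 'm)" where
  "B w = (gh (fst w) + Ladj (snd w), \<chi> i. gl i (snd w $ i) - L i (fst w))"

lemma mem_W: "(x, v) \<in> W \<longleftrightarrow> (\<forall>i. v $ i \<in> G i)"
  by (simp add: W_def prod_space_def)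

lemma W: "subspace W" "closed W"
  unfolding W_def
  using subspace_Times[OF subspace_UNIV subspace_prod_space[of G]]
    closed_Times[OF closed_UNIV closed_prod_space[of G]] G by auto

lemma A_dom: "u \<in> A w \<Longrightarrow> w \<in> W"
  by (cases w) (auto simp: A_def mem_W dest: subdiff_onD(2))

lemma A_mono:
  assumes "u \<in> A x" "w \<in> A y"
  shows "(u - w) \<bullet> (x - y) \<ge> 0"
proof -
  have 1: "(fst u + z - (fst w + z)) \<bullet> (fst x - fst y) \<ge> 0"
    using assms by (intro subdiff_monotone) (auto simp: A_def)
  have "(snd u $ i - r $ i - (snd w $ i - r $ i)) \<bullet> (snd x $ i - snd y $ i) \<ge> 0" for i
    using assms by (intro subdiff_monotone) (auto simp: A_def)
  then have "(snd u - snd w) \<bullet> (snd x - snd y) \<ge> 0"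
    by (auto simp: inner_vec_def intro!: sum_nonneg)
  with 1 show ?thesis by (simp add: inner_prod_def)
qed

lemma A_resolvent:
  assumes c: "c > 0" and w: "w \<in> W"
  shows "\<exists>y. (1 / c) *\<^sub>R (w - y) \<in> A y"
proof -
  obtain x v where xv: "w = (x, v)" by (cases w)
  have vG: "v $ i - c *\<^sub>R r $ i \<in> G i" for i
    using G(1)[of i] w r_G by (auto simp: xv mem_W intro: subspace_diff subspace_scale)
  obtain x' where x': "(1 / c) *\<^sub>R (x + c *\<^sub>R z - x') \<in> subdiff_on UNIV f x'"
    using prox_subdiff_exists[OF subspace_UNIV closed_UNIV f c UNIV_I] by blast
  have "\<forall>i. \<exists>y. (1 / c) *\<^sub>R (v $ i - c *\<^sub>R r $ i - y) \<in> subdiff_on (G i) (gs i) y"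
    using prox_subdiff_exists[OF G gs c vG] by metis
  then obtain y where y: "\<And>i. (1 / c) *\<^sub>R (v $ i - c *\<^sub>R r $ i - y i) \<in> subdiff_on (G i) (gs i) (y i)"
    by metis
  have "(1 / c) *\<^sub>R (w - (x', vec_lambda y)) \<in> A (x', vec_lambda y)"
    using x' y c by (auto simp: A_def xv algebra_simps)
  then show ?thesis by blast
qed

lemma B_W: "w \<in> W \<Longrightarrow> B w \<in> W"
  using G(1) gl_G L(2) by (cases w) (auto simp: mem_W B_def intro!: subspace_diff)

definition "smooth_const = Max (insert \<mu> (range \<nu>))"

lemma smooth_const: "\<mu> \<le> smooth_const" "\<nu> i \<le> smooth_const"
  unfolding smooth_const_def by (rule Max_ge; simp)+

lemma gl_mono: "v \<in> G i \<Longrightarrow> w \<in> G i \<Longrightarrow> (gl i v - gl i w) \<bullet> (v - w) \<ge> 0"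
  using subdiff_monotone[OF gl_ls gl_ls] .

text \<open>
  The terms with \<open>L\<close> and its adjoint form a skew operator and cancel; the gradients are monotone.
\<close>

lemma B_mono:
  assumes "w \<in> W" "w' \<in> W"
  shows "(B w - B w') \<bullet> (w - w') \<ge> 0"
proof -
  obtain x v x' v' where xv: "w = (x, v)" "w' = (x', v')" by (cases w; cases w')
  have 1: "(gh x - gh x') \<bullet> (x - x') \<ge> 0" using subdiff_monotone[OF gh gh] .
  have 2: "(\<Sum>i\<in>UNIV. (gl i (v $ i) - gl i (v' $ i)) \<bullet> (v $ i - v' $ i)) \<ge> 0"
    using assms by (intro sum_nonneg gl_mono) (auto simp: xv mem_W)
  have "(\<Sum>i\<in>UNIV. (gl i (v $ i) - L i x - (gl i (v' $ i) - L i x')) \<bullet> (v $ i - v' $ i))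
      = (\<Sum>i\<in>UNIV. (gl i (v $ i) - gl i (v' $ i)) \<bullet> (v $ i - v' $ i)) - stack_op L (x - x') \<bullet> (v - v')"
    unfolding stack_op_diff
    by (simp add: inner_vec_def stack_op_def sum_subtractf[symmetric] inner_diff_left algebra_simps)
  moreover have "(gh x + Ladj v - (gh x' + Ladj v')) \<bullet> (x - x')
      = (gh x - gh x') \<bullet> (x - x') + stack_op L (x - x') \<bullet> (v - v')"
  proof -
    have "gh x + Ladj v - (gh x' + Ladj v') = (gh x - gh x') + Ladj (v - v')"
      unfolding Ladj_diff by simp
    then show ?thesis
      by (simp only: Ladj_inner[symmetric] inner_add_left inner_commute[of "Ladj (v - v')" "x - x'"])
  qed
  ultimately show ?thesis using 1 2 by (simp add: xv B_def inner_prod_def inner_vec_def)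
qed

lemma gl_lipschitz: "v \<in> G i \<Longrightarrow> w \<in> G i \<Longrightarrow> norm (gl i v - gl i w) \<le> \<nu> i * norm (v - w)"
  using strongly_convex_subdiff_inverse_lipschitz[OF G(1) l_strong gl gl] .

text \<open>
  The gradient part \<open>D\<close> acts blockwise, hence the maximum of the constants. The skew part \<open>S\<close> exchanges the
  blocks, hence the norm of the stacked operator.
\<close>

lemma B_lipschitz:
  assumes "w \<in> W" "w' \<in> W"
  shows "norm (B w - B w') \<le> (smooth_const + L_norm) * norm (w - w')"
proof -
  obtain x v x' v' where xv: "w = (x, v)" "w' = (x', v')" by (cases w; cases w')
  define D where "D = (gh x - gh x', (\<chi> i. gl i (v $ i) - gl i (v' $ i)) :: 'g ^ 'm)"
  define S where "S = (Ladj (v - v'), - stack_op L (x - x'))"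
  have M: "smooth_const > 0" using smooth_const(1) h_lipschitz(1) by simp
  have "B w - B w' = D + S"
    unfolding S_def Ladj_diff stack_op_diff
    by (simp add: B_def D_def xv vec_eq_iff stack_op_def)
  then have "norm (B w - B w') \<le> norm D + norm S" by (simp add: norm_triangle_ineq)
  also have "norm D \<le> smooth_const * norm (w - w')"
  proof (rule power2_le_imp_le)
    have "norm (gh x - gh x') \<le> smooth_const * norm (x - x')"
      using lipschitz_onD[OF h_lipschitz(2), of x x'] mult_right_mono[OF smooth_const(1), of "norm (x - x')"]
      by (simp add: dist_norm)
    then have "(norm (gh x - gh x'))\<^sup>2 \<le> (smooth_const * norm (x - x'))\<^sup>2"
      by (intro power_mono) auto
    moreover have "norm (gl i (v $ i) - gl i (v' $ i)) \<le> smooth_const * norm (v $ i - v' $ i)" for i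
      using gl_lipschitz[of "v $ i" i "v' $ i"] assms
        mult_right_mono[OF smooth_const(2)[of i], of "norm (v $ i - v' $ i)"]
      by (simp add: xv mem_W)
    then have "(\<Sum>i\<in>UNIV. (norm (gl i (v $ i) - gl i (v' $ i)))\<^sup>2)
        \<le> (\<Sum>i\<in>UNIV. (smooth_const * norm (v $ i - v' $ i))\<^sup>2)"
      by (intro sum_mono power_mono) auto
    ultimately show "(norm D)\<^sup>2 \<le> (smooth_const * norm (w - w'))\<^sup>2"
      by (simp add: D_def xv norm_Pair_sq norm_vec_sq power_mult_distrib distrib_left sum_distrib_left)
  qed (use M in simp)
  also have "norm S \<le> L_norm * norm (w - w')"
  proof (rule power2_le_imp_le)
    have "(norm (Ladj (v - v')))\<^sup>2 \<le> (L_norm * norm (v - v'))\<^sup>2"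
      "(norm (stack_op L (x - x')))\<^sup>2 \<le> (L_norm * norm (x - x'))\<^sup>2"
      by (intro power_mono norm_Ladj norm_stack_op norm_ge_zero)+
    then show "(norm S)\<^sup>2 \<le> (L_norm * norm (w - w'))\<^sup>2"
      by (simp add: S_def xv norm_Pair_sq power_mult_distrib distrib_left)
  qed (simp add: L_norm_def sum_nonneg)
  finally show ?thesis by (simp add: distrib_right)
qed

end

section \<open>Saddle point estimates and optimality\<close>

lemma jensen_ergodic:
  fixes p :: "nat \<Rightarrow> 'a::real_vector"
  assumes \<phi>: "convex_on C \<phi>" and p: "\<And>n. p n \<in> C" and N: "N \<ge> 1"
  shows "ergodic p N \<in> C" "\<phi> (ergodic p N) \<le> (\<Sum>n<N. \<phi> (p n)) / real N"
proof -
  have eq: "ergodic p N = (\<Sum>n<N. (1 / real N) *\<^sub>R p n)"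
    by (simp add: ergodic_def scaleR_sum_right)
  have one: "(\<Sum>n<N. 1 / real N) = 1" "{..<N} \<noteq> {}" using N by (auto simp: lessThan_empty_iff)
  show "ergodic p N \<in> C"
    unfolding eq using convex_on_imp_convex[OF \<phi>] one p by (intro convex_sum) auto
  show "\<phi> (ergodic p N) \<le> (\<Sum>n<N. \<phi> (p n)) / real N"
  proof -
    have "\<phi> (ergodic p N) \<le> (\<Sum>n<N. (1 / real N) * \<phi> (p n))"
      unfolding eq using one p by (intro convex_on_sum[OF _ _ \<phi>]) auto
    then show ?thesis unfolding sum_distrib_left[symmetric] by simp
  qed
qed

lemma Gamma_on_imp_convex_on:
  fixes f :: "'a::real_inner \<Rightarrow> ereal"
  assumes V: "subspace V" and f: "f \<in> Gamma_on V"
  shows "convex_on {x\<in>V. f x \<noteq> \<infinity>} (\<lambda>x. real_of_ereal (f x))"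
proof -
  let ?D = "{x\<in>V. f x \<noteq> \<infinity>}"
  have real: "f x = ereal (real_of_ereal (f x))" if "x \<in> ?D" for x
    using that Gamma_onD(1)[OF f] by (cases "f x") (auto simp: proper_on_def)
  have le: "f ((1 - t) *\<^sub>R x + t *\<^sub>R y) \<le> ereal ((1 - t) * real_of_ereal (f x) + t * real_of_ereal (f y))"
    if t: "0 < t" "t < 1" and xy: "x \<in> ?D" "y \<in> ?D" for t x y
  proof -
    have "1 - t \<in> {0<..<1}" "x \<in> V" "y \<in> V" using t xy by auto
    then have "f ((1 - t) *\<^sub>R x + (1 - (1 - t)) *\<^sub>R y) \<le> ereal (1 - t) * f x + ereal (1 - (1 - t)) * f y"
      using f unfolding Gamma_on_def econvex_on_def by blast
    moreover obtain a b where "f x = ereal a" "f y = ereal b" using real xy by blast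
    ultimately show ?thesis by simp
  qed
  have memV: "(1 - t) *\<^sub>R x + t *\<^sub>R y \<in> V" if "x \<in> V" "y \<in> V" for t x y
    using V that by (intro subspace_add subspace_scale)
  have mem: "(1 - t) *\<^sub>R x + t *\<^sub>R y \<in> ?D" if "0 < t" "t < 1" "x \<in> ?D" "y \<in> ?D" for t x y
    using le[OF that] memV that by (cases "f ((1 - t) *\<^sub>R x + t *\<^sub>R y)") auto
  show ?thesis
  proof (rule convex_onI)
    fix t x y assume t: "0 < (t::real)" "t < 1" and xy: "x \<in> ?D" "y \<in> ?D"
    show "real_of_ereal (f ((1 - t) *\<^sub>R x + t *\<^sub>R y))
        \<le> (1 - t) * real_of_ereal (f x) + t * real_of_ereal (f y)"
      using le[OF t xy] mem[OF t xy] Gamma_onD(1)[OF f]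
      by (cases "f ((1 - t) *\<^sub>R x + t *\<^sub>R y)") (auto simp: proper_on_def)
  next
    show "convex ?D"
      unfolding convex_alt
    proof (intro ballI allI impI)
      fix x y and t :: real assume "x \<in> ?D" "y \<in> ?D" "0 \<le> t \<and> t \<le> 1"
      then show "(1 - t) *\<^sub>R x + t *\<^sub>R y \<in> ?D"
        using mem[of t x y] by (cases "t = 0 \<or> t = 1") auto
    qed
  qed
qed

text \<open>
  The Fenchel-Young inequalities for \<open>f\<close> and \<open>l\<close> at the two summands of a decomposition of \<open>x\<close>.
\<close>

lemma infconv_lower:
  assumes V: "subspace V" and x: "x \<in> V"
    and c: "conjugate_on V f w = ereal a" "conjugate_on V l w = ereal b"
  shows "ereal (w \<bullet> x - a - b) \<le> infconv_on V f l x"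
  unfolding infconv_on_def
proof (rule INF_greatest)
  fix y assume y: "y \<in> V"
  have "x - y \<in> V" using V x y by (rule subspace_diff)
  from fenchel_young[OF this, of w l] fenchel_young[OF y, of w f]
  show "ereal (w \<bullet> x - a - b) \<le> f y + l (x - y)"
    unfolding c by (cases "f y"; cases "l (x - y)") (auto simp: inner_diff_right)
qed

lemma infconv_upper: "y \<in> V \<Longrightarrow> infconv_on V f l x \<le> f y + l (x - y)"
  unfolding infconv_on_def by (rule INF_lower)

lemma ereal_add_le_approx:
  fixes T X S :: ereal
  assumes T: "T \<noteq> -\<infinity>" and X: "X \<noteq> -\<infinity>" and le: "\<And>c. ereal c < T \<Longrightarrow> ereal c + X \<le> S"
  shows "T + X \<le> S"
proof -
  obtain c where c: "ereal c < T" using T ereal_dense2[of "-\<infinity>" T] by auto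
  show ?thesis
  proof (cases X)
    case PInf
    then show ?thesis using le[OF c] by simp
  next
    case (real x)
    have "T \<le> S - ereal x"
    proof (rule ccontr)
      assume "\<not> T \<le> S - ereal x"
      then have "S - ereal x < T" by simp
      then obtain k where "S - ereal x < ereal k" "ereal k < T"
        using ereal_dense2[of "S - ereal x" T] by auto
      then show False using le[of k] by (cases S) (auto simp: real)
    qed
    then show ?thesis by (cases S; cases T) (auto simp: real)
  qed (use X in simp)
qed

lemma ereal_sum_neq_MInf:
  fixes T :: "'i \<Rightarrow> ereal"
  assumes "finite I" "\<And>i. i \<in> I \<Longrightarrow> T i \<noteq> -\<infinity>"
  shows "(\<Sum>i\<in>I. T i) \<noteq> -\<infinity>"
  using assms
proof (induction rule: finite_induct)
  case (insert j I)
  have "(\<Sum>i\<in>I. T i) \<noteq> -\<infinity>" "T j \<noteq> -\<infinity>"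
    using insert.IH insert.prems by blast+
  then have "T j + (\<Sum>i\<in>I. T i) \<noteq> -\<infinity>"
    by (simp only: ereal_plus_eq_MInfty) simp
  then show ?case using insert.hyps by simp
qed simp

text \<open>
  A sum of suprema is bounded by bounding all sums of real numbers below the individual suprema; this
  covers infinite summands too.
\<close>

lemma ereal_sum_le_approx:
  fixes T :: "'i \<Rightarrow> ereal"
  assumes "finite I" "\<And>i. i \<in> I \<Longrightarrow> T i \<noteq> -\<infinity>"
    and "\<And>c. (\<And>i. i \<in> I \<Longrightarrow> ereal (c i) < T i) \<Longrightarrow> ereal (\<Sum>i\<in>I. c i) \<le> S"
  shows "(\<Sum>i\<in>I. T i) \<le> S"
  using assms
proof (induction I arbitrary: S rule: finite_induct)
  case empty
  then show ?case by (simp add: zero_ereal_def)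
next
  case (insert j I)
  have X: "(\<Sum>i\<in>I. T i) \<noteq> -\<infinity>"
    by (rule ereal_sum_neq_MInf) (use insert.prems(1) insert.hyps(1) in blast)+
  have Tj: "T j \<noteq> -\<infinity>" using insert.prems(1) by blast
  have "T j + (\<Sum>i\<in>I. T i) \<le> S"
  proof (rule ereal_add_le_approx[OF Tj X])
    fix d assume d: "ereal d < T j"
    have "(\<Sum>i\<in>I. T i) \<le> S - ereal d"
    proof (rule insert.IH)
      show "T i \<noteq> -\<infinity>" if "i \<in> I" for i using insert.prems(1) that by blast
      fix c assume c: "\<And>i. i \<in> I \<Longrightarrow> ereal (c i) < T i"
      have "ereal ((c(j := d)) i) < T i" if "i \<in> insert j I" for i
        using that c d by (cases "i = j") simp_all
      then have "ereal (\<Sum>i\<in>insert j I. (c(j := d)) i) \<le> S" by (rule insert.prems(2))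
      moreover have "(\<Sum>i\<in>I. (c(j := d)) i) = (\<Sum>i\<in>I. c i)"
        using insert.hyps(2) by (intro sum.cong) auto
      ultimately have "ereal (d + (\<Sum>i\<in>I. c i)) \<le> S" using insert.hyps by simp
      then show "ereal (\<Sum>i\<in>I. c i) \<le> S - ereal d" by (cases S) simp_all
    qed
    then show "ereal d + (\<Sum>i\<in>I. T i) \<le> S" by (cases S; cases "\<Sum>i\<in>I. T i") simp_all
  qed
  then show ?case using insert.hyps by simp
qed

context composite_problem
begin

text \<open>
  Real-valued forms of \<open>F\<close> and of \<open>v \<mapsto> G* v + \<langle>r, v\<rangle>\<close>, to be used on \<open>domP\<close> and \<open>domQ\<close>, where all terms are
  finite. In these terms the gap integrand at \<open>(x, v)\<close> and \<open>(x', v')\<close> is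
  \<open>P x - P x' + Q v - Q v' + \<langle>L x, v'\<rangle> - \<langle>L x', v\<rangle>\<close>.
\<close>

definition "P x = real_of_ereal (f x) + h x - x \<bullet> z"

definition "Q v = (\<Sum>i\<in>UNIV. real_of_ereal (gs i (v $ i)) + real_of_ereal (ls i (v $ i)) + r $ i \<bullet> v $ i)"

definition "domP = {x. f x \<noteq> \<infinity>}"

definition "domQ = {v. \<forall>i. v $ i \<in> G i \<and> gs i (v $ i) \<noteq> \<infinity>}"

lemma f_real: "x \<in> domP \<Longrightarrow> f x = ereal (real_of_ereal (f x))"
  using Gamma_onD(1)[OF f] by (cases "f x") (auto simp: domP_def proper_on_def)

lemma gs_real: "v \<in> domQ \<Longrightarrow> gs i (v $ i) = ereal (real_of_ereal (gs i (v $ i)))"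
  using Gamma_onD(1)[OF gs, of i] by (cases "gs i (v $ i)") (auto simp: domQ_def proper_on_def)

lemma ls_real: "v \<in> G i \<Longrightarrow> ls i v = ereal (real_of_ereal (ls i v))"
  using subdiff_onD(3)[OF gl_ls] by (auto simp: ereal_real)

lemma domQ_G: "v \<in> domQ \<Longrightarrow> v $ i \<in> G i" by (simp add: domQ_def)

lemma A_dom_finite:
  assumes "u \<in> A w"
  shows "fst w \<in> domP" "snd w \<in> domQ"
proof -
  show "fst w \<in> domP" using assms subdiff_onD(3) by (fastforce simp: A_def domP_def)
  show "snd w \<in> domQ" unfolding domQ_def
  proof (intro CollectI allI conjI)
    fix i
    have "snd u $ i - r $ i \<in> subdiff_on (G i) (gs i) (snd w $ i)" using assms by (auto simp: A_def)
    from subdiff_onD(2,3)[OF this] show "snd w $ i \<in> G i" "gs i (snd w $ i) \<noteq> \<infinity>" by auto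
  qed
qed

lemma convex_on_P: "convex_on domP P"
proof -
  have c: "convex_on domP (\<lambda>x. real_of_ereal (f x))"
    using Gamma_on_imp_convex_on[OF subspace_UNIV f] by (simp add: domP_def)
  have "convex_on domP (\<lambda>x. - (x \<bullet> z))"
    using convex_on_imp_convex[OF c]
    by (intro convex_onI) (auto simp: inner_add_left)
  from convex_on_add[OF convex_on_add[OF c convex_on_subset[OF h_convex subset_UNIV convex_on_imp_convex[OF c]]] this]
  show ?thesis by (simp add: P_def[abs_def])
qed

lemma convex_on_Q: "convex_on domQ Q"
proof (rule convex_onI)
  have gc: "convex_on {x\<in>G i. gs i x \<noteq> \<infinity>} (\<lambda>x. real_of_ereal (gs i x))" for i
    using Gamma_on_imp_convex_on[OF G(1) gs] .
  have lc: "convex_on {x\<in>G i. ls i x \<noteq> \<infinity>} (\<lambda>x. real_of_ereal (ls i x))" for i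
    using Gamma_on_imp_convex_on[OF G(1) conjugate_Gamma[OF G l]] .
  show "convex domQ"
    using convex_on_imp_convex[OF gc] by (auto simp: convex_def domQ_def)
  fix t v w assume t: "0 < (t::real)" "t < 1" and vw: "v \<in> domQ" "w \<in> domQ"
  have ls: "ls i (v $ i) \<noteq> \<infinity>" "ls i (w $ i) \<noteq> \<infinity>" for i
    using ls_real[OF domQ_G[OF vw(1)], of i] ls_real[OF domQ_G[OF vw(2)], of i] by auto
  have "Q ((1 - t) *\<^sub>R v + t *\<^sub>R w) \<le> (\<Sum>i\<in>UNIV.
      ((1 - t) * real_of_ereal (gs i (v $ i)) + t * real_of_ereal (gs i (w $ i)))
      + ((1 - t) * real_of_ereal (ls i (v $ i)) + t * real_of_ereal (ls i (w $ i)))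
      + ((1 - t) * (r $ i \<bullet> v $ i) + t * (r $ i \<bullet> w $ i)))"
    unfolding Q_def
  proof (intro sum_mono add_mono)
    fix i
    show "real_of_ereal (gs i (((1 - t) *\<^sub>R v + t *\<^sub>R w) $ i))
        \<le> (1 - t) * real_of_ereal (gs i (v $ i)) + t * real_of_ereal (gs i (w $ i))"
      using convex_onD[OF gc[of i], of t "v $ i" "w $ i"] t vw by (simp add: domQ_def)
    show "real_of_ereal (ls i (((1 - t) *\<^sub>R v + t *\<^sub>R w) $ i))
        \<le> (1 - t) * real_of_ereal (ls i (v $ i)) + t * real_of_ereal (ls i (w $ i))"
      using convex_onD[OF lc[of i], of t "v $ i" "w $ i"] t vw ls[of i] by (simp add: domQ_def)
  qed (simp add: inner_add_right)
  also have "\<dots> = (1 - t) * Q v + t * Q w"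
    unfolding Q_def sum_distrib_left sum.distrib[symmetric]
    by (intro sum.cong refl) (simp add: algebra_simps)
  finally show "Q ((1 - t) *\<^sub>R v + t *\<^sub>R w) \<le> (1 - t) * Q v + t * Q w" .
qed

text \<open>
  The subgradient inequalities of all the functions, added up. The skew terms \<open>L*v\<close> and \<open>-L x\<close> of \<open>B\<close> supply
  exactly the coupling \<open>\<langle>L x, v'\<rangle> - \<langle>L x', v\<rangle>\<close> of the gap integrand.
\<close>

lemma saddle_estimate:
  assumes u: "u - B (x, v) \<in> A (x, v)" and x': "x' \<in> domP" and v': "v' \<in> domQ"
  shows "P x - P x' + Q v - Q v' + stack_op L x \<bullet> v' - stack_op L x' \<bullet> v \<le> u \<bullet> ((x, v) - (x', v'))"
proof -
  obtain u1 u2 where u12: "u = (u1, u2)" by (cases u)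
  define a where "a = u1 - gh x - Ladj v + z"
  have a: "a \<in> subdiff_on UNIV f x"
    using u by (auto simp: A_def B_def u12 a_def algebra_simps)
  have b: "u2 $ i - gl i (v $ i) + L i x - r $ i \<in> subdiff_on (G i) (gs i) (v $ i)" for i
    using u by (auto simp: A_def B_def u12 algebra_simps)
  note dom = A_dom_finite[OF u, simplified]
  have "real_of_ereal (f x) + a \<bullet> (x' - x) \<le> real_of_ereal (f x')"
    using subdiff_onD(4)[OF a UNIV_I, of x'] by (subst (asm) f_real[OF dom(1)], subst (asm) f_real[OF x']) simp
  moreover have "h x + gh x \<bullet> (x' - x) \<le> h x'"
    using subdiff_onD(4)[OF gh UNIV_I, of x x'] by simp
  ultimately have 1: "P x - P x' \<le> (u1 - Ladj v) \<bullet> (x - x')"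
    by (simp add: P_def a_def inner_diff_left inner_diff_right inner_add_left inner_commute algebra_simps)
  have "Q v + (u2 + stack_op L x) \<bullet> (v' - v)
      = (\<Sum>i\<in>UNIV. (real_of_ereal (gs i (v $ i)) + (u2 $ i - gl i (v $ i) + L i x - r $ i) \<bullet> (v' $ i - v $ i))
        + (real_of_ereal (ls i (v $ i)) + gl i (v $ i) \<bullet> (v' $ i - v $ i)) + r $ i \<bullet> v' $ i)"
    unfolding Q_def inner_vec_def sum.distrib[symmetric]
    by (intro sum.cong refl) (simp add: stack_op_def inner_diff_left inner_diff_right inner_add_left)
  also have "\<dots> \<le> Q v'"
    unfolding Q_def
  proof (intro sum_mono add_mono order_refl)
    fix i
    show "real_of_ereal (gs i (v $ i)) + (u2 $ i - gl i (v $ i) + L i x - r $ i) \<bullet> (v' $ i - v $ i)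
        \<le> real_of_ereal (gs i (v' $ i))"
      using subdiff_onD(4)[OF b domQ_G[OF v'], of i]
      by (subst (asm) gs_real[OF dom(2)], subst (asm) gs_real[OF v']) simp
    show "real_of_ereal (ls i (v $ i)) + gl i (v $ i) \<bullet> (v' $ i - v $ i) \<le> real_of_ereal (ls i (v' $ i))"
      using subdiff_onD(4)[OF gl_ls[OF domQ_G[OF dom(2)]] domQ_G[OF v'], of i]
      by (subst (asm) ls_real[OF domQ_G[OF dom(2)]], subst (asm) ls_real[OF domQ_G[OF v']]) simp
  qed
  finally have 2: "Q v + (u2 + stack_op L x) \<bullet> (v' - v) \<le> Q v'" .
  have 3: "Ladj v \<bullet> (x - x') = stack_op L x \<bullet> v - stack_op L x' \<bullet> v"
    unfolding inner_commute[of "Ladj v"] Ladj_inner stack_op_diff inner_diff_left by (rule refl)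
  have "(u1 - Ladj v) \<bullet> (x - x') = u1 \<bullet> (x - x') - (stack_op L x \<bullet> v - stack_op L x' \<bullet> v)"
    by (simp only: inner_diff_left[of u1] 3)
  moreover have "(u2 + stack_op L x) \<bullet> (v' - v) = u2 \<bullet> (v' - v) + (stack_op L x \<bullet> v' - stack_op L x \<bullet> v)"
    by (simp only: inner_add_left inner_diff_right)
  moreover have "u \<bullet> ((x, v) - (x', v')) = u1 \<bullet> (x - x') - u2 \<bullet> (v' - v)"
    by (simp add: u12 inner_diff_right)
  ultimately show ?thesis using 1 2 by linarith
qed

text \<open>
  The conjugate of a sum of infimal convolutions in separate variables. For \<open>\<ge>\<close>, points that almost attain the suprema
  are chosen in every coordinate; in the \<open>l\<^sub>i\<close> part the supremum is attained at \<open>\<nabla>l\<^sub>i* w\<^sub>i\<close>.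
\<close>

lemma conjugate_primal_G:
  assumes w: "w \<in> prod_space G"
  shows "conjugate_on (prod_space G) (primal_G G g l) w = (\<Sum>i\<in>UNIV. gs i (w $ i) + ls i (w $ i))"
    (is "?S = ?T")
proof (rule antisym)
  have wG: "w $ i \<in> G i" for i using w by (simp add: prod_space_def)
  have gM: "gs i (w $ i) \<noteq> -\<infinity>" for i using Gamma_onD(1)[OF gs] wG by (auto simp: proper_on_def)
  have lM: "ls i (w $ i) \<noteq> -\<infinity>" for i using Gamma_onD(1)[OF conjugate_Gamma[OF G l]] wG by (auto simp: proper_on_def)
  show "?S \<le> ?T"
  proof (cases "\<exists>i. gs i (w $ i) = \<infinity>")
    case True
    then have "?T = \<infinity>" unfolding sum_Pinfty using lM by fastforce
    then show ?thesis by simp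
  next
    case False
    define a where "a i = real_of_ereal (gs i (w $ i))" for i
    define b where "b i = real_of_ereal (ls i (w $ i))" for i
    have ab: "gs i (w $ i) = ereal (a i)" "ls i (w $ i) = ereal (b i)" for i
      using False gM[of i] ls_real[OF wG, of i] by (auto simp: a_def b_def ereal_real)
    show ?thesis
    proof (subst (1) conjugate_on_def, rule SUP_least)
      fix y assume y: "y \<in> prod_space G"
      have "ereal (\<Sum>i\<in>UNIV. w $ i \<bullet> y $ i - a i - b i) \<le> primal_G G g l y"
        unfolding primal_G_def sum_ereal[symmetric]
        using y by (intro sum_mono infconv_lower[OF G(1) _ ab]) (simp add: prod_space_def)
      then show "ereal (w \<bullet> y) - primal_G G g l y \<le> ?T"
        by (cases "primal_G G g l y") (auto simp: ab inner_vec_def sum.distrib sum_subtractf)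
    qed
  qed
  show "?T \<le> ?S"
  proof (rule ereal_sum_le_approx)
    show "gs i (w $ i) + ls i (w $ i) \<noteq> -\<infinity>" for i using gM[of i] lM[of i] by simp
    fix c :: "'m \<Rightarrow> real" assume c: "\<And>i. i \<in> UNIV \<Longrightarrow> ereal (c i) < gs i (w $ i) + ls i (w $ i)"
    have "\<exists>s\<in>G i. infconv_on (G i) (g i) (l i) s \<le> ereal (w $ i \<bullet> s - c i)" for i
    proof -
      define q where "q = gl i (w $ i)"
      obtain b where b: "l i q = ereal b" using gl[OF wG] unfolding q_def by (rule subdiff_on_realE)
      have lsw: "ls i (w $ i) = ereal (w $ i \<bullet> q - b)"
        using conjugate_at_subgradient[OF gl[OF wG]] b unfolding q_def by blast
      have "ereal (c i - (w $ i \<bullet> q - b)) < gs i (w $ i)"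
        using c[of i] lsw by (cases "gs i (w $ i)") auto
      then obtain y where y: "y \<in> G i" "ereal (c i - (w $ i \<bullet> q - b)) < ereal (w $ i \<bullet> y) - g i y"
        unfolding conjugate_on_def less_SUP_iff by blast
      have "infconv_on (G i) (g i) (l i) (y + q) \<le> g i y + l i q"
        using infconv_upper[OF y(1), of "g i" "l i" "y + q"] by simp
      also have "\<dots> \<le> ereal (w $ i \<bullet> (y + q) - c i)"
        using y(2) by (cases "g i y") (auto simp: b inner_add_right)
      finally show ?thesis
        using subspace_add[OF G(1) y(1) gl_G[OF wG]] by (auto simp: q_def)
    qed
    then obtain s where s: "\<And>i. s i \<in> G i"
        "\<And>i. infconv_on (G i) (g i) (l i) (s i) \<le> ereal (w $ i \<bullet> s i - c i)" by metis
    have "primal_G G g l (vec_lambda s) \<le> ereal (\<Sum>i\<in>UNIV. w $ i \<bullet> s i - c i)"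
      unfolding primal_G_def sum_ereal[symmetric] using s(2) by (intro sum_mono) simp
    then have "ereal (\<Sum>i\<in>UNIV. c i) \<le> ereal (w \<bullet> vec_lambda s) - primal_G G g l (vec_lambda s)"
      by (cases "primal_G G g l (vec_lambda s)") (auto simp: inner_vec_def sum_subtractf)
    also have "\<dots> \<le> ?S" using s(1) by (intro fenchel_young) (simp add: prod_space_def)
    finally show "ereal (\<Sum>i\<in>UNIV. c i) \<le> ?S" .
  qed simp
qed

lemma conjugate_primal_G_real:
  assumes "w \<in> domQ"
  shows "conjugate_on (prod_space G) (primal_G G g l) w = ereal (Q w - r \<bullet> w)"
proof -
  have "(\<Sum>i\<in>UNIV. gs i (w $ i) + ls i (w $ i))
      = (\<Sum>i\<in>UNIV. ereal (real_of_ereal (gs i (w $ i)) + real_of_ereal (ls i (w $ i))))"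
    by (intro sum.cong refl, subst gs_real[OF assms], subst ls_real[OF domQ_G[OF assms]]) simp
  then show ?thesis
    using assms by (subst conjugate_primal_G)
      (auto simp: prod_space_def domQ_def Q_def inner_vec_def sum.distrib)
qed

lemma conjugate_primal_G_infinite:
  assumes "w \<in> prod_space G" "w \<notin> domQ"
  shows "conjugate_on (prod_space G) (primal_G G g l) w = \<infinity>"
proof -
  obtain i where i: "gs i (w $ i) = \<infinity>" using assms by (auto simp: prod_space_def domQ_def)
  have "ls i (w $ i) \<noteq> -\<infinity>" using ls_real[of "w $ i" i] assms by (auto simp: prod_space_def)
  then have "(\<Sum>i\<in>UNIV. gs i (w $ i) + ls i (w $ i)) = \<infinity>"
    unfolding sum_Pinfty using i by auto
  then show ?thesis using conjugate_primal_G[OF assms(1)] by simp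
qed

text \<open>
  By Fenchel-Young, \<open>K y = \<langle>L y, v\<rangle> - Q v\<close> minorizes the composite term at every \<open>y\<close>. At \<open>y = x\<close> there is
  equality, because \<open>v\<^sub>i\<close> is a common subgradient of \<open>g\<^sub>i\<close> and \<open>l\<^sub>i\<close> at the two summands \<open>s\<close> and \<open>q\<close> of
  \<open>L\<^sub>i x - r\<^sub>i\<close>. The saddle estimate with \<open>v' = v\<close> then compares \<open>P + K\<close> at \<open>x\<close> and at \<open>y\<close>.
\<close>

lemma zeros_imp_primal_optimal:
  assumes sol: "- B (x, v) \<in> A (x, v)"
  shows "is_arg_min (primal_obj G f h z g l L r) (\<lambda>y. True) x"
proof -
  have zero: "0 - B (x, v) \<in> A (x, v)" using sol by simp
  note dom = A_dom_finite[OF sol, simplified]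
  define K where "K y = stack_op L y \<bullet> v - Q v" for y
  define a where "a i = real_of_ereal (gs i (v $ i))" for i
  define b where "b i = real_of_ereal (ls i (v $ i))" for i
  have ab: "gs i (v $ i) = ereal (a i)" "ls i (v $ i) = ereal (b i)" for i
    using gs_real[OF dom(2)] ls_real[OF domQ_G[OF dom(2)]] by (auto simp: a_def b_def)
  have K: "K y = (\<Sum>i\<in>UNIV. v $ i \<bullet> (L i y - r $ i) - a i - b i)" for y
    unfolding K_def Q_def a_def[symmetric] b_def[symmetric]
    by (simp add: inner_vec_def stack_op_def sum_subtractf[symmetric] inner_diff_right inner_commute algebra_simps)
  have LG: "L i y - r $ i \<in> G i" for i y using G(1) L(2) r_G by (rule subspace_diff)
  have lower: "ereal (K y) \<le> (\<Sum>i\<in>UNIV. infconv_on (G i) (g i) (l i) (L i y - r $ i))" for y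
    unfolding K sum_ereal[symmetric] by (intro sum_mono infconv_lower[OF G(1) LG ab])
  have upper: "(\<Sum>i\<in>UNIV. infconv_on (G i) (g i) (l i) (L i x - r $ i)) \<le> ereal (K x)"
    unfolding K sum_ereal[symmetric]
  proof (intro sum_mono)
    fix i
    define q where "q = gl i (v $ i)"
    define s where "s = L i x - r $ i - q"
    have "s \<in> subdiff_on (G i) (gs i) (v $ i)"
      using sol by (auto simp: A_def B_def s_def q_def algebra_simps)
    then have s: "v $ i \<in> subdiff_on (G i) (g i) s" using subdiff_conjugateD[OF G g] by blast
    have q: "v $ i \<in> subdiff_on (G i) (l i) q" unfolding q_def using gl[OF domQ_G[OF dom(2)]] .
    obtain c d where cd: "g i s = ereal c" "l i q = ereal d"
      using s q by (auto elim!: subdiff_on_realE)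
    have "infconv_on (G i) (g i) (l i) (L i x - r $ i) \<le> g i s + l i q"
      using infconv_upper[OF subdiff_onD(2)[OF s], of "g i" "l i" "L i x - r $ i"] by (simp add: s_def)
    also have "\<dots> = ereal (c + d)" by (simp add: cd)
    also have "c + d = v $ i \<bullet> (L i x - r $ i) - a i - b i"
      using conjugate_at_subgradient[OF s cd(1)] conjugate_at_subgradient[OF q cd(2)]
      by (simp add: ab s_def inner_diff_right)
    finally show "infconv_on (G i) (g i) (l i) (L i x - r $ i) \<le> ereal (v $ i \<bullet> (L i x - r $ i) - a i - b i)" .
  qed
  have at_x: "primal_obj G f h z g l L r x = ereal (P x + K x)"
  proof -
    have "(\<Sum>i\<in>UNIV. infconv_on (G i) (g i) (l i) (L i x - r $ i)) = ereal (K x)"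
      using lower upper by (rule antisym[rotated])
    then show ?thesis unfolding primal_obj_def
      by (subst f_real[OF dom(1)]) (simp add: P_def)
  qed
  have "ereal (P x + K x) \<le> primal_obj G f h z g l L r y" for y
  proof -
    have "f y + ereal (K y) + ereal (h y) - ereal (y \<bullet> z) \<le> primal_obj G f h z g l L r y"
      unfolding primal_obj_def by (intro ereal_minus_mono add_mono lower order_refl)
    moreover have "ereal (P x + K x) \<le> f y + ereal (K y) + ereal (h y) - ereal (y \<bullet> z)"
    proof (cases "y \<in> domP")
      case True
      have "P x + K x \<le> P y + K y"
        using saddle_estimate[OF zero True dom(2)] by (simp add: K_def)
      then show ?thesis by (subst f_real[OF True]) (simp add: P_def)
    qed (simp add: domP_def)
    ultimately show ?thesis by order
  qed
  then show ?thesis unfolding is_arg_min_def at_x by (auto simp: not_less)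
qed

text \<open>
  By Fenchel-Young at \<open>x\<close>, \<open>U w\<close> majorizes the dual objective at every feasible \<open>w\<close> where the latter is not \<open>-\<infinity>\<close>. At \<open>w = v\<close> there is
  equality, because \<open>z - L*v\<close> splits into subgradients of \<open>f\<close> and \<open>h\<close> at \<open>x\<close>. The saddle estimate with \<open>x' = x\<close>
  gives \<open>U w \<le> U v\<close>.
\<close>

lemma zeros_imp_dual_optimal:
  assumes sol: "- B (x, v) \<in> A (x, v)"
  shows "is_arg_max (dual_obj G f h z g l L r) (\<lambda>w. w \<in> prod_space G) v"
proof -
  have zero: "0 - B (x, v) \<in> A (x, v)" using sol by simp
  note dom = A_dom_finite[OF sol, simplified]
  obtain fx where fx: "f x = ereal fx" using f_real[OF dom(1)] by blast
  define U where "U w = fx + h x - (z - Ladj w) \<bullet> x - Q w" for w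
  let ?I = "infconv_on UNIV (conjugate_on UNIV f) (conjugate_on UNIV (\<lambda>x. ereal (h x)))"
  have vG: "v \<in> prod_space G" using dom(2) by (simp add: prod_space_def domQ_def)
  have T: "(\<Sum>i\<in>UNIV. gs i (w $ i) + ls i (w $ i) + ereal (w $ i \<bullet> r $ i)) = ereal (Q w)"
    if "w \<in> domQ" for w
    unfolding Q_def sum_ereal[symmetric]
    by (intro sum.cong refl, subst gs_real[OF that], subst ls_real[OF domQ_G[OF that]])
       (simp add: inner_commute)
  have lower: "ereal (s \<bullet> x - fx - h x) \<le> ?I s" for s
    unfolding infconv_on_def
  proof (rule INF_greatest)
    fix y
    show "ereal (s \<bullet> x - fx - h x) \<le> conjugate_on UNIV f y + conjugate_on UNIV (\<lambda>x. ereal (h x)) (s - y)"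
      using fenchel_young[of x UNIV y f] fenchel_young[of x UNIV "s - y" "\<lambda>x. ereal (h x)"]
      by (cases "conjugate_on UNIV f y"; cases "conjugate_on UNIV (\<lambda>x. ereal (h x)) (s - y)")
         (auto simp: fx inner_diff_left)
  qed
  have upper: "dual_obj G f h z g l L r w \<le> ereal (U v)" if w: "w \<in> prod_space G" for w
  proof (cases "w \<in> domQ")
    case True
    have "dual_obj G f h z g l L r w \<le> - ereal ((z - Ladj w) \<bullet> x - fx - h x) - ereal (Q w)"
      unfolding dual_obj_def T[OF True]
      by (intro ereal_minus_mono order_refl) (simp only: ereal_minus_le_minus lower)
    also have "\<dots> = ereal (U w)" by (simp add: U_def)
    also have "U w \<le> U v"
    proof -
      have "Q v - Q w + stack_op L x \<bullet> w - stack_op L x \<bullet> v \<le> 0"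
        using saddle_estimate[OF zero dom(1) True] by simp
      moreover have "Ladj w \<bullet> x = stack_op L x \<bullet> w" "Ladj v \<bullet> x = stack_op L x \<bullet> v"
        unfolding inner_commute[of _ x] Ladj_inner by (rule refl)+
      ultimately show ?thesis unfolding U_def inner_diff_left by linarith
    qed
    finally show ?thesis by simp
  next
    case False
    then obtain i where i: "gs i (w $ i) = \<infinity>" using w by (auto simp: prod_space_def domQ_def)
    have "ls i (w $ i) \<noteq> -\<infinity>" using ls_real[of "w $ i" i] w by (auto simp: prod_space_def)
    then have "(\<Sum>i\<in>UNIV. gs i (w $ i) + ls i (w $ i) + ereal (w $ i \<bullet> r $ i)) = \<infinity>"
      unfolding sum_Pinfty using i by auto
    moreover have "- ?I (z - Ladj w) \<noteq> \<infinity>" using lower[of "z - Ladj w"] by (cases "?I (z - Ladj w)") auto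
    ultimately show ?thesis unfolding dual_obj_def by (cases "?I (z - Ladj w)") auto
  qed
  define a where "a = z - Ladj v - gh x"
  have a: "a \<in> subdiff_on UNIV f x" using sol by (auto simp: A_def B_def a_def algebra_simps)
  have "?I (z - Ladj v) \<le> conjugate_on UNIV f a + conjugate_on UNIV (\<lambda>x. ereal (h x)) (gh x)"
    using infconv_upper[of a UNIV "conjugate_on UNIV f" "conjugate_on UNIV (\<lambda>x. ereal (h x))" "z - Ladj v"]
    by (simp add: a_def)
  also have "\<dots> = ereal ((z - Ladj v) \<bullet> x - fx - h x)"
    using conjugate_at_subgradient[OF a fx] conjugate_at_subgradient[OF gh refl]
    by (simp add: a_def inner_diff_left)
  finally have "- ereal ((z - Ladj v) \<bullet> x - fx - h x) - ereal (Q v) \<le> dual_obj G f h z g l L r v"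
    unfolding dual_obj_def T[OF dom(2)]
    by (intro ereal_minus_mono order_refl) (simp only: ereal_minus_le_minus)
  moreover have "- ereal ((z - Ladj v) \<bullet> x - fx - h x) - ereal (Q v) = ereal (U v)"
    by (simp add: U_def)
  ultimately have "ereal (U v) \<le> dual_obj G f h z g l L r v" by simp
  then show ?thesis using upper vG unfolding is_arg_max_def by (force simp: not_less)
qed

end

section \<open>Ergodic means and the gap function\<close>

lemma cesaro_mean_tendsto:
  fixes a :: "nat \<Rightarrow> real"
  assumes a: "a \<longlonglongrightarrow> c"
  shows "(\<lambda>N. (\<Sum>n<N. a n) / real N) \<longlonglongrightarrow> c"
proof (rule LIMSEQ_I)
  fix e :: real assume e: "e > 0"
  obtain N0 where N0: "\<And>n. n \<ge> N0 \<Longrightarrow> \<bar>a n - c\<bar> < e / 2"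
    using LIMSEQ_D[OF a, of "e / 2"] e by auto
  define C where "C = (\<Sum>n<N0. \<bar>a n - c\<bar>)"
  have tail: "(\<Sum>n<N0 + k. \<bar>a n - c\<bar>) \<le> C + real k * (e / 2)" for k
  proof (induction k)
    case (Suc k)
    define d where "d = e / 2"
    have "real (Suc k) * d = real k * d + d" by (simp add: distrib_right)
    moreover have "(\<Sum>n<N0 + Suc k. \<bar>a n - c\<bar>) = (\<Sum>n<N0 + k. \<bar>a n - c\<bar>) + \<bar>a (N0 + k) - c\<bar>"
      by simp
    ultimately show ?case using Suc N0[of "N0 + k"] unfolding d_def[symmetric] by linarith
  qed (simp add: C_def)
  obtain N1 :: nat where N1: "2 * C / e < real N1" using reals_Archimedean2 by blast
  show "\<exists>no. \<forall>N\<ge>no. norm ((\<Sum>n<N. a n) / real N - c) < e"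
  proof (intro exI[of _ "max N0 (Suc N1)"] allI impI)
    fix N assume N: "N \<ge> max N0 (Suc N1)"
    then have pos: "real N > 0" "real N > 2 * C / e" using N1 by auto
    have "(\<Sum>n<N. a n) / real N - c = (\<Sum>n<N. a n - c) / real N"
      using pos(1) by (simp add: sum_subtractf field_simps)
    then have "norm ((\<Sum>n<N. a n) / real N - c) = \<bar>\<Sum>n<N. a n - c\<bar> / real N"
      by simp
    also have "\<dots> \<le> (\<Sum>n<N. \<bar>a n - c\<bar>) / real N"
      by (intro divide_right_mono sum_abs) simp
    also have "\<dots> \<le> (C + real (N - N0) * (e / 2)) / real N"
      using tail[of "N - N0"] N by (intro divide_right_mono) auto
    also have "\<dots> \<le> (C + real N * (e / 2)) / real N"
      using e by (intro divide_right_mono add_left_mono mult_right_mono) auto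
    also have "\<dots> < e"
    proof -
      have "2 * C < real N * e" using pos(2) e by (simp add: divide_less_eq)
      then show ?thesis using pos(1) by (simp add: divide_less_eq mult.commute)
    qed
    finally show "norm ((\<Sum>n<N. a n) / real N - c) < e" .
  qed
qed

lemma weakly_tendsto_ergodic:
  assumes "weakly_tendsto p x"
  shows "weakly_tendsto (ergodic p) x"
  unfolding weakly_tendsto_def
proof
  fix u
  have "(\<lambda>N. (\<Sum>n<N. p n \<bullet> u) / real N) \<longlonglongrightarrow> x \<bullet> u"
    using assms by (intro cesaro_mean_tendsto) (simp add: weakly_tendsto_def)
  then show "(\<lambda>N. ergodic p N \<bullet> u) \<longlonglongrightarrow> x \<bullet> u"
    by (simp add: ergodic_def inner_sum_left)
qed

text \<open>
  For nonincreasing weights \<open>1 / \<gamma> n\<close> the sum telescopes up to terms of the right sign; the induction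
  carries the nonnegative remainder \<open>D N / \<gamma> N\<close> along.
\<close>

lemma weighted_telescoping_bound:
  fixes D \<gamma> :: "nat \<Rightarrow> real"
  assumes \<gamma>: "incseq \<gamma>" "\<And>n. \<gamma> n > 0" and D: "\<And>n. D n \<ge> 0"
  shows "(\<Sum>n<N. (D n - D (Suc n)) / \<gamma> n) \<le> D 0 / \<gamma> 0"
proof -
  have "(\<Sum>n<N. (D n - D (Suc n)) / \<gamma> n) + D N / \<gamma> N \<le> D 0 / \<gamma> 0"
  proof (induction N)
    case (Suc N)
    have "D (Suc N) / \<gamma> (Suc N) \<le> D (Suc N) / \<gamma> N"
      using \<gamma>(2) D incseq_SucD[OF \<gamma>(1), of N] by (intro divide_left_mono) auto
    then show ?case using Suc by (simp add: diff_divide_distrib)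
  qed simp
  then show ?thesis using divide_nonneg_pos[OF D \<gamma>(2), of N N] by linarith
qed

context composite_problem
begin

text \<open>
  The range condition unpacked: membership in the parallel sum splits \<open>L\<^sub>i y - r\<^sub>i\<close> into \<open>c + d\<close> with \<open>v\<^sub>i\<close> a
  subgradient at both points, and \<open>d\<close> must be \<open>\<nabla>l\<^sub>i* v\<^sub>i\<close>.
\<close>

lemma zero_exists:
  assumes "z \<in> op_ran (\<lambda>y. subdiff_on UNIV f y
        + (\<Sum>i\<in>UNIV. adjoint (L i) `
             parallel_sum (subdiff_on (G i) (g i)) (subdiff_on (G i) (l i)) (L i y - r $ i))
        + {gradient_on UNIV h y})"
  obtains x v where "- B (x, v) \<in> A (x, v)"
proof -
  obtain y a b where a: "a \<in> subdiff_on UNIV f y" and z: "z = a + b + gh y"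
    and b: "b \<in> (\<Sum>i\<in>UNIV. adjoint (L i) `
             parallel_sum (subdiff_on (G i) (g i)) (subdiff_on (G i) (l i)) (L i y - r $ i))"
  proof -
    from assms obtain y where y: "z \<in> subdiff_on UNIV f y
        + (\<Sum>i\<in>UNIV. adjoint (L i) `
             parallel_sum (subdiff_on (G i) (g i)) (subdiff_on (G i) (l i)) (L i y - r $ i))
        + {gh y}"
      unfolding op_ran_def mem_Collect_eq by (elim exE)
    then obtain c d where c: "z = c + d" "d \<in> {gh y}" and c': "c \<in> subdiff_on UNIV f y
        + (\<Sum>i\<in>UNIV. adjoint (L i) `
             parallel_sum (subdiff_on (G i) (g i)) (subdiff_on (G i) (l i)) (L i y - r $ i))"
      by (rule set_plus_elim)
    from c' obtain a b where "c = a + b" "a \<in> subdiff_on UNIV f y"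
      "b \<in> (\<Sum>i\<in>UNIV. adjoint (L i) `
             parallel_sum (subdiff_on (G i) (g i)) (subdiff_on (G i) (l i)) (L i y - r $ i))"
      by (rule set_plus_elim)
    then show ?thesis using that[of a y b] c by simp
  qed
  from b obtain s where s: "b = (\<Sum>i\<in>UNIV. s i)"
    "\<And>i. s i \<in> adjoint (L i) `
       parallel_sum (subdiff_on (G i) (g i)) (subdiff_on (G i) (l i)) (L i y - r $ i)"
    unfolding set_sum_alt[OF finite] by blast
  then obtain v where v: "\<And>i. s i = adjoint (L i) (v i)"
    "\<And>i. v i \<in> parallel_sum (subdiff_on (G i) (g i)) (subdiff_on (G i) (l i)) (L i y - r $ i)"
    unfolding image_iff bex_simps Bex_def by metis
  have sub: "L i y - r $ i - gl i (v i) \<in> subdiff_on (G i) (gs i) (v i)" for i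
  proof -
    obtain c d where cd: "L i y - r $ i = c + d" "v i \<in> subdiff_on (G i) (g i) c"
        "v i \<in> subdiff_on (G i) (l i) d"
      using v(2)[of i] unfolding parallel_sum_def op_inverse_def mem_Collect_eq
      by (auto elim: set_plus_elim)
    have vG: "v i \<in> G i" using cd(2) by (rule subdiff_onD)
    have "norm (d - gl i (v i)) \<le> \<nu> i * norm (v i - v i)"
      using strongly_convex_subdiff_inverse_lipschitz[OF G(1) l_strong cd(3) gl[OF vG]] .
    then have "d = gl i (v i)" by simp
    then show ?thesis using subdiff_conjugateI[OF cd(2)] cd(1) by simp
  qed
  then have "- B (y, vec_lambda v) \<in> A (y, vec_lambda v)"
  proof -
    have "- (gh y + b) + z = a" unfolding z by simp
    moreover have "b = Ladj (vec_lambda v)" unfolding s(1) v(1) by simp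
    ultimately show ?thesis using a sub
      by (simp add: A_def B_def diff_diff_eq add.commute)
  qed
  then show ?thesis using that by blast
qed

text \<open>
  A point of the graph of \<open>A + B\<close>. Through the saddle estimate it provides affine minorants of \<open>P\<close> and \<open>Q\<close>, hence
  the bounds on bounded sets that follow.
\<close>

lemma graph_point:
  obtains u x v where "u - B (x, v) \<in> A (x, v)"
proof -
  obtain y where "(1 / 1) *\<^sub>R (0 - y) \<in> A y"
    using A_resolvent[OF zero_less_one subspace_0[OF W(1)]] by blast
  then have "(B y - y) - B y \<in> A y" by simp
  then show ?thesis using that by (cases y) blast
qed

lemma P_bounded_below:
  assumes "bounded S"
  obtains c where "\<And>x'. x' \<in> S \<Longrightarrow> x' \<in> domP \<Longrightarrow> c \<le> stack_op L x' \<bullet> w + P x'"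
proof -
  obtain u x v where u: "u - B (x, v) \<in> A (x, v)" by (rule graph_point)
  note dom = A_dom_finite[OF u, simplified]
  obtain M where M: "\<And>x'. x' \<in> S \<Longrightarrow> norm x' \<le> M" using assms by (auto simp: bounded_iff)
  define q where "q = Ladj (w - v) + fst u"
  have "P x + stack_op L x \<bullet> v - fst u \<bullet> x - M * norm q \<le> stack_op L x' \<bullet> w + P x'"
    if x': "x' \<in> S" "x' \<in> domP" for x'
  proof -
    have 1: "P x - P x' + stack_op L x \<bullet> v - stack_op L x' \<bullet> v \<le> fst u \<bullet> x - fst u \<bullet> x'"
      using saddle_estimate[OF u x'(2) dom(2)] by (simp add: inner_prod_def inner_diff_right)
    have "stack_op L x' \<bullet> (w - v) + fst u \<bullet> x' = x' \<bullet> q"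
      unfolding q_def inner_add_right Ladj_inner by (simp add: inner_commute)
    then have 2: "stack_op L x' \<bullet> w - stack_op L x' \<bullet> v + fst u \<bullet> x' = x' \<bullet> q"
      by (simp only: inner_diff_right)
    have "\<bar>x' \<bullet> q\<bar> \<le> M * norm q"
      using Cauchy_Schwarz_ineq2[of x' q] mult_right_mono[OF M[OF x'(1)], of "norm q"] by simp
    with 1 2 show ?thesis by linarith
  qed
  then show ?thesis using that by blast
qed

lemma Q_bounded_above:
  assumes "bounded S"
  obtains c where "\<And>v'. v' \<in> S \<Longrightarrow> v' \<in> domQ \<Longrightarrow> y \<bullet> v' - Q v' \<le> c"
proof -
  obtain u x v where u: "u - B (x, v) \<in> A (x, v)" by (rule graph_point)
  note dom = A_dom_finite[OF u, simplified]
  obtain M where M: "\<And>v'. v' \<in> S \<Longrightarrow> norm v' \<le> M" using assms by (auto simp: bounded_iff)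
  define q where "q = y - stack_op L x - snd u"
  have "y \<bullet> v' - Q v' \<le> stack_op L x \<bullet> v - Q v + snd u \<bullet> v + M * norm q"
    if v': "v' \<in> S" "v' \<in> domQ" for v'
  proof -
    have 1: "Q v - Q v' + stack_op L x \<bullet> v' - stack_op L x \<bullet> v \<le> snd u \<bullet> v - snd u \<bullet> v'"
      using saddle_estimate[OF u dom(1) v'(2)] by (simp add: inner_prod_def inner_diff_right)
    have 2: "q \<bullet> v' = y \<bullet> v' - stack_op L x \<bullet> v' - snd u \<bullet> v'"
      unfolding q_def inner_diff_left by (rule refl)
    have "\<bar>q \<bullet> v'\<bar> \<le> M * norm q"
      using Cauchy_Schwarz_ineq2[of q v'] mult_right_mono[OF M[OF v'(1)], of "norm q"]
      by (simp add: mult.commute)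
    with 1 2 show ?thesis by linarith
  qed
  then show ?thesis using that by blast
qed

text \<open>
  The gap is a difference of extended reals, where \<open>\<infinity> - \<infinity>\<close> and \<open>-\<infinity> - (-\<infinity>)\<close> both evaluate to \<open>\<infinity>\<close>.
  Boundedness of \<open>B1\<close> and \<open>B2\<close> keeps the supremum \<open>S\<close> below \<open>\<infinity>\<close> and the infimum \<open>I\<close> above \<open>-\<infinity>\<close>, which excludes both
  forms; this includes empty sets, for which the gap is \<open>-\<infinity>\<close>. What remains is a comparison of pairs of
  points.
\<close>

lemma pd_gap_le:
  assumes dom: "xN \<in> domP" "vN \<in> domQ"
    and B1: "bounded B1" and B2: "bounded B2" "B2 \<subseteq> prod_space G"
    and est: "\<And>x' v'. x' \<in> B1 \<Longrightarrow> v' \<in> B2 \<Longrightarrow> x' \<in> domP \<Longrightarrow> v' \<in> domQ \<Longrightarrow>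
      ereal (P xN - P x' + Q vN - Q v' + stack_op L xN \<bullet> v' - stack_op L x' \<bullet> vN) \<le> C"
  shows "pd_gap G f h z g l L r B1 B2 xN vN \<le> C"
proof -
  define a where "a v' = ereal ((stack_op L xN - r) \<bullet> v') + primal_F f h z xN
      - conjugate_on (prod_space G) (primal_G G g l) v'" for v'
  define b where "b x' = ereal ((stack_op L x' - r) \<bullet> vN) + primal_F f h z x'
      - conjugate_on (prod_space G) (primal_G G g l) vN" for x'
  have F: "primal_F f h z x' = ereal (P x')" if "x' \<in> domP" for x'
    unfolding primal_F_def by (subst f_real[OF that]) (simp add: P_def)
  have F': "primal_F f h z x' = \<infinity>" if "x' \<notin> domP" for x'
    using that by (simp add: primal_F_def domP_def)
  have a: "a v' = ereal (stack_op L xN \<bullet> v' + P xN - Q v')" if "v' \<in> domQ" for v'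
    unfolding a_def F[OF dom(1)] conjugate_primal_G_real[OF that] by (simp add: inner_diff_left)
  have a': "a v' = -\<infinity>" if "v' \<in> B2" "v' \<notin> domQ" for v'
    unfolding a_def F[OF dom(1)] using conjugate_primal_G_infinite[of v'] that B2(2) by auto
  have b: "b x' = ereal (stack_op L x' \<bullet> vN + P x' - Q vN)" if "x' \<in> domP" for x'
    unfolding b_def F[OF that] conjugate_primal_G_real[OF dom(2)] by (simp add: inner_diff_left)
  have b': "b x' = \<infinity>" if "x' \<notin> domP" for x'
    unfolding b_def F'[OF that] conjugate_primal_G_real[OF dom(2)] by simp
  have pair: "a v' - b x' \<le> C" if "v' \<in> B2" "x' \<in> B1" for v' x'
  proof (cases "v' \<in> domQ")
    case v': True
    show ?thesis
    proof (cases "x' \<in> domP")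
      case True
      have "a v' - b x' = ereal (P xN - P x' + Q vN - Q v' + stack_op L xN \<bullet> v' - stack_op L x' \<bullet> vN)"
        by (simp add: a[OF v'] b[OF True])
      then show ?thesis using est[OF that(2,1) True v'] by simp
    qed (simp add: a[OF v'] b')
  next
    case False
    then show ?thesis using that b b' by (cases "x' \<in> domP") (auto simp: a')
  qed
  obtain \<alpha> where \<alpha>: "\<And>v'. v' \<in> B2 \<Longrightarrow> v' \<in> domQ \<Longrightarrow> stack_op L xN \<bullet> v' - Q v' \<le> \<alpha>"
    using Q_bounded_above[OF B2(1)] by blast
  obtain \<iota> where \<iota>: "\<And>x'. x' \<in> B1 \<Longrightarrow> x' \<in> domP \<Longrightarrow> \<iota> \<le> stack_op L x' \<bullet> vN + P x'"
    using P_bounded_below[OF B1] by blast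
  define S where "S = (SUP v'\<in>B2. a v')"
  define I where "I = (INF x'\<in>B1. b x')"
  have "S \<le> ereal (\<alpha> + P xN)" unfolding S_def
  proof (rule SUP_least)
    fix v' assume v': "v' \<in> B2"
    show "a v' \<le> ereal (\<alpha> + P xN)"
      using \<alpha>[OF v'] a[of v'] a'[OF v'] by (cases "v' \<in> domQ") auto
  qed
  moreover have "ereal (\<iota> - Q vN) \<le> I" unfolding I_def
  proof (rule INF_greatest)
    fix x' assume x': "x' \<in> B1"
    show "ereal (\<iota> - Q vN) \<le> b x'"
      using \<iota>[OF x'] b[of x'] b'[of x'] by (cases "x' \<in> domP") auto
  qed
  ultimately consider "S = -\<infinity>" "I \<noteq> -\<infinity>" | "I = \<infinity>" "S \<noteq> \<infinity>"
    | s i where "S = ereal s" "I = ereal i"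
    by (cases S; cases I) auto
  then have "S - I \<le> C"
  proof cases
    case 1
    then show ?thesis by (cases I) simp_all
  next
    case 2
    then show ?thesis by (cases S) simp_all
  next
    case (3 s i)
    show ?thesis
    proof (rule ccontr)
      assume "\<not> S - I \<le> C"
      then have "C < ereal (s - i)" using 3 by simp
      from ereal_dense2[OF this] obtain k where k: "C < ereal k" "k < s - i" by auto
      define d where "d = (s - i - k) / 2"
      have "ereal (s - d) < S" "I < ereal (i + d)" using k(2) by (simp_all add: 3 d_def)
      then obtain v' x' where vx: "v' \<in> B2" "ereal (s - d) < a v'" "x' \<in> B1" "b x' < ereal (i + d)"
        unfolding S_def I_def less_SUP_iff INF_less_iff by blast
      have "ereal (s - d) - ereal (i + d) \<le> a v' - b x'"
        using vx by (intro ereal_minus_mono) auto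
      also have "\<dots> \<le> C" using pair[OF vx(1,3)] .
      finally have "ereal k \<le> C" by (simp add: d_def field_simps)
      then show False using k(1) by simp
    qed
  qed
  then show ?thesis unfolding pd_gap_def S_def I_def a_def b_def .
qed

end

section \<open>Convergence of the primal-dual algorithm\<close>

theorem theorem2p1:
  fixes f :: "'h::{real_inner, complete_space} \<Rightarrow> ereal"
    and h :: "'h \<Rightarrow> real"
    and z :: 'h
    and G :: "'m::finite \<Rightarrow> 'g::{real_inner, complete_space} set"
    and g l :: "'m \<Rightarrow> 'g \<Rightarrow> ereal"
    and L :: "'m \<Rightarrow> 'h \<Rightarrow> 'g"
    and r :: "'g ^ 'm"
    and \<mu> \<beta> \<epsilon> :: real
    and \<nu> :: "'m \<Rightarrow> real"
    and \<gamma> :: "nat \<Rightarrow> real"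
    and x p1 :: "nat \<Rightarrow> 'h"
    and v p2 :: "nat \<Rightarrow> 'g ^ 'm"
  assumes G_hilbert: "\<And>i. subspace (G i)" "\<And>i. closed (G i)"
    and f: "f \<in> Gamma_on UNIV"
    and h_convex: "convex_on UNIV h"
    and h_diff: "\<And>y. h differentiable (at y)"
    and h_lipschitz: "\<mu> > 0" "lipschitz_on \<mu> UNIV (gradient_on UNIV h)"
    and r: "r \<in> prod_space G"
    and g: "\<And>i. g i \<in> Gamma_on (G i)"
    and l: "\<And>i. l i \<in> Gamma_on (G i)"
    and l_strong: "\<And>i. \<nu> i > 0" "\<And>i. strongly_convex_on (inverse (\<nu> i)) (G i) (l i)"
    and L: "\<And>i. bounded_linear (L i)" "\<And>i y. L i y \<in> G i" "\<And>i. L i \<noteq> (\<lambda>y. 0)"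
    and z_ran: "z \<in> op_ran (\<lambda>y. subdiff_on UNIV f y
        + (\<Sum>i\<in>UNIV. adjoint (L i) `
             parallel_sum (subdiff_on (G i) (g i)) (subdiff_on (G i) (l i)) (L i y - r $ i))
        + {gradient_on UNIV h y})"
    and beta: "\<beta> = Max (insert \<mu> (range \<nu>)) + sqrt (\<Sum>i\<in>UNIV. (onorm (L i))\<^sup>2)"
    and eps: "\<epsilon> \<in> {0<..<1 / (\<beta> + 1)}"
    and gamma: "incseq \<gamma>" "\<And>n. \<gamma> n \<in> {\<epsilon>..(1 - \<epsilon>) / \<beta>}"
    and v0: "v 0 \<in> prod_space G"
    and p1: "\<And>n. p1 n = prox_on UNIV (\<gamma> n) f
        (x n - \<gamma> n *\<^sub>R (gradient_on UNIV h (x n) + (\<Sum>i\<in>UNIV. adjoint (L i) (v n $ i)) - z))"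
    and p2: "\<And>n i. p2 n $ i = prox_on (G i) (\<gamma> n) (conjugate_on (G i) (g i))
        (v n $ i + \<gamma> n *\<^sub>R (L i (x n) - grad_conj_on (G i) (l i) (v n $ i) - r $ i))"
    and v_step: "\<And>n i. v (Suc n) $ i = \<gamma> n *\<^sub>R L i (p1 n - x n)
        + \<gamma> n *\<^sub>R (grad_conj_on (G i) (l i) (v n $ i) - grad_conj_on (G i) (l i) (p2 n $ i))
        + p2 n $ i"
    and x_step: "\<And>n. x (Suc n) = \<gamma> n *\<^sub>R (\<Sum>i\<in>UNIV. adjoint (L i) (v n $ i - p2 n $ i))
        + \<gamma> n *\<^sub>R (gradient_on UNIV h (x n) - gradient_on UNIV h (p1 n)) + p1 n"
  shows "\<exists>xb vb.
      is_arg_min (primal_obj G f h z g l L r) (\<lambda>y. True) xb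
    \<and> is_arg_max (dual_obj G f h z g l L r) (\<lambda>w. w \<in> prod_space G) vb
    \<comment> \<open>(a)\<close>
    \<and> z - (\<Sum>i\<in>UNIV. adjoint (L i) (vb $ i)) \<in> subdiff_on UNIV f xb + {gradient_on UNIV h xb}
    \<and> (\<forall>i. L i xb - r $ i \<in> subdiff_on (G i) (conjugate_on (G i) (g i)) (vb $ i)
                             + {grad_conj_on (G i) (l i) (vb $ i)})
    \<comment> \<open>(b)\<close>
    \<and> weakly_tendsto x xb \<and> weakly_tendsto p1 xb
    \<and> (\<forall>i. weakly_tendsto (\<lambda>n. v n $ i) (vb $ i) \<and> weakly_tendsto (\<lambda>n. p2 n $ i) (vb $ i))
    \<comment> \<open>(c)\<close>
    \<and> (\<forall>n. (norm (x n - xb))\<^sup>2 / (2 * \<gamma> n)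
              + (\<Sum>i\<in>UNIV. (norm (v n $ i - vb $ i))\<^sup>2 / (2 * \<gamma> n))
           \<le> (norm (x 0 - xb))\<^sup>2 / (2 * \<gamma> 0)
              + (\<Sum>i\<in>UNIV. (norm (v 0 $ i - vb $ i))\<^sup>2 / (2 * \<gamma> 0)))
    \<comment> \<open>(d)\<close>
    \<and> (\<forall>B1 B2. bounded B1 \<and> B2 \<subseteq> prod_space G \<and> bounded B2 \<longrightarrow>
         (\<forall>N\<ge>1. pd_gap G f h z g l L r B1 B2 (ergodic p1 N) (ergodic p2 N)
                   \<le> gap_const (\<gamma> 0) (x 0) (v 0) B1 B2 / ereal (real N)))
    \<comment> \<open>(e)\<close>
    \<and> weakly_tendsto (\<lambda>N. (ergodic p1 N, ergodic p2 N)) (xb, vb)"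
proof -
  interpret CP: composite_problem f h z G g l L r \<mu> \<nu>
    by (rule composite_problem.intro; fact)
  define w where "w n = (x n, v n)" for n
  define p where "p n = (p1 n, p2 n)" for n
  have \<beta>: "\<beta> = CP.smooth_const + CP.L_norm"
    unfolding beta CP.smooth_const_def CP.L_norm_def ..
  have \<beta>_pos: "\<beta> > 0"
  proof -
    have "CP.L_norm \<ge> 0" by (simp add: CP.L_norm_def sum_nonneg)
    then show ?thesis using CP.smooth_const(1) h_lipschitz(1) by (simp add: \<beta>)
  qed
  have \<epsilon>: "0 < \<epsilon>" "\<epsilon> < 1"
  proof -
    show "0 < \<epsilon>" using eps by simp
    have "1 / (\<beta> + 1) \<le> 1" using \<beta>_pos by simp
    then show "\<epsilon> < 1" using eps by simp
  qed
  have \<gamma>: "\<epsilon> \<le> \<gamma> n" "\<gamma> n * \<beta> \<le> 1 - \<epsilon>" for n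
    using gamma(2)[of n] \<beta>_pos by (auto simp: pos_le_divide_eq)
  have \<gamma>_pos: "\<gamma> n > 0" for n using \<gamma>(1)[of n] \<epsilon> by simp
  interpret FBF: forward_backward_forward CP.W CP.A CP.B \<beta> \<epsilon> \<gamma> w p
  proof (rule forward_backward_forward.intro)
    show "norm (CP.B a - CP.B b) \<le> \<beta> * norm (a - b)" if "a \<in> CP.W" "b \<in> CP.W" for a b
      unfolding \<beta> using CP.B_lipschitz[OF that] .
    show "w 0 \<in> CP.W" using v0 by (simp add: w_def CP.mem_W prod_space_def)
    show "w (Suc n) = p n + \<gamma> n *\<^sub>R (CP.B (w n) - CP.B (p n))" for n
    proof -
      have "x (Suc n) = p1 n + \<gamma> n *\<^sub>R (gradient_on UNIV h (x n) + CP.Ladj (v n)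
          - (gradient_on UNIV h (p1 n) + CP.Ladj (p2 n)))"
      proof -
        have eq: "(\<Sum>i\<in>UNIV. adjoint (L i) (v n $ i - p2 n $ i)) = CP.Ladj (v n) - CP.Ladj (p2 n)"
          using CP.Ladj_diff[of "v n" "p2 n"] by simp
        show ?thesis unfolding x_step[of n] eq by (simp add: algebra_simps)
      qed
      moreover have "v (Suc n) = p2 n + \<gamma> n *\<^sub>R ((\<chi> i. grad_conj_on (G i) (l i) (v n $ i) - L i (x n))
          - (\<chi> i. grad_conj_on (G i) (l i) (p2 n $ i) - L i (p1 n)))"
        using v_step[of n] linear_diff[OF bounded_linear.linear[OF L(1)]]
        by (simp add: vec_eq_iff algebra_simps)
      ultimately show ?thesis by (simp add: w_def p_def CP.B_def)
    qed
    show "(1 / \<gamma> n) *\<^sub>R (w n - \<gamma> n *\<^sub>R CP.B (w n) - p n) \<in> CP.A (p n)" if "w n \<in> CP.W" for n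
    proof -
      \<comment> \<open>The algorithm passes \<open>z\<close> and \<open>r\<close> to the proximity operators; here they are moved into \<open>A\<close>.\<close>
      define a where "a = x n - \<gamma> n *\<^sub>R (gradient_on UNIV h (x n) + CP.Ladj (v n) - z)"
      define b where "b i = v n $ i + \<gamma> n *\<^sub>R (L i (x n) - grad_conj_on (G i) (l i) (v n $ i) - r $ i)" for i
      have vG: "v n $ i \<in> G i" for i using that by (simp add: w_def CP.mem_W)
      have bG: "b i \<in> G i" for i
        unfolding b_def
        by (intro subspace_add subspace_scale subspace_diff G_hilbert vG L(2) CP.gl_G CP.r_G)
      have "(1 / \<gamma> n) *\<^sub>R (a - p1 n) \<in> subdiff_on UNIV f (p1 n)"
        unfolding p1 a_def using prox_on_subdiff[OF subspace_UNIV closed_UNIV f \<gamma>_pos UNIV_I] .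
      moreover have "(1 / \<gamma> n) *\<^sub>R (b i - p2 n $ i) \<in> subdiff_on (G i) (CP.gs i) (p2 n $ i)" for i
        using prox_on_subdiff[OF G_hilbert CP.gs \<gamma>_pos bG, of n i] unfolding p2 b_def .
      moreover have "(1 / \<gamma> n) *\<^sub>R (a - p1 n)
          = (1 / \<gamma> n) *\<^sub>R (x n - \<gamma> n *\<^sub>R (gradient_on UNIV h (x n) + CP.Ladj (v n)) - p1 n) + z"
        using \<gamma>_pos[of n] by (simp add: a_def algebra_simps)
      moreover have "(1 / \<gamma> n) *\<^sub>R (b i - p2 n $ i)
          = (1 / \<gamma> n) *\<^sub>R (v n $ i - \<gamma> n *\<^sub>R (grad_conj_on (G i) (l i) (v n $ i) - L i (x n)) - p2 n $ i) - r $ i" for i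
        using \<gamma>_pos[of n] by (simp add: b_def algebra_simps)
      ultimately show ?thesis by (simp add: CP.A_def CP.B_def w_def p_def)
    qed
  qed (fact CP.W CP.A_dom CP.A_mono CP.A_resolvent CP.B_W CP.B_mono \<beta>_pos \<epsilon> \<gamma>)+
  obtain xs vs where "- CP.B (xs, vs) \<in> CP.A (xs, vs)" using CP.zero_exists[OF z_ran] .
  from FBF.weak_convergence[OF this] obtain wb where
    wb: "- CP.B wb \<in> CP.A wb" "weakly_tendsto w wb" "weakly_tendsto p wb" by blast
  obtain xb vb where xvb: "wb = (xb, vb)" by (cases wb)
  \<comment> \<open>Testing with \<open>(u, 0)\<close> and \<open>(0, axis i u)\<close> yields weak convergence of the components.\<close>
  have split: "weakly_tendsto a c \<and> (\<forall>i. weakly_tendsto (\<lambda>n. b n $ i) (d $ i))"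
    if "weakly_tendsto (\<lambda>n. (a n, b n)) (c, d)"
    for a :: "nat \<Rightarrow> 'h" and b :: "nat \<Rightarrow> 'g ^ 'm" and c d
  proof (intro conjI allI)
    show "weakly_tendsto a c" unfolding weakly_tendsto_def
    proof
      fix u show "(\<lambda>n. a n \<bullet> u) \<longlonglongrightarrow> c \<bullet> u"
        using that[unfolded weakly_tendsto_def, rule_format, of "(u, 0)"] by simp
    qed
    show "weakly_tendsto (\<lambda>n. b n $ i) (d $ i)" for i unfolding weakly_tendsto_def
    proof
      fix u show "(\<lambda>n. b n $ i \<bullet> u) \<longlonglongrightarrow> d $ i \<bullet> u"
        using that[unfolded weakly_tendsto_def, rule_format, of "(0, axis i u)"] by (simp add: inner_axis)
    qed
  qed
  have sq: "(norm (a - a'))\<^sup>2 / c + (\<Sum>i\<in>UNIV. (norm (b $ i - b' $ i))\<^sup>2 / c)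
      = (norm ((a, b) - (a', b')))\<^sup>2 / c"
    for a a' :: 'h and b b' :: "'g ^ 'm" and c :: real
    by (simp add: norm_Pair_sq norm_vec_sq add_divide_distrib sum_divide_distrib)
  have p_graph: "(1 / \<gamma> n) *\<^sub>R (w n - w (Suc n)) - CP.B (p1 n, p2 n) \<in> CP.A (p1 n, p2 n)" for n
    using FBF.residual[of n] by (simp add: p_def)
  note p_dom = CP.A_dom_finite[OF p_graph, simplified]
  have gap: "pd_gap G f h z g l L r B1 B2 (ergodic p1 N) (ergodic p2 N)
      \<le> gap_const (\<gamma> 0) (x 0) (v 0) B1 B2 / ereal (real N)"
    if B: "bounded B1" "B2 \<subseteq> prod_space G" "bounded B2" and N: "N \<ge> 1" for B1 B2 N
  proof (rule CP.pd_gap_le)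
    show "ergodic p1 N \<in> CP.domP" "ergodic p2 N \<in> CP.domQ"
      using jensen_ergodic(1)[OF CP.convex_on_P] jensen_ergodic(1)[OF CP.convex_on_Q] p_dom N by auto
    fix x' v' assume B': "x' \<in> B1" "v' \<in> B2" and dom': "x' \<in> CP.domP" "v' \<in> CP.domQ"
    \<comment> \<open>Every term of the averaged gap integrand is at most a weighted decrease of this half squared distance.\<close>
    define D where "D n = (norm (w n - (x', v')))\<^sup>2 / 2" for n
    define gapn where "gapn n = CP.P (p1 n) - CP.P x' + CP.Q (p2 n) - CP.Q v'
        + stack_op L (p1 n) \<bullet> v' - stack_op L x' \<bullet> p2 n" for n
    have "gapn n \<le> (D n - D (Suc n)) / \<gamma> n" for n
    proof -
      have "gapn n \<le> (1 / \<gamma> n) *\<^sub>R (w n - w (Suc n)) \<bullet> ((p1 n, p2 n) - (x', v'))"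
        unfolding gapn_def using CP.saddle_estimate[OF p_graph dom'] .
      also have "\<dots> = ((w n - w (Suc n)) \<bullet> (p n - (x', v'))) / \<gamma> n"
        unfolding inner_scaleR_left p_def by simp
      also have "\<dots> \<le> (D n - D (Suc n)) / \<gamma> n"
      proof (rule divide_right_mono)
        have "\<epsilon> * (norm (w n - p n))\<^sup>2 \<ge> 0" using \<epsilon> by simp
        then show "(w n - w (Suc n)) \<bullet> (p n - (x', v')) \<le> D n - D (Suc n)"
          using FBF.step_estimate[of n "(x', v')"] unfolding D_def by linarith
      qed (use \<gamma>_pos[of n] in simp)
      finally show ?thesis .
    qed
    then have "(\<Sum>n<N. gapn n) \<le> (\<Sum>n<N. (D n - D (Suc n)) / \<gamma> n)" by (intro sum_mono)
    also have "\<dots> \<le> D 0 / \<gamma> 0"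
      by (rule weighted_telescoping_bound[OF gamma(1) \<gamma>_pos]) (simp add: D_def)
    finally have sum_le: "(\<Sum>n<N. gapn n) \<le> D 0 / \<gamma> 0" .
    have "CP.P (ergodic p1 N) - CP.P x' + CP.Q (ergodic p2 N) - CP.Q v'
        + stack_op L (ergodic p1 N) \<bullet> v' - stack_op L x' \<bullet> ergodic p2 N \<le> (\<Sum>n<N. gapn n) / real N"
    proof -
      have NP: "real N > 0" using N by simp
      have "CP.P (ergodic p1 N) \<le> (\<Sum>n<N. CP.P (p1 n)) / real N"
        "CP.Q (ergodic p2 N) \<le> (\<Sum>n<N. CP.Q (p2 n)) / real N"
        using jensen_ergodic(2)[OF CP.convex_on_P] jensen_ergodic(2)[OF CP.convex_on_Q] p_dom N by auto
      moreover have "stack_op L (ergodic p1 N) \<bullet> v' = (\<Sum>n<N. stack_op L (p1 n) \<bullet> v') / real N"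
        unfolding CP.Ladj_inner[symmetric] ergodic_def by (simp add: inner_sum_left)
      moreover have "stack_op L x' \<bullet> ergodic p2 N = (\<Sum>n<N. stack_op L x' \<bullet> p2 n) / real N"
        unfolding ergodic_def by (simp add: inner_sum_right)
      moreover have "(\<Sum>n<N. gapn n) / real N = (\<Sum>n<N. CP.P (p1 n)) / real N - CP.P x'
          + (\<Sum>n<N. CP.Q (p2 n)) / real N - CP.Q v'
          + (\<Sum>n<N. stack_op L (p1 n) \<bullet> v') / real N - (\<Sum>n<N. stack_op L x' \<bullet> p2 n) / real N"
        unfolding gapn_def sum.distrib sum_subtractf add_divide_distrib diff_divide_distrib
        using NP by simp
      ultimately show ?thesis by linarith
    qed
    also have "\<dots> \<le> (D 0 / \<gamma> 0) / real N" using sum_le by (rule divide_right_mono) simp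
    finally have "ereal (CP.P (ergodic p1 N) - CP.P x' + CP.Q (ergodic p2 N) - CP.Q v'
        + stack_op L (ergodic p1 N) \<bullet> v' - stack_op L x' \<bullet> ergodic p2 N)
        \<le> ereal (D 0 / \<gamma> 0) / ereal (real N)" using N by simp
    also have "\<dots> \<le> gap_const (\<gamma> 0) (x 0) (v 0) B1 B2 / ereal (real N)"
    proof (rule ereal_divide_right_mono)
      have "ereal (D 0 / \<gamma> 0) = (case (x', v') of (a, b) \<Rightarrow> ereal ((norm (x 0 - a))\<^sup>2 / (2 * \<gamma> 0)
          + (\<Sum>i\<in>UNIV. (norm (v 0 $ i - b $ i))\<^sup>2 / (2 * \<gamma> 0))))"
        by (simp only: prod.case sq) (simp add: D_def w_def)
      also have "\<dots> \<le> gap_const (\<gamma> 0) (x 0) (v 0) B1 B2"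
        unfolding gap_const_def using B' by (intro SUP_upper) simp
      finally show "ereal (D 0 / \<gamma> 0) \<le> gap_const (\<gamma> 0) (x 0) (v 0) B1 B2" .
    qed (use N in simp)
    finally show "ereal (CP.P (ergodic p1 N) - CP.P x' + CP.Q (ergodic p2 N) - CP.Q v'
        + stack_op L (ergodic p1 N) \<bullet> v' - stack_op L x' \<bullet> ergodic p2 N)
        \<le> gap_const (\<gamma> 0) (x 0) (v 0) B1 B2 / ereal (real N)" .
  qed (use B in auto)
  have fejer: "(norm (x n - xb))\<^sup>2 / (2 * \<gamma> n) + (\<Sum>i\<in>UNIV. (norm (v n $ i - vb $ i))\<^sup>2 / (2 * \<gamma> n))
      \<le> (norm (x 0 - xb))\<^sup>2 / (2 * \<gamma> 0) + (\<Sum>i\<in>UNIV. (norm (v 0 $ i - vb $ i))\<^sup>2 / (2 * \<gamma> 0))" for n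
  proof -
    have "norm (w n - wb) \<le> norm (w 0 - wb)" using decseqD[OF FBF.fejer[OF wb(1)]] by simp
    moreover have "\<gamma> 0 \<le> \<gamma> n" using gamma(1) by (simp add: incseqD)
    ultimately have "(norm (w n - wb))\<^sup>2 / (2 * \<gamma> n) \<le> (norm (w 0 - wb))\<^sup>2 / (2 * \<gamma> 0)"
      using \<gamma>_pos by (intro frac_le power_mono) auto
    then show ?thesis unfolding sq by (simp add: w_def xvb)
  qed
  have primal: "z - CP.Ladj vb \<in> subdiff_on UNIV f xb + {gradient_on UNIV h xb}"
  proof -
    have "z - CP.Ladj vb - gradient_on UNIV h xb \<in> subdiff_on UNIV f xb"
      using wb(1) by (auto simp: xvb CP.A_def CP.B_def algebra_simps)
    then have "(z - CP.Ladj vb - gradient_on UNIV h xb) + gradient_on UNIV h xb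
        \<in> subdiff_on UNIV f xb + {gradient_on UNIV h xb}" by (intro set_plus_intro) simp_all
    then show ?thesis by simp
  qed
  have dual: "L i xb - r $ i \<in> subdiff_on (G i) (CP.gs i) (vb $ i) + {grad_conj_on (G i) (l i) (vb $ i)}" for i
  proof -
    have "L i xb - r $ i - grad_conj_on (G i) (l i) (vb $ i) \<in> subdiff_on (G i) (CP.gs i) (vb $ i)"
      using wb(1) by (auto simp: xvb CP.A_def CP.B_def algebra_simps)
    then have "(L i xb - r $ i - grad_conj_on (G i) (l i) (vb $ i)) + grad_conj_on (G i) (l i) (vb $ i)
        \<in> subdiff_on (G i) (CP.gs i) (vb $ i) + {grad_conj_on (G i) (l i) (vb $ i)}"
      by (intro set_plus_intro) simp_all
    then show ?thesis by simp
  qed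
  have erg: "(\<lambda>N. (ergodic p1 N, ergodic p2 N)) = ergodic p"
    by (rule ext) (simp add: ergodic_def p_def sum_prod)
  note sol = wb(1)[unfolded xvb]
  have wt: "weakly_tendsto (\<lambda>n. (x n, v n)) (xb, vb)" "weakly_tendsto (\<lambda>n. (p1 n, p2 n)) (xb, vb)"
    using wb(2,3) by (simp_all add: w_def[abs_def] p_def[abs_def] xvb)
  show ?thesis
  proof (rule exI[of _ xb], rule exI[of _ vb], intro conjI allI impI)
    show "is_arg_min (primal_obj G f h z g l L r) (\<lambda>y. True) xb"
      using CP.zeros_imp_primal_optimal[OF sol] .
    show "is_arg_max (dual_obj G f h z g l L r) (\<lambda>w. w \<in> prod_space G) vb"
      using CP.zeros_imp_dual_optimal[OF sol] .
    show "weakly_tendsto x xb" "weakly_tendsto (\<lambda>n. v n $ i) (vb $ i)" for i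
      using split[OF wt(1)] by blast+
    show "weakly_tendsto p1 xb" "weakly_tendsto (\<lambda>n. p2 n $ i) (vb $ i)" for i
      using split[OF wt(2)] by blast+
    show "weakly_tendsto (\<lambda>N. (ergodic p1 N, ergodic p2 N)) (xb, vb)"
      unfolding erg using weakly_tendsto_ergodic[OF wb(3)] by (simp add: xvb)
  qed (use primal dual fejer gap in blast)+
qed

end
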